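(* Let $\Omega$ be a Hausdorff locally compact space, let $\mathcal{U}=\{\Omega,A_x,\Theta\}$ be a locally trivial continuous field of Banach algebras, and let the Banach algebra $\mathcal{A}$ be defined by $\mathcal{U}$. Suppose that $\mathcal{A}$ is biprojective. Then (i) the Banach algebras $A_x$, $x\in\Omega$, are uniformly biprojective, and (ii) $\Omega$ is discrete.
   Context: Continuous fields. A continuous field of Banach algebras is a triple $\mathcal{U}=\{\Omega,A_t,\Theta\}$ where $\Omega$ is a locally compact Hausdorff space, $(A_t)_{t\in\Omega}$ is a family of Banach algebras, and $\Theta$ is a subalgebra of $\prod_{t\in\Omega}A_t$ such that: (i) for every $t\in\Omega$ the set $\{x(t):x\in\Theta\}$ is dense in $A_t$; (ii) for every $x\in\Theta$ the function $t\mapsto\|x(t)\|$ is continuous on $\Omega$; (iii) if $x\in\prod_{t}A_t$ and for every $t\in\Omega$ and every $\varepsilon>0$ there is $x'\in\Theta$ with $\|x(s)-x'(s)\|\le\varepsilon$ for all $s$ in some neighbourhood of $t$, then $x\in\Theta$. The Banach algebra $\mathcal{A}$ defined by $\mathcal{U}$ is the set of $x\in\Theta$ such that $t\mapsto\|x(t)\|$ vanishes at infinity on $\Omega$, with pointwise operations and norm $\|x\|=\sup_t\|x(t)\|$. For $Y\subseteq\Omega$, the induced field is $\mathcal{U}|_Y=\{Y,(A_t)_{t\in Y},\Theta|_Y\}$, where $\Theta|_Y$ is the set of $x\in\prod_{t\in Y}A_t$ such that for every $t_0\in Y$ and $\varepsilon>0$ there is $x'\in\Theta$ with $\|x(t)-x'(t)\|\le\varepsilon$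 for all $t\in Y$ in some neighbourhood of $t_0$. An isomorphism of fields over the same space is a family of isometric algebra isomorphisms $\phi_t:A_t\to A'_t$ carrying $\Theta$ into $\Theta'$. The constant field over $\Omega$ defined by a Banach algebra $A$ has $A_t=A$ for all $t$ and $\Theta$ equal to the algebra of all continuous maps $\Omega\to A$. A field is trivial if it is isomorphic to a constant field, and locally trivial if every point of $\Omega$ has a neighbourhood $V$ such that $\mathcal{U}|_V$ is trivial. Projectivity. A Banach algebra $B$ is biprojective if it is a projective Banach $B$-bimodule, where a Banach $B$-bimodule $P$ is projective if every epimorphism of Banach $B$-bimodules $\varphi:Y\to P$ that has a right inverse as a morphism of Banach spaces has a right inverse that is a bimodule morphism. Equivalently for $P=B$: there is a morphism of Banach $B$-bimodules $\rho:B\to B\widehat{\otimes}B$ with $\pi\circ\rho=\mathrm{id}_B$, where $\widehat{\otimes}$ is the projective tensor product and $\pi(a\otimes b)=ab$. The algebras $A_x$, $x\in\Omega$, are uniformly biprojective if for every $x\in\Omega$ there is a morphism of Banach $A_x$-bimodules $\rho_x:A_x\to A_x\widehat{\otimes}A_x$ with $\pi\circ\rho_x=\mathrm{id}_{A_x}$ and $\sup_{x\in\Omega}\|\rho_x\|<\infty$.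
   Formalization: Part (ii), that Ω is discrete, is proved under the added assumption that every Banach algebra A_x is nonzero; without it (ii) fails, e.g. for Ω=[0,1] with all A_x=0. Part (i) is proved without this assumption. *)

theory Defs
  imports "HOL-Analysis.Analysis"
begin

text \<open>
  The fibres of a field of Banach algebras vary with the point, so Banach spaces, algebras and
  bimodules (all over the complex numbers) are structures on carrier sets.  A family indexed by
  the points of a space may always be realised with all its carriers inside one common type.
\<close>

record 'a cspace =
  carr :: "'a set"
  vzero :: 'a
  vadd :: "'a \<Rightarrow> 'a \<Rightarrow> 'a"
  vscale :: "complex \<Rightarrow> 'a \<Rightarrow> 'a"
  vnorm :: "'a \<Rightarrow> real"

definition vsub :: "('a, 'z) cspace_scheme \<Rightarrow> 'a \<Rightarrow> 'a \<Rightarrow> 'a" where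
  "vsub V x y = vadd V x (vscale V (-1) y)"

text \<open>
  The locale \<open>Metric_space\<close> requires symmetry and nonnegativity also outside the carrier, so the
  distance is set to \<open>0\<close> there.
\<close>

definition vdist :: "('a, 'z) cspace_scheme \<Rightarrow> 'a \<Rightarrow> 'a \<Rightarrow> real" where
  "vdist V x y = (if x \<in> carr V \<and> y \<in> carr V then vnorm V (vsub V x y) else 0)"

definition vtop :: "('a, 'z) cspace_scheme \<Rightarrow> 'a topology" where
  "vtop V = Metric_space.mtopology (carr V) (vdist V)"

locale complex_vector_space =
  fixes V :: "('a, 'z) cspace_scheme"
  assumes vzero_closed: "vzero V \<in> carr V"
    and vadd_closed: "\<lbrakk>x \<in> carr V; y \<in> carr V\<rbrakk> \<Longrightarrow> vadd V x y \<in> carr V"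
    and vscale_closed: "x \<in> carr V \<Longrightarrow> vscale V c x \<in> carr V"
    and vadd_assoc: "\<lbrakk>x \<in> carr V; y \<in> carr V; z \<in> carr V\<rbrakk> \<Longrightarrow>
          vadd V (vadd V x y) z = vadd V x (vadd V y z)"
    and vadd_commute: "\<lbrakk>x \<in> carr V; y \<in> carr V\<rbrakk> \<Longrightarrow> vadd V x y = vadd V y x"
    and vadd_zero: "x \<in> carr V \<Longrightarrow> vadd V x (vzero V) = x"
    and vsub_self: "x \<in> carr V \<Longrightarrow> vsub V x x = vzero V"
    and vscale_vadd: "\<lbrakk>x \<in> carr V; y \<in> carr V\<rbrakk> \<Longrightarrow>
          vscale V c (vadd V x y) = vadd V (vscale V c x) (vscale V c y)"
    and vscale_add: "x \<in> carr V \<Longrightarrow> vscale V (c + d) x = vadd V (vscale V c x) (vscale V d x)"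
    and vscale_vscale: "x \<in> carr V \<Longrightarrow> vscale V c (vscale V d x) = vscale V (c * d) x"
    and vscale_one: "x \<in> carr V \<Longrightarrow> vscale V 1 x = x"

locale complex_normed_space = complex_vector_space +
  assumes vnorm_nonneg: "x \<in> carr V \<Longrightarrow> 0 \<le> vnorm V x"
    and vnorm_eq_0_iff: "x \<in> carr V \<Longrightarrow> vnorm V x = 0 \<longleftrightarrow> x = vzero V"
    and vnorm_triangle: "\<lbrakk>x \<in> carr V; y \<in> carr V\<rbrakk> \<Longrightarrow>
          vnorm V (vadd V x y) \<le> vnorm V x + vnorm V y"
    and vnorm_vscale: "x \<in> carr V \<Longrightarrow> vnorm V (vscale V c x) = cmod c * vnorm V x"

lemma (in complex_normed_space) Metric_space_vdist: "Metric_space (carr V) (vdist V)"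
proof
  have sub: "vsub V x y \<in> carr V" if "x \<in> carr V" "y \<in> carr V" for x y
    using that by (simp add: vsub_def vadd_closed vscale_closed)
  have cancel: "vadd V (vscale V (-1) y) y = vzero V" if "y \<in> carr V" for y
    using vsub_self[OF that] that by (simp add: vsub_def vadd_commute vscale_closed)
  have decomp: "vadd V (vsub V x y) (vsub V y z) = vsub V x z"
    if c: "x \<in> carr V" "y \<in> carr V" "z \<in> carr V" for x y z
  proof -
    have "vadd V (vsub V x y) (vsub V y z)
        = vadd V x (vadd V (vadd V (vscale V (-1) y) y) (vscale V (-1) z))"
      using c by (simp add: vsub_def vadd_assoc vadd_closed vscale_closed)
    also have "\<dots> = vsub V x z"
      using c cancel vadd_commute vadd_zero vzero_closed vscale_closed
      by (metis vsub_def)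
    finally show ?thesis .
  qed
  show "0 \<le> vdist V x y" for x y
    by (simp add: vdist_def sub vnorm_nonneg)
  show "vdist V x y = vdist V y x" for x y
  proof -
    have "vsub V y x = vscale V (-1) (vsub V x y)" if "x \<in> carr V" "y \<in> carr V"
      using that by (simp add: vsub_def vscale_vadd vscale_closed vscale_vscale vscale_one vadd_commute)
    then show ?thesis
      by (simp add: vdist_def sub vnorm_vscale)
  qed
  show "vdist V x y = 0 \<longleftrightarrow> x = y" if c: "x \<in> carr V" "y \<in> carr V" for x y
  proof -
    have "x = y" if "vsub V x y = vzero V"
    proof -
      have "x = vadd V x (vadd V (vscale V (-1) y) y)"
        using c cancel vadd_zero by simp
      also have "\<dots> = vadd V (vsub V x y) y"
        using c by (simp add: vsub_def vadd_assoc vscale_closed)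
      also have "\<dots> = y"
        using c that vadd_commute vadd_zero vzero_closed by metis
      finally show ?thesis .
    qed
    then show ?thesis
      using c by (auto simp: vdist_def vnorm_eq_0_iff sub vsub_self)
  qed
  show "vdist V x z \<le> vdist V x y + vdist V y z"
    if "x \<in> carr V" "y \<in> carr V" "z \<in> carr V" for x y z
    using that vnorm_triangle[OF sub sub, of x y y z] by (simp add: vdist_def decomp)
qed

locale complex_banach_space = complex_normed_space +
  assumes complete: "Metric_space.mcomplete (carr V) (vdist V)"

definition linear_op ::
  "('a, 'z) cspace_scheme \<Rightarrow> ('b, 'w) cspace_scheme \<Rightarrow> ('a \<Rightarrow> 'b) \<Rightarrow> bool" where
  "linear_op V W f \<longleftrightarrow>
     f \<in> carr V \<rightarrow> carr W \<and>
     (\<forall>x\<in>carr V. \<forall>y\<in>carr V. f (vadd V x y) = vadd W (f x) (f y)) \<and>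
     (\<forall>c. \<forall>x\<in>carr V. f (vscale V c x) = vscale W c (f x))"

definition bounded_op ::
  "('a, 'z) cspace_scheme \<Rightarrow> ('b, 'w) cspace_scheme \<Rightarrow> ('a \<Rightarrow> 'b) \<Rightarrow> bool" where
  "bounded_op V W f \<longleftrightarrow>
     linear_op V W f \<and> (\<exists>K. \<forall>x\<in>carr V. vnorm W (f x) \<le> K * vnorm V x)"

definition op_norm ::
  "('a, 'z) cspace_scheme \<Rightarrow> ('b, 'w) cspace_scheme \<Rightarrow> ('a \<Rightarrow> 'b) \<Rightarrow> real" where
  "op_norm V W f = Sup {vnorm W (f x) | x. x \<in> carr V \<and> vnorm V x \<le> 1}"

record 'a calgebra = "'a cspace" +
  amul :: "'a \<Rightarrow> 'a \<Rightarrow> 'a"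

text \<open>Banach algebras need not be unital, and the zero algebra is admitted.\<close>

locale complex_banach_algebra = complex_banach_space A
  for A :: "('a, 'z) calgebra_scheme" +
  assumes amul_closed: "\<lbrakk>x \<in> carr A; y \<in> carr A\<rbrakk> \<Longrightarrow> amul A x y \<in> carr A"
    and amul_assoc: "\<lbrakk>x \<in> carr A; y \<in> carr A; z \<in> carr A\<rbrakk> \<Longrightarrow>
          amul A (amul A x y) z = amul A x (amul A y z)"
    and amul_vadd_left: "\<lbrakk>x \<in> carr A; y \<in> carr A; z \<in> carr A\<rbrakk> \<Longrightarrow>
          amul A (vadd A x y) z = vadd A (amul A x z) (amul A y z)"
    and amul_vadd_right: "\<lbrakk>x \<in> carr A; y \<in> carr A; z \<in> carr A\<rbrakk> \<Longrightarrow>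
          amul A x (vadd A y z) = vadd A (amul A x y) (amul A x z)"
    and amul_vscale_left: "\<lbrakk>x \<in> carr A; y \<in> carr A\<rbrakk> \<Longrightarrow>
          amul A (vscale A c x) y = vscale A c (amul A x y)"
    and amul_vscale_right: "\<lbrakk>x \<in> carr A; y \<in> carr A\<rbrakk> \<Longrightarrow>
          amul A x (vscale A c y) = vscale A c (amul A x y)"
    and vnorm_amul: "\<lbrakk>x \<in> carr A; y \<in> carr A\<rbrakk> \<Longrightarrow>
          vnorm A (amul A x y) \<le> vnorm A x * vnorm A y"

record ('b, 'y) cbimodule = "'y cspace" +
  lact :: "'b \<Rightarrow> 'y \<Rightarrow> 'y"
  ract :: "'y \<Rightarrow> 'b \<Rightarrow> 'y"

definition bimodule_on ::
  "('y, 'z) cspace_scheme \<Rightarrow> ('b \<Rightarrow> 'y \<Rightarrow> 'y) \<Rightarrow> ('y \<Rightarrow> 'b \<Rightarrow> 'y) \<Rightarrow> ('b, 'y) cbimodule" where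
  "bimodule_on V l r =
     \<lparr>carr = carr V, vzero = vzero V, vadd = vadd V, vscale = vscale V, vnorm = vnorm V,
      lact = l, ract = r\<rparr>"

locale complex_banach_bimodule = B: complex_banach_algebra B + Y: complex_banach_space Y
  for B :: "('b, 'z) calgebra_scheme" and Y :: "('b, 'y, 'w) cbimodule_scheme" +
  assumes lact_closed: "\<lbrakk>b \<in> carr B; y \<in> carr Y\<rbrakk> \<Longrightarrow> lact Y b y \<in> carr Y"
    and ract_closed: "\<lbrakk>b \<in> carr B; y \<in> carr Y\<rbrakk> \<Longrightarrow> ract Y y b \<in> carr Y"
    and lact_vadd: "\<lbrakk>b \<in> carr B; x \<in> carr Y; y \<in> carr Y\<rbrakk> \<Longrightarrow>
          lact Y b (vadd Y x y) = vadd Y (lact Y b x) (lact Y b y)"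
    and ract_vadd: "\<lbrakk>b \<in> carr B; x \<in> carr Y; y \<in> carr Y\<rbrakk> \<Longrightarrow>
          ract Y (vadd Y x y) b = vadd Y (ract Y x b) (ract Y y b)"
    and vadd_lact: "\<lbrakk>a \<in> carr B; b \<in> carr B; y \<in> carr Y\<rbrakk> \<Longrightarrow>
          lact Y (vadd B a b) y = vadd Y (lact Y a y) (lact Y b y)"
    and vadd_ract: "\<lbrakk>a \<in> carr B; b \<in> carr B; y \<in> carr Y\<rbrakk> \<Longrightarrow>
          ract Y y (vadd B a b) = vadd Y (ract Y y a) (ract Y y b)"
    and lact_vscale: "\<lbrakk>b \<in> carr B; y \<in> carr Y\<rbrakk> \<Longrightarrow>
          lact Y b (vscale Y c y) = vscale Y c (lact Y b y)"
    and ract_vscale: "\<lbrakk>b \<in> carr B; y \<in> carr Y\<rbrakk> \<Longrightarrow>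
          ract Y (vscale Y c y) b = vscale Y c (ract Y y b)"
    and vscale_lact: "\<lbrakk>b \<in> carr B; y \<in> carr Y\<rbrakk> \<Longrightarrow>
          lact Y (vscale B c b) y = vscale Y c (lact Y b y)"
    and vscale_ract: "\<lbrakk>b \<in> carr B; y \<in> carr Y\<rbrakk> \<Longrightarrow>
          ract Y y (vscale B c b) = vscale Y c (ract Y y b)"
    and lact_lact: "\<lbrakk>a \<in> carr B; b \<in> carr B; y \<in> carr Y\<rbrakk> \<Longrightarrow>
          lact Y a (lact Y b y) = lact Y (amul B a b) y"
    and ract_ract: "\<lbrakk>a \<in> carr B; b \<in> carr B; y \<in> carr Y\<rbrakk> \<Longrightarrow>
          ract Y (ract Y y a) b = ract Y y (amul B a b)"
    and lact_ract: "\<lbrakk>a \<in> carr B; b \<in> carr B; y \<in> carr Y\<rbrakk> \<Longrightarrow>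
          ract Y (lact Y a y) b = lact Y a (ract Y y b)"
    and act_bounded: "\<exists>K. \<forall>b\<in>carr B. \<forall>y\<in>carr Y.
          vnorm Y (lact Y b y) \<le> K * vnorm B b * vnorm Y y \<and>
          vnorm Y (ract Y y b) \<le> K * vnorm B b * vnorm Y y"

definition regular_bimodule :: "('b, 'z) calgebra_scheme \<Rightarrow> ('b, 'b) cbimodule" where
  "regular_bimodule B = bimodule_on B (amul B) (amul B)"

definition bimodule_morphism ::
  "('b, 'z) calgebra_scheme \<Rightarrow> ('b, 'x, 'v) cbimodule_scheme \<Rightarrow> ('b, 'y, 'w) cbimodule_scheme \<Rightarrow>
   ('x \<Rightarrow> 'y) \<Rightarrow> bool" where
  "bimodule_morphism B X Y f \<longleftrightarrow>
     bounded_op X Y f \<and>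
     (\<forall>b\<in>carr B. \<forall>x\<in>carr X. f (lact X b x) = lact Y b (f x) \<and> f (ract X x b) = ract Y (f x) b)"

definition bilinear_forms ::
  "('a, 'z) cspace_scheme \<Rightarrow> ('b, 'w) cspace_scheme \<Rightarrow> ('a \<Rightarrow> 'b \<Rightarrow> complex) set" where
  "bilinear_forms E F = {\<beta>.
     (\<forall>x\<in>carr E. \<forall>x'\<in>carr E. \<forall>y\<in>carr F. \<beta> (vadd E x x') y = \<beta> x y + \<beta> x' y) \<and>
     (\<forall>x\<in>carr E. \<forall>y\<in>carr F. \<forall>y'\<in>carr F. \<beta> x (vadd F y y') = \<beta> x y + \<beta> x y') \<and>
     (\<forall>c. \<forall>x\<in>carr E. \<forall>y\<in>carr F. \<beta> (vscale E c x) y = c * \<beta> x y \<and> \<beta> x (vscale F c y) = c * \<beta> x y)}"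

text \<open>
  The algebraic tensor product is the linear span of the evaluation functionals
  \<open>x \<otimes> y = (\<beta> \<mapsto> \<beta> x y)\<close> on the space of all (not necessarily bounded) bilinear forms.  A list of
  pairs stands for the sum of the corresponding elementary tensors; scalars are absorbed
  by the first factor.
\<close>

type_synonym ('a, 'b) tensor = "('a \<Rightarrow> 'b \<Rightarrow> complex) \<Rightarrow> complex"

definition tensor_of ::
  "('a, 'z) cspace_scheme \<Rightarrow> ('b, 'w) cspace_scheme \<Rightarrow> ('a \<times> 'b) list \<Rightarrow> ('a, 'b) tensor" where
  "tensor_of E F xs = (\<lambda>\<beta>\<in>bilinear_forms E F. \<Sum>(x, y)\<leftarrow>xs. \<beta> x y)"

definition alg_tensor ::
  "('a, 'z) cspace_scheme \<Rightarrow> ('b, 'w) cspace_scheme \<Rightarrow> ('a, 'b) tensor cspace" where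
  "alg_tensor E F =
     \<lparr>carr = tensor_of E F ` lists (carr E \<times> carr F),
      vzero = tensor_of E F [],
      vadd = (\<lambda>u v. \<lambda>\<beta>\<in>bilinear_forms E F. u \<beta> + v \<beta>),
      vscale = (\<lambda>c u. \<lambda>\<beta>\<in>bilinear_forms E F. c * u \<beta>),
      vnorm = (\<lambda>u. Inf {(\<Sum>(x, y)\<leftarrow>xs. vnorm E x * vnorm F y) | xs.
                         xs \<in> lists (carr E \<times> carr F) \<and> tensor_of E F xs = u})\<rparr>"

definition cauchy_seqs :: "('a, 'z) cspace_scheme \<Rightarrow> (nat \<Rightarrow> 'a) set" where
  "cauchy_seqs V = {s. range s \<subseteq> carr V \<and>
     (\<forall>\<epsilon>>0. \<exists>N. \<forall>m\<ge>N. \<forall>n\<ge>N. vdist V (s m) (s n) < \<epsilon>)}"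

definition null_rel :: "('a, 'z) cspace_scheme \<Rightarrow> ((nat \<Rightarrow> 'a) \<times> (nat \<Rightarrow> 'a)) set" where
  "null_rel V = {(s, t). s \<in> cauchy_seqs V \<and> t \<in> cauchy_seqs V \<and>
     (\<lambda>n. vdist V (s n) (t n)) \<longlonglongrightarrow> 0}"

definition completion :: "('a, 'z) cspace_scheme \<Rightarrow> (nat \<Rightarrow> 'a) set cspace" where
  "completion V =
     \<lparr>carr = cauchy_seqs V // null_rel V,
      vzero = null_rel V `` {\<lambda>n. vzero V},
      vadd = (\<lambda>X Y. \<Union>s\<in>X. \<Union>t\<in>Y. null_rel V `` {\<lambda>n. vadd V (s n) (t n)}),
      vscale = (\<lambda>c X. \<Union>s\<in>X. null_rel V `` {\<lambda>n. vscale V c (s n)}),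
      vnorm = (\<lambda>X. THE r. \<forall>s\<in>X. (\<lambda>n. vnorm V (s n)) \<longlonglongrightarrow> r)\<rparr>"

type_synonym ('a, 'b) ptensor = "(nat \<Rightarrow> ('a, 'b) tensor) set"

definition proj_tensor ::
  "('a, 'z) cspace_scheme \<Rightarrow> ('b, 'w) cspace_scheme \<Rightarrow> ('a, 'b) ptensor cspace" where
  "proj_tensor E F = completion (alg_tensor E F)"

definition elem_tensor ::
  "('a, 'z) cspace_scheme \<Rightarrow> ('b, 'w) cspace_scheme \<Rightarrow> 'a \<Rightarrow> 'b \<Rightarrow> ('a, 'b) ptensor" where
  "elem_tensor E F x y = null_rel (alg_tensor E F) `` {\<lambda>n. tensor_of E F [(x, y)]}"

text \<open>
  The bounded operator on the projective tensor product induced by a bounded bilinear operator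
  \<open>m\<close>; it is unique because the elementary tensors span a dense subspace.
\<close>

definition tensor_lift ::
  "('a, 'z) cspace_scheme \<Rightarrow> ('b, 'w) cspace_scheme \<Rightarrow> ('c, 'v) cspace_scheme \<Rightarrow>
   ('a \<Rightarrow> 'b \<Rightarrow> 'c) \<Rightarrow> ('a, 'b) ptensor \<Rightarrow> 'c" where
  "tensor_lift E F G m = (THE f.
     f \<in> extensional (carr (proj_tensor E F)) \<and> bounded_op (proj_tensor E F) G f \<and>
     (\<forall>x\<in>carr E. \<forall>y\<in>carr F. f (elem_tensor E F x y) = m x y))"

text \<open>\<open>B \<otimes> B\<close> with \<open>a \<cdot> (x \<otimes> y) \<cdot> b = (a x) \<otimes> (y b)\<close>, and the product map \<open>x \<otimes> y \<mapsto> x y\<close>.\<close>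

definition tensor_bimodule :: "('b, 'z) calgebra_scheme \<Rightarrow> ('b, ('b, 'b) ptensor) cbimodule" where
  "tensor_bimodule B = bimodule_on (proj_tensor B B)
     (\<lambda>a. tensor_lift B B (proj_tensor B B) (\<lambda>x y. elem_tensor B B (amul B a x) y))
     (\<lambda>u b. tensor_lift B B (proj_tensor B B) (\<lambda>x y. elem_tensor B B x (amul B y b)) u)"

definition product_map :: "('b, 'z) calgebra_scheme \<Rightarrow> ('b, 'b) ptensor \<Rightarrow> 'b" where
  "product_map B = tensor_lift B B B (amul B)"

text \<open>
  The definition of projectivity quantifies over all Banach bimodules \<open>Y\<close>.  A definition in HOL
  cannot quantify over types, so the type in which the carriers of the test bimodules \<open>Y\<close> live
  is a parameter.
\<close>

definition projective_bimodule ::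
  "'y itself \<Rightarrow> ('b, 'z) calgebra_scheme \<Rightarrow> ('b, 'p, 'w) cbimodule_scheme \<Rightarrow> bool" where
  "projective_bimodule T B P \<longleftrightarrow>
     (\<forall>(Y :: ('b, 'y) cbimodule) \<phi>.
        complex_banach_bimodule B Y \<longrightarrow>
        bimodule_morphism B Y P \<phi> \<longrightarrow> \<phi> ` carr Y = carr P \<longrightarrow>
        (\<exists>\<sigma>. bounded_op P Y \<sigma> \<and> (\<forall>p\<in>carr P. \<phi> (\<sigma> p) = p)) \<longrightarrow>
        (\<exists>\<psi>. bimodule_morphism B P Y \<psi> \<and> (\<forall>p\<in>carr P. \<phi> (\<psi> p) = p)))"

text \<open>
  For \<open>P = B\<close> the test type below loses nothing.  With \<open>B\<^sub>+\<close> the unitization of \<open>B\<close>, the bimodule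
  \<open>B\<close> is projective as soon as the canonical epimorphism from \<open>B\<^sub>+ \<otimes> B \<otimes> B\<^sub>+\<close> (projective tensor
  product) onto \<open>B\<close>, which is split as an operator, splits as a bimodule morphism.  This Banach
  space has at most \<open>(\<bar>B\<bar> \<cdot> 2\<^sup>\<omega>)\<^sup>\<omega>\<close> elements, and the test type has at least as many
  (if the type \<open>'b\<close> is finite then \<open>B\<close> is zero), so an isomorphic copy of it is among
  the test bimodules.
\<close>

definition biprojective :: "('b, 'z) calgebra_scheme \<Rightarrow> bool" where
  "biprojective B \<longleftrightarrow>
     projective_bimodule TYPE(('b, 'b) ptensor \<times> 'b) B (regular_bimodule B)"

definition uniformly_biprojective :: "'t set \<Rightarrow> ('t \<Rightarrow> ('a, 'z) calgebra_scheme) \<Rightarrow> bool" where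
  "uniformly_biprojective S A \<longleftrightarrow>
     (\<exists>\<rho>. (\<forall>t\<in>S. bimodule_morphism (A t) (regular_bimodule (A t)) (tensor_bimodule (A t)) (\<rho> t) \<and>
                 (\<forall>a\<in>carr (A t). product_map (A t) (\<rho> t a) = a)) \<and>
          bdd_above ((\<lambda>t. op_norm (A t) (proj_tensor (A t) (A t)) (\<rho> t)) ` S))"

record ('t, 'a) cfield =
  base :: "'t topology"
  fibre :: "'t \<Rightarrow> 'a calgebra"
  sections :: "('t \<Rightarrow> 'a) set"

definition all_sections :: "'t set \<Rightarrow> ('t \<Rightarrow> 'a calgebra) \<Rightarrow> ('t \<Rightarrow> 'a) set" where
  "all_sections S A = (\<Pi>\<^sub>E t\<in>S. carr (A t))"

text \<open>Inserting \<open>0\<close> only matters for empty \<open>S\<close>, where \<open>Sup\<close> would be unspecified.\<close>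

definition section_algebra ::
  "'t set \<Rightarrow> ('t \<Rightarrow> 'a calgebra) \<Rightarrow> ('t \<Rightarrow> 'a) set \<Rightarrow> ('t \<Rightarrow> 'a) calgebra" where
  "section_algebra S A C =
     \<lparr>carr = C,
      vzero = (\<lambda>t\<in>S. vzero (A t)),
      vadd = (\<lambda>x y. \<lambda>t\<in>S. vadd (A t) (x t) (y t)),
      vscale = (\<lambda>c x. \<lambda>t\<in>S. vscale (A t) c (x t)),
      vnorm = (\<lambda>x. Sup (insert 0 ((\<lambda>t. vnorm (A t) (x t)) ` S))),
      amul = (\<lambda>x y. \<lambda>t\<in>S. amul (A t) (x t) (y t))\<rparr>"

definition subalgebra_of_product :: "'t set \<Rightarrow> ('t \<Rightarrow> 'a calgebra) \<Rightarrow> ('t \<Rightarrow> 'a) set \<Rightarrow> bool" where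
  "subalgebra_of_product S A C \<longleftrightarrow>
     (let P = section_algebra S A C in
      C \<subseteq> all_sections S A \<and> vzero P \<in> C \<and>
      (\<forall>x\<in>C. \<forall>y\<in>C. vadd P x y \<in> C \<and> amul P x y \<in> C) \<and> (\<forall>c. \<forall>x\<in>C. vscale P c x \<in> C))"

text \<open>
  The sections over the space \<open>X\<close> that near every point of \<open>X\<close> are uniform limits of elements
  of \<open>C\<close>; the elements of \<open>C\<close> may be defined on more than the points of \<open>X\<close>.
\<close>

definition local_closure ::
  "'t topology \<Rightarrow> ('t \<Rightarrow> 'a calgebra) \<Rightarrow> ('t \<Rightarrow> 'a) set \<Rightarrow> ('t \<Rightarrow> 'a) set" where
  "local_closure X A C = {x \<in> all_sections (topspace X) A.
     \<forall>t\<in>topspace X. \<forall>\<epsilon>>0. \<exists>x'\<in>C. \<exists>N. openin X N \<and> t \<in> N \<and>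
       (\<forall>s\<in>N. vdist (A s) (x s) (x' s) \<le> \<epsilon>)}"

definition continuous_field :: "('t, 'a) cfield \<Rightarrow> bool" where
  "continuous_field U \<longleftrightarrow>
     Hausdorff_space (base U) \<and> locally_compact_space (base U) \<and>
     (\<forall>t\<in>topspace (base U). complex_banach_algebra (fibre U t)) \<and>
     subalgebra_of_product (topspace (base U)) (fibre U) (sections U) \<and>
     (\<forall>t\<in>topspace (base U).
        vtop (fibre U t) closure_of {x t | x. x \<in> sections U} = carr (fibre U t)) \<and>
     (\<forall>x\<in>sections U. continuous_map (base U) euclideanreal (\<lambda>t. vnorm (fibre U t) (x t))) \<and>
     local_closure (base U) (fibre U) (sections U) \<subseteq> sections U"

definition vanishing_at_infinity ::
  "'t topology \<Rightarrow> ('t \<Rightarrow> real) \<Rightarrow> bool" where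
  "vanishing_at_infinity X f \<longleftrightarrow>
     (\<forall>\<epsilon>>0. \<exists>K. compactin X K \<and> (\<forall>t\<in>topspace X - K. \<bar>f t\<bar> < \<epsilon>))"

definition field_algebra :: "('t, 'a) cfield \<Rightarrow> ('t \<Rightarrow> 'a) calgebra" where
  "field_algebra U = section_algebra (topspace (base U)) (fibre U)
     {x \<in> sections U. vanishing_at_infinity (base U) (\<lambda>t. vnorm (fibre U t) (x t))}"

definition induced_field :: "('t, 'a) cfield \<Rightarrow> 't set \<Rightarrow> ('t, 'a) cfield" where
  "induced_field U Y =
     \<lparr>base = subtopology (base U) Y, fibre = fibre U,
      sections = local_closure (subtopology (base U) Y) (fibre U) (sections U)\<rparr>"

definition constant_field :: "'t topology \<Rightarrow> 'a calgebra \<Rightarrow> ('t, 'a) cfield" where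
  "constant_field X A =
     \<lparr>base = X, fibre = (\<lambda>t. A),
      sections = {x \<in> all_sections (topspace X) (\<lambda>t. A). continuous_map X (vtop A) x}\<rparr>"

definition isometric_isomorphism ::
  "('a, 'z) calgebra_scheme \<Rightarrow> ('b, 'w) calgebra_scheme \<Rightarrow> ('a \<Rightarrow> 'b) \<Rightarrow> bool" where
  "isometric_isomorphism A B f \<longleftrightarrow>
     linear_op A B f \<and> bij_betw f (carr A) (carr B) \<and>
     (\<forall>x\<in>carr A. \<forall>y\<in>carr A. f (amul A x y) = amul B (f x) (f y)) \<and>
     (\<forall>x\<in>carr A. vnorm B (f x) = vnorm A x)"

text \<open>
  It suffices that the sections are carried into the sections: by density in the fibres and
  closedness under local uniform approximation, they are then carried onto them.
\<close>

definition isomorphic_fields :: "('t, 'a) cfield \<Rightarrow> ('t, 'b) cfield \<Rightarrow> bool" where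
  "isomorphic_fields U U' \<longleftrightarrow>
     base U = base U' \<and>
     (\<exists>\<phi>. (\<forall>t\<in>topspace (base U). isometric_isomorphism (fibre U t) (fibre U' t) (\<phi> t)) \<and>
          (\<forall>x\<in>sections U. (\<lambda>t\<in>topspace (base U). \<phi> t (x t)) \<in> sections U'))"

text \<open>
  Over a nonempty base the algebra defining the constant field is isomorphic to a fibre,
  so it may be taken with carrier in the type of the fibres.
\<close>

definition trivial_field :: "('t, 'a) cfield \<Rightarrow> bool" where
  "trivial_field U \<longleftrightarrow>
     (\<exists>A :: 'a calgebra. complex_banach_algebra A \<and> isomorphic_fields U (constant_field (base U) A))"

definition locally_trivial :: "('t, 'a) cfield \<Rightarrow> bool" where
  "locally_trivial U \<longleftrightarrow>
     (\<forall>t\<in>topspace (base U). \<exists>N V. openin (base U) N \<and> t \<in> N \<and> N \<subseteq> V \<and> V \<subseteq> topspace (base U) \<and>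
        trivial_field (induced_field U V))"

end

theory Submission
  imports Defs
begin

text \<open>
  Write \<open>\<A>\<close> for the algebra of the field, \<open>\<pi>\<close> for the product map and \<open>\<Omega>\<close> for the base space.

  Biprojectivity of \<open>\<A>\<close> yields a bimodule morphism \<open>\<rho> : \<A> \<rightarrow> \<A> \<otimes> \<A>\<close> with \<open>\<pi> (\<rho> x) = x\<close>
  (\<open>biprojective_splitting\<close>).  The test bimodule is \<open>\<A>\<^sub>+ \<otimes> \<A>\<close>, where \<open>\<A>\<^sub>+\<close> has an adjoined unit
  \<open>e\<close>, with its product map onto \<open>\<A>\<close>.  A splitting of it has an \<open>e \<otimes> \<A>\<close> component \<open>\<beta>\<close>, and
  the module identities force \<open>\<beta> b \<otimes> \<beta> b = 0\<close> for all \<open>b\<close>; by Hahn-Banach \<open>\<beta> = 0\<close>.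

  As \<open>x = \<pi> (\<rho> x)\<close>, the products span a dense subspace of \<open>\<A>\<close>.  On a product,
  \<open>\<rho> (a b) = a \<cdot> \<rho> b = \<rho> a \<cdot> b\<close>, and either factor may be multiplied by a scalar function on
  \<open>\<Omega>\<close>.  Hence \<open>\<rho>\<close> commutes with scalar functions acting on either side, and everything about
  \<open>\<rho> x\<close> is local on \<open>\<Omega> \<times> \<Omega>\<close>.

  Evaluating both factors at \<open>t\<close>, the image of \<open>\<rho> x\<close> in \<open>A\<^sub>t \<otimes> A\<^sub>t\<close> depends on \<open>x(t)\<close> only
  (\<open>eval_splitting_eq_vzero\<close>).  Since every \<open>a \<in> A\<^sub>t\<close> is the value of a section of norm at most
  \<open>\<parallel>a\<parallel>\<close> (\<open>section_through\<close>), this defines splittings for the fibres with norm at most \<open>\<parallel>\<rho>\<parallel>\<close>, so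
  the fibres are uniformly biprojective.

  Evaluating the factors at distinct points \<open>s \<noteq> t\<close> gives \<open>0\<close>, because a scalar function separates
  \<open>s\<close> from \<open>t\<close> (\<open>splitting_off_diagonal\<close>).  Near \<open>s\<close> the field is constant, and there the product
  of the two values is a continuous function of \<open>t\<close>, with value \<open>x(s)\<close> at \<open>t = s\<close>
  (\<open>transported_continuous\<close>, \<open>splitting_diagonal\<close>).  If \<open>s\<close> is not isolated then \<open>x(s) = 0\<close> for
  all \<open>x\<close>, so \<open>A\<^sub>s = 0\<close>.
\<close>

section \<open>Seminormed spaces on carrier sets\<close>

lemma (in complex_vector_space) vsub_closed:
  "\<lbrakk>x \<in> carr V; y \<in> carr V\<rbrakk> \<Longrightarrow> vsub V x y \<in> carr V"
  by (simp add: vsub_def vadd_closed vscale_closed)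

lemmas (in complex_vector_space) closed = vzero_closed vadd_closed vscale_closed vsub_closed

lemma (in complex_vector_space) vadd_left_commute:
  "\<lbrakk>x \<in> carr V; y \<in> carr V; z \<in> carr V\<rbrakk> \<Longrightarrow> vadd V x (vadd V y z) = vadd V y (vadd V x z)"
  by (metis vadd_assoc vadd_commute)

lemmas (in complex_vector_space) vadd_ac = vadd_assoc vadd_commute vadd_left_commute

lemma (in complex_vector_space) vadd_zero_left:
  "x \<in> carr V \<Longrightarrow> vadd V (vzero V) x = x"
  using vadd_commute vadd_zero vzero_closed by metis

lemma (in complex_vector_space) vadd_uminus_cancel:
  "\<lbrakk>x \<in> carr V; y \<in> carr V\<rbrakk> \<Longrightarrow> vadd V (vscale V (-1) x) (vadd V x y) = y"
  by (metis vadd_assoc vadd_commute vadd_zero_left vscale_closed vsub_def vsub_self)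

lemma (in complex_vector_space) vadd_vsub_cancel:
  "\<lbrakk>x \<in> carr V; y \<in> carr V\<rbrakk> \<Longrightarrow> vadd V (vsub V x y) y = x"
  by (metis vadd_assoc vadd_commute vadd_zero vscale_closed vsub_def vsub_self)

lemma (in complex_vector_space) vadd_self_eq_vzero:
  assumes "x \<in> carr V" "vadd V x x = x"
  shows "x = vzero V"
  by (metis assms vadd_uminus_cancel vadd_commute vscale_closed vsub_def vsub_self)

lemma (in complex_vector_space) vscale_zero_left: "x \<in> carr V \<Longrightarrow> vscale V 0 x = vzero V"
  by (metis add_0 vadd_self_eq_vzero vscale_add vscale_closed)

lemma (in complex_vector_space) vscale_vzero: "vscale V c (vzero V) = vzero V"
  by (metis vadd_self_eq_vzero vadd_zero vscale_closed vscale_vadd vzero_closed)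

lemma (in complex_vector_space) vsub_vzero: "x \<in> carr V \<Longrightarrow> vsub V x (vzero V) = x"
  by (simp add: vsub_def vscale_vzero vadd_zero)

lemma (in complex_vector_space) vsub_eq_vzero:
  "\<lbrakk>x \<in> carr V; y \<in> carr V; vsub V x y = vzero V\<rbrakk> \<Longrightarrow> x = y"
  by (metis vadd_vsub_cancel vadd_zero_left)

lemma (in complex_vector_space) vsub_telescope:
  assumes "x \<in> carr V" "y \<in> carr V" "z \<in> carr V"
  shows "vadd V (vsub V x y) (vsub V y z) = vsub V x z"
proof -
  have "vadd V (vsub V x y) (vsub V y z) = vadd V (vadd V (vsub V x y) y) (vscale V (-1) z)"
    using assms unfolding vsub_def[of V y z] by (simp add: vadd_assoc closed)
  then show ?thesis
    using assms by (simp add: vadd_vsub_cancel) (simp add: vsub_def)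
qed

lemma (in complex_vector_space) vsub_swap:
  "\<lbrakk>x \<in> carr V; y \<in> carr V\<rbrakk> \<Longrightarrow> vsub V y x = vscale V (-1) (vsub V x y)"
  by (simp add: vsub_def vscale_vadd vscale_closed vscale_vscale vscale_one vadd_commute)

lemma (in complex_vector_space) vsub_vadd_vadd:
  "\<lbrakk>a \<in> carr V; b \<in> carr V; c \<in> carr V; d \<in> carr V\<rbrakk> \<Longrightarrow>
    vsub V (vadd V a b) (vadd V c d) = vadd V (vsub V a c) (vsub V b d)"
  by (simp add: vsub_def vscale_vadd closed vadd_ac)

lemma (in complex_vector_space) vsub_vscale:
  "\<lbrakk>a \<in> carr V; b \<in> carr V\<rbrakk> \<Longrightarrow> vsub V (vscale V c a) (vscale V c b) = vscale V c (vsub V a b)"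
  by (simp add: vsub_def vscale_vadd closed vscale_vscale)

text \<open>Homogeneity of a norm follows from the inequality, applied to \<open>c\<close> and to \<open>1 / c\<close>.\<close>

lemma (in complex_vector_space) homogeneousI:
  assumes nonneg: "\<And>x. x \<in> carr V \<Longrightarrow> 0 \<le> vnorm V x"
    and le: "\<And>c x. x \<in> carr V \<Longrightarrow> vnorm V (vscale V c x) \<le> cmod c * vnorm V x"
    and x: "x \<in> carr V"
  shows "vnorm V (vscale V c x) = cmod c * vnorm V x"
proof (cases "c = 0")
  case True
  then show ?thesis
    using le[OF x, of c] nonneg[OF vscale_closed[OF x], of c] by simp
next
  case False
  have "vnorm V x \<le> cmod (1 / c) * vnorm V (vscale V c x)"
    using le[OF vscale_closed[OF x], of "1 / c" c] False x by (simp add: vscale_vscale vscale_one)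
  then have "cmod c * vnorm V x \<le> vnorm V (vscale V c x)"
    using False by (simp add: norm_divide field_simps)
  then show ?thesis
    using le[OF x, of c] by simp
qed

text \<open>
  The algebraic tensor product is only treated as a seminormed space: showing that its norm is
  definite would take an argument with functionals, while the completion identifies points at
  distance \<open>0\<close> anyway.
\<close>

locale complex_seminormed_space = complex_vector_space +
  assumes seminorm_nonneg: "x \<in> carr V \<Longrightarrow> 0 \<le> vnorm V x"
    and seminorm_triangle: "\<lbrakk>x \<in> carr V; y \<in> carr V\<rbrakk> \<Longrightarrow>
          vnorm V (vadd V x y) \<le> vnorm V x + vnorm V y"
    and seminorm_vscale: "x \<in> carr V \<Longrightarrow> vnorm V (vscale V c x) = cmod c * vnorm V x"

lemmas (in complex_seminormed_space) seminormed = complex_seminormed_space_axioms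

sublocale complex_normed_space \<subseteq> complex_seminormed_space
  by unfold_locales (simp_all add: vnorm_nonneg vnorm_triangle vnorm_vscale)

lemma (in complex_seminormed_space) seminorm_vzero: "vnorm V (vzero V) = 0"
  using seminorm_vscale[OF vzero_closed, of 0] by (simp add: vscale_vzero)

lemma (in complex_seminormed_space) vdist_eq:
  "\<lbrakk>x \<in> carr V; y \<in> carr V\<rbrakk> \<Longrightarrow> vdist V x y = vnorm V (vsub V x y)"
  by (simp add: vdist_def)

lemma (in complex_seminormed_space) vdist_nonneg: "0 \<le> vdist V x y"
  by (simp add: vdist_def seminorm_nonneg closed)

lemma (in complex_seminormed_space) vdist_self: "vdist V x x = 0"
  by (simp add: vdist_def vsub_self seminorm_vzero)

lemma (in complex_seminormed_space) vdist_commute: "vdist V x y = vdist V y x"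
proof (cases "x \<in> carr V \<and> y \<in> carr V")
  case True
  then show ?thesis
    using vsub_swap[of x y] by (simp add: vdist_eq seminorm_vscale closed)
qed (auto simp: vdist_def)

lemma (in complex_seminormed_space) vdist_triangle:
  assumes "x \<in> carr V" "y \<in> carr V" "z \<in> carr V"
  shows "vdist V x z \<le> vdist V x y + vdist V y z"
  using assms seminorm_triangle[of "vsub V x y" "vsub V y z"]
  by (simp add: vdist_eq vsub_telescope closed)

lemma (in complex_seminormed_space) vdist_vadd:
  assumes "a \<in> carr V" "b \<in> carr V" "c \<in> carr V" "d \<in> carr V"
  shows "vdist V (vadd V a b) (vadd V c d) \<le> vdist V a c + vdist V b d"
  using assms seminorm_triangle[of "vsub V a c" "vsub V b d"]
  by (simp add: vdist_eq vsub_vadd_vadd closed)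

lemma (in complex_seminormed_space) vdist_vscale:
  assumes "a \<in> carr V" "b \<in> carr V"
  shows "vdist V (vscale V c a) (vscale V c b) = cmod c * vdist V a b"
  using assms by (simp add: vdist_eq vsub_vscale seminorm_vscale closed)

lemma (in complex_seminormed_space) vdist_vzero: "x \<in> carr V \<Longrightarrow> vdist V x (vzero V) = vnorm V x"
  by (simp add: vdist_eq closed vsub_vzero)

lemma (in complex_seminormed_space) norm_diff_le_vdist:
  assumes "x \<in> carr V" "y \<in> carr V"
  shows "\<bar>vnorm V x - vnorm V y\<bar> \<le> vdist V x y"
  using vdist_triangle[of x y "vzero V"] vdist_triangle[of y x "vzero V"] assms
  by (simp add: vdist_vzero closed vdist_commute[of y x])

definition vlim :: "('a, 'z) cspace_scheme \<Rightarrow> (nat \<Rightarrow> 'a) \<Rightarrow> 'a \<Rightarrow> bool" where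
  "vlim V s x \<longleftrightarrow> (\<lambda>n. vdist V (s n) x) \<longlonglongrightarrow> 0"

lemma (in complex_seminormed_space) vlim_squeeze:
  assumes "\<And>n. vdist V (s n) x \<le> f n" "f \<longlonglongrightarrow> 0"
  shows "vlim V s x"
  unfolding vlim_def
  by (rule tendsto_sandwich[OF _ _ tendsto_const assms(2)]) (simp_all add: vdist_nonneg assms)

lemma (in complex_seminormed_space) vlim_vadd:
  assumes "vlim V s x" "vlim V t y" "\<And>n. s n \<in> carr V" "\<And>n. t n \<in> carr V" "x \<in> carr V" "y \<in> carr V"
  shows "vlim V (\<lambda>n. vadd V (s n) (t n)) (vadd V x y)"
proof (rule vlim_squeeze)
  show "(\<lambda>n. vdist V (s n) x + vdist V (t n) y) \<longlonglongrightarrow> 0"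
    using tendsto_add[OF assms(1,2)[unfolded vlim_def]] by simp
qed (simp add: vdist_vadd assms)

lemma (in complex_seminormed_space) vlim_vscale:
  assumes "vlim V s x" "\<And>n. s n \<in> carr V" "x \<in> carr V"
  shows "vlim V (\<lambda>n. vscale V c (s n)) (vscale V c x)"
  using tendsto_mult_right_zero[OF assms(1)[unfolded vlim_def], of "cmod c"] assms(2,3)
  by (simp add: vlim_def vdist_vscale)

lemma (in complex_seminormed_space) vlim_vnorm:
  assumes "vlim V s x" "\<And>n. s n \<in> carr V" "x \<in> carr V"
  shows "(\<lambda>n. vnorm V (s n)) \<longlonglongrightarrow> vnorm V x"
proof -
  have "(\<lambda>n. vnorm V (s n) - vnorm V x) \<longlonglongrightarrow> 0"
    by (rule Lim_null_comparison[OF _ assms(1)[unfolded vlim_def]])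
      (simp add: norm_diff_le_vdist assms)
  then show ?thesis
    by (simp add: LIM_zero_iff)
qed

lemma (in complex_seminormed_space) vlim_const: "vlim V (\<lambda>n. x) x"
  by (simp add: vlim_def vdist_self)

lemma (in complex_normed_space) eq_if_vdist_zero:
  "\<lbrakk>x \<in> carr V; y \<in> carr V; vdist V x y = 0\<rbrakk> \<Longrightarrow> x = y"
  by (simp add: vdist_eq vnorm_eq_0_iff closed vsub_eq_vzero)

lemma (in complex_normed_space) vlim_unique:
  assumes "vlim V s x" "vlim V s y" "\<And>n. s n \<in> carr V" "x \<in> carr V" "y \<in> carr V"
  shows "x = y"
proof -
  have "(\<lambda>n. vdist V (s n) x + vdist V (s n) y) \<longlonglongrightarrow> 0"
    using tendsto_add[OF assms(1,2)[unfolded vlim_def]] by simp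
  moreover have "vdist V x y \<le> vdist V (s n) x + vdist V (s n) y" for n
    using vdist_triangle[of x "s n" y] assms by (simp add: vdist_commute)
  ultimately have "vdist V x y \<le> 0"
    by (meson LIMSEQ_le_const)
  then show ?thesis
    using vdist_nonneg[of x y] assms by (intro eq_if_vdist_zero) auto
qed

lemma (in complex_banach_space) cauchy_convergent:
  assumes "s \<in> cauchy_seqs V"
  shows "\<exists>x\<in>carr V. vlim V s x"
proof -
  interpret M: Metric_space "carr V" "vdist V"
    by (rule Metric_space_vdist)
  have "M.MCauchy s"
    using assms by (auto simp: cauchy_seqs_def M.MCauchy_def)
  then obtain x where x: "limitin M.mtopology s x sequentially"
    using complete M.mcomplete_def by blast
  then have "x \<in> carr V" "\<forall>e>0. \<exists>N. \<forall>n\<ge>N. vdist V (s n) x < e"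
    unfolding M.limit_metric_sequentially by blast+
  then have "x \<in> carr V" "vlim V s x"
    by (auto simp: vlim_def LIMSEQ_iff vdist_nonneg)
  then show ?thesis
    by blast
qed

lemma (in complex_normed_space) complex_banach_spaceI:
  assumes "\<And>s. s \<in> cauchy_seqs V \<Longrightarrow> \<exists>x\<in>carr V. vlim V s x"
  shows "complex_banach_space V"
proof -
  interpret M: Metric_space "carr V" "vdist V"
    by (rule Metric_space_vdist)
  have "M.mcomplete"
    unfolding M.mcomplete_def
  proof (intro allI impI)
    fix s
    assume "M.MCauchy s"
    then have s: "s \<in> cauchy_seqs V"
      by (auto simp: cauchy_seqs_def M.MCauchy_def)
    then obtain x where "x \<in> carr V" "vlim V s x"
      using assms by blast
    moreover have "s n \<in> carr V" for n
      using s by (auto simp: cauchy_seqs_def)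
    ultimately have "limitin M.mtopology s x sequentially"
      by (simp add: M.limit_metric_sequentially vlim_def LIMSEQ_iff vdist_nonneg)
    then show "\<exists>x. limitin M.mtopology s x sequentially" ..
  qed
  then show ?thesis
    by unfold_locales
qed

lemma linear_opD:
  assumes "linear_op V W f"
  shows "x \<in> carr V \<Longrightarrow> f x \<in> carr W"
    and "\<lbrakk>x \<in> carr V; y \<in> carr V\<rbrakk> \<Longrightarrow> f (vadd V x y) = vadd W (f x) (f y)"
    and "x \<in> carr V \<Longrightarrow> f (vscale V c x) = vscale W c (f x)"
  using assms by (auto simp: linear_op_def)

lemma linear_op_vsub:
  assumes "linear_op V W f" "complex_vector_space V" "x \<in> carr V" "y \<in> carr V"
  shows "f (vsub V x y) = vsub W (f x) (f y)"
  using assms complex_vector_space.vscale_closed[OF assms(2)]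
  by (simp add: vsub_def linear_opD[OF assms(1)])

lemma linear_op_vzero:
  assumes "linear_op V W f" "complex_vector_space V" "complex_vector_space W"
  shows "f (vzero V) = vzero W"
proof -
  interpret V: complex_vector_space V by fact
  interpret W: complex_vector_space W by fact
  show ?thesis
    using linear_op_vsub[OF assms(1,2) V.vzero_closed V.vzero_closed]
    by (simp add: V.vsub_self W.vsub_self V.vzero_closed linear_opD[OF assms(1)])
qed

lemma bounded_op_linear: "bounded_op V W f \<Longrightarrow> linear_op V W f"
  by (simp add: bounded_op_def)

lemma bounded_op_bound:
  assumes "bounded_op V W f" "complex_seminormed_space V"
  obtains K where "0 \<le> K" "\<And>x. x \<in> carr V \<Longrightarrow> vnorm W (f x) \<le> K * vnorm V x"
proof -
  interpret V: complex_seminormed_space V by fact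
  obtain K where K: "\<forall>x\<in>carr V. vnorm W (f x) \<le> K * vnorm V x"
    using assms(1) by (auto simp: bounded_op_def)
  have "vnorm W (f x) \<le> \<bar>K\<bar> * vnorm V x" if "x \<in> carr V" for x
    using K that V.seminorm_nonneg[OF that]
    by (meson abs_ge_self mult_right_mono order_trans)
  then show ?thesis
    using that[of "\<bar>K\<bar>"] by simp
qed

lemma vdist_linear_op_le:
  assumes f: "linear_op V W f" and K: "\<And>x. x \<in> carr V \<Longrightarrow> vnorm W (f x) \<le> K * vnorm V x"
    and V: "complex_seminormed_space V" and xy: "x \<in> carr V" "y \<in> carr V"
  shows "vdist W (f x) (f y) \<le> K * vdist V x y"
proof -
  interpret V: complex_seminormed_space V by fact
  show ?thesis
    using K[of "vsub V x y"] xy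
    by (simp add: vdist_def linear_opD[OF f] linear_op_vsub[OF f] V.complex_vector_space_axioms
        V.vsub_closed)
qed

lemma vlim_bounded_op:
  assumes f: "bounded_op V W f" and V: "complex_seminormed_space V"
    and W: "complex_seminormed_space W"
    and s: "\<And>n. s n \<in> carr V" "x \<in> carr V" "vlim V s x"
  shows "vlim W (\<lambda>n. f (s n)) (f x)"
proof -
  interpret W: complex_seminormed_space W by fact
  obtain K where K: "\<And>x. x \<in> carr V \<Longrightarrow> vnorm W (f x) \<le> K * vnorm V x"
    using f V by (metis bounded_op_bound)
  have lin: "linear_op V W f"
    using f by (simp add: bounded_op_def)
  have "(\<lambda>n. K * vdist V (s n) x) \<longlonglongrightarrow> 0"
    using s(3) tendsto_mult_right_zero unfolding vlim_def by blast
  then show ?thesis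
    using vdist_linear_op_le[OF lin K V s(1,2)] by (intro W.vlim_squeeze) auto
qed

lemma bounded_op_compose:
  assumes f: "bounded_op U V f" and g: "bounded_op V W g"
    and U: "complex_seminormed_space U" and V: "complex_seminormed_space V"
  shows "bounded_op U W (\<lambda>x. g (f x))"
proof -
  interpret U: complex_seminormed_space U by fact
  obtain K where K: "\<And>x. x \<in> carr U \<Longrightarrow> vnorm V (f x) \<le> K * vnorm U x"
    using bounded_op_bound[OF f U] by blast
  obtain L where L: "0 \<le> L" "\<And>x. x \<in> carr V \<Longrightarrow> vnorm W (g x) \<le> L * vnorm V x"
    using bounded_op_bound[OF g V] by blast
  have lin: "linear_op U V f" "linear_op V W g"
    using f g by (auto simp: bounded_op_def)
  have "vnorm W (g (f x)) \<le> (L * K) * vnorm U x" if "x \<in> carr U" for x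
    using L(2)[of "f x"] mult_left_mono[OF K[OF that] L(1)] linear_opD(1)[OF lin(1) that]
    by (simp add: mult.assoc)
  moreover have "linear_op U W (\<lambda>x. g (f x))"
    using lin by (auto simp: linear_op_def Pi_iff)
  ultimately show ?thesis
    unfolding bounded_op_def by blast
qed

lemma bounded_op_vadd:
  assumes f: "bounded_op V W f" and g: "bounded_op V W g"
    and V: "complex_seminormed_space V" and W: "complex_seminormed_space W"
  shows "bounded_op V W (\<lambda>x. vadd W (f x) (g x))"
proof -
  interpret V: complex_seminormed_space V by fact
  interpret W: complex_seminormed_space W by fact
  obtain K where K: "\<And>x. x \<in> carr V \<Longrightarrow> vnorm W (f x) \<le> K * vnorm V x"
    using bounded_op_bound[OF f V] by blast
  obtain L where L: "\<And>x. x \<in> carr V \<Longrightarrow> vnorm W (g x) \<le> L * vnorm V x"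
    using bounded_op_bound[OF g V] by blast
  have lin: "linear_op V W f" "linear_op V W g"
    using f g by (auto simp: bounded_op_def)
  note D = linear_opD[OF lin(1)] linear_opD[OF lin(2)]
  have "vnorm W (vadd W (f x) (g x)) \<le> (K + L) * vnorm V x" if "x \<in> carr V" for x
    using W.seminorm_triangle[of "f x" "g x"] K[OF that] L[OF that] that D
    by (simp add: ring_distribs)
  moreover have "linear_op V W (\<lambda>x. vadd W (f x) (g x))"
    unfolding linear_op_def
    by (auto simp: D W.closed W.vscale_vadd) (simp add: W.vadd_ac W.closed D)
  ultimately show ?thesis
    unfolding bounded_op_def by blast
qed

lemma bounded_op_vscale:
  assumes f: "bounded_op V W f"
    and V: "complex_seminormed_space V" and W: "complex_seminormed_space W"
  shows "bounded_op V W (\<lambda>x. vscale W c (f x))"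
proof -
  interpret W: complex_seminormed_space W by fact
  obtain K where K: "\<And>x. x \<in> carr V \<Longrightarrow> vnorm W (f x) \<le> K * vnorm V x"
    using bounded_op_bound[OF f V] by blast
  have lin: "linear_op V W f"
    using f by (auto simp: bounded_op_def)
  have "vnorm W (vscale W c (f x)) \<le> (cmod c * K) * vnorm V x" if "x \<in> carr V" for x
    using mult_left_mono[OF K[OF that], of "cmod c"] that linear_opD[OF lin]
    by (simp add: W.seminorm_vscale mult.assoc)
  moreover have "linear_op V W (\<lambda>x. vscale W c (f x))"
    unfolding linear_op_def
    by (auto simp: linear_opD[OF lin] W.closed W.vscale_vadd W.vscale_vscale mult.commute)
  ultimately show ?thesis
    unfolding bounded_op_def by blast
qed

section \<open>Bounded functionals separate points\<close>

definition sublinear :: "('a, 'z) cspace_scheme \<Rightarrow> ('a \<Rightarrow> real) \<Rightarrow> bool" where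
  "sublinear V p \<longleftrightarrow>
     (\<forall>x\<in>carr V. \<forall>y\<in>carr V. p (vadd V x y) \<le> p x + p y) \<and>
     (\<forall>r\<ge>0. \<forall>x\<in>carr V. p (vscale V (complex_of_real r) x) \<le> r * p x)"

lemma sublinear_vadd:
  "\<lbrakk>sublinear V p; x \<in> carr V; y \<in> carr V\<rbrakk> \<Longrightarrow> p (vadd V x y) \<le> p x + p y"
  by (simp add: sublinear_def)

lemma sublinear_vscale:
  "\<lbrakk>sublinear V p; x \<in> carr V; 0 \<le> r\<rbrakk> \<Longrightarrow> p (vscale V (complex_of_real r) x) \<le> r * p x"
  by (simp add: sublinear_def)

lemma (in complex_vector_space) sublinear_vzero: "sublinear V p \<Longrightarrow> p (vzero V) = 0"
  using sublinear_vscale[of V p "vzero V" 0] sublinear_vadd[of V p "vzero V" "vzero V"]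
  by (simp add: vscale_vzero vadd_zero closed)

lemma (in complex_vector_space) sublinear_uminus:
  assumes "sublinear V p" "x \<in> carr V"
  shows "- p (vscale V (-1) x) \<le> p x"
proof -
  have "p (vsub V x x) \<le> p x + p (vscale V (-1) x)"
    unfolding vsub_def by (rule sublinear_vadd) (simp_all add: assms closed)
  then show ?thesis
    by (simp add: vsub_self sublinear_vzero assms)
qed

text \<open>
  Lowering a sublinear functional \<open>p\<close> in the direction \<open>a\<close> as far as possible: the result is
  still sublinear and its value at \<open>-a\<close> is at most \<open>-p a\<close>.  A minimal sublinear functional cannot
  be lowered in any direction, and that makes it additive.
\<close>

definition lower_towards ::
  "('a, 'z) cspace_scheme \<Rightarrow> ('a \<Rightarrow> real) \<Rightarrow> 'a \<Rightarrow> 'a \<Rightarrow> real" where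
  "lower_towards V p a x =
     Inf {p (vadd V x (vscale V (complex_of_real t) a)) - t * p a | t. 0 \<le> t}"

context complex_vector_space
begin

lemma lower_towards_bdd:
  assumes p: "sublinear V p" and a: "a \<in> carr V" and x: "x \<in> carr V"
  shows "bdd_below {p (vadd V x (vscale V (complex_of_real t) a)) - t * p a | t. 0 \<le> t}"
proof (rule bdd_belowI)
  fix r
  assume "r \<in> {p (vadd V x (vscale V (complex_of_real t) a)) - t * p a | t. 0 \<le> t}"
  then obtain t where t: "0 \<le> t" and r: "r = p (vadd V x (vscale V (complex_of_real t) a)) - t * p a"
    by blast
  let ?y = "vadd V x (vscale V (complex_of_real t) a)"
  \<comment> \<open>\<open>t a = (-x) + (x + t a)\<close> gives \<open>p (t a) \<le> p (-x) + p (x + t a)\<close>.  Sublinearity bounds \<open>p (t a)\<close>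
      from above by \<open>t p a\<close>; the bound from below needed here comes from scaling by \<open>1 / t\<close>.\<close>
  have "t * p a \<le> p (vscale V (complex_of_real t) a)"
  proof (cases "t = 0")
    case False
    then have "p a \<le> (1 / t) * p (vscale V (complex_of_real t) a)"
      using sublinear_vscale[OF p, of "vscale V (complex_of_real t) a" "1 / t"] t a
      by (simp add: closed vscale_vscale vscale_one)
    then show ?thesis
      using False t by (simp add: field_simps)
  qed (simp add: vscale_zero_left a sublinear_vzero p)
  also have "\<dots> = p (vadd V (vscale V (-1) x) ?y)"
    using a x by (simp add: vadd_uminus_cancel closed)
  also have "\<dots> \<le> p (vscale V (-1) x) + p ?y"
    using a x by (intro sublinear_vadd[OF p]) (simp_all add: closed)
  finally show "- p (vscale V (-1) x) \<le> r"
    using r by simp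
qed

lemma lower_towards_le_at:
  assumes "sublinear V p" "a \<in> carr V" "x \<in> carr V" "0 \<le> t"
  shows "lower_towards V p a x \<le> p (vadd V x (vscale V (complex_of_real t) a)) - t * p a"
  unfolding lower_towards_def
  by (rule cInf_lower[OF _ lower_towards_bdd]) (use assms in auto)

lemma le_lower_towards:
  assumes "\<And>t. 0 \<le> t \<Longrightarrow> r \<le> p (vadd V x (vscale V (complex_of_real t) a)) - t * p a"
  shows "r \<le> lower_towards V p a x"
  unfolding lower_towards_def by (rule cInf_greatest) (use assms in force)+

lemma lower_towards_le:
  assumes "sublinear V p" "a \<in> carr V" "x \<in> carr V"
  shows "lower_towards V p a x \<le> p x"
  using lower_towards_le_at[OF assms order_refl] assms by (simp add: vscale_zero_left vadd_zero)

lemma lower_towards_sublinear: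
  assumes p: "sublinear V p" and a: "a \<in> carr V"
  shows "sublinear V (lower_towards V p a)"
  unfolding sublinear_def
proof (intro conjI ballI allI impI)
  fix x y
  assume x: "x \<in> carr V" and y: "y \<in> carr V"
  let ?q = "lower_towards V p a"
  let ?A = "\<lambda>z t. p (vadd V z (vscale V (complex_of_real t) a)) - t * p a"
  have st: "?q (vadd V x y) \<le> ?A x s + ?A y t" if "0 \<le> s" "0 \<le> t" for s t
  proof -
    have "vadd V (vadd V x y) (vscale V (complex_of_real (s + t)) a) =
        vadd V (vadd V x (vscale V (complex_of_real s) a)) (vadd V y (vscale V (complex_of_real t) a))"
      using a x y by (simp add: vscale_add closed vadd_ac)
    then have "p (vadd V (vadd V x y) (vscale V (complex_of_real (s + t)) a)) \<le>
        p (vadd V x (vscale V (complex_of_real s) a)) + p (vadd V y (vscale V (complex_of_real t) a))"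
      using sublinear_vadd[OF p, of "vadd V x (vscale V (complex_of_real s) a)"
          "vadd V y (vscale V (complex_of_real t) a)"] a x y by (simp add: closed)
    then show ?thesis
      using lower_towards_le_at[OF p a vadd_closed[OF x y], of "s + t"] that
      by (simp add: ring_distribs)
  qed
  have "?q (vadd V x y) - ?A x s \<le> ?q y" if "0 \<le> s" for s
    using st[OF that] by (intro le_lower_towards) (simp add: algebra_simps)
  then have "?q (vadd V x y) - ?q y \<le> ?q x"
    by (intro le_lower_towards) (simp add: algebra_simps)
  then show "?q (vadd V x y) \<le> ?q x + ?q y"
    by simp
next
  fix r :: real and x
  assume r: "0 \<le> r" and x: "x \<in> carr V"
  let ?q = "lower_towards V p a"
  have le: "?q (vscale V (complex_of_real r) x) \<le> r * (p (vadd V x (vscale V (complex_of_real t) a)) - t * p a)"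
    if "0 \<le> t" for t
  proof -
    have "?q (vscale V (complex_of_real r) x) \<le>
        p (vadd V (vscale V (complex_of_real r) x) (vscale V (complex_of_real (r * t)) a)) - (r * t) * p a"
      using r that x by (intro lower_towards_le_at[OF p a]) (simp_all add: closed)
    also have "vadd V (vscale V (complex_of_real r) x) (vscale V (complex_of_real (r * t)) a) =
        vscale V (complex_of_real r) (vadd V x (vscale V (complex_of_real t) a))"
      using x a by (simp add: vscale_vadd vscale_vscale closed)
    also have "p \<dots> \<le> r * p (vadd V x (vscale V (complex_of_real t) a))"
      using r x a by (intro sublinear_vscale[OF p]) (simp_all add: closed)
    finally show ?thesis
      by (simp add: algebra_simps)
  qed
  show "?q (vscale V (complex_of_real r) x) \<le> r * ?q x"
  proof (cases "r = 0")
    case True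
    then show ?thesis
      using le[OF order_refl] by simp
  next
    case False
    with r have "0 < r" by simp
    then have "?q (vscale V (complex_of_real r) x) / r \<le> ?q x"
      using le by (intro le_lower_towards) (simp add: divide_le_eq mult.commute)
    then show ?thesis
      using \<open>0 < r\<close> by (simp add: divide_le_eq mult.commute)
  qed
qed

lemma sublinear_cong_on:
  assumes "sublinear V p" "\<And>x. x \<in> carr V \<Longrightarrow> q x = p x"
  shows "sublinear V q"
  using assms by (simp add: sublinear_def closed)

text \<open>
  All sublinear \<open>q \<le> p\<close> satisfy \<open>-p (-x) \<le> q x\<close>, so chains of them have pointwise infima and Zorn's
  lemma gives a minimal one.  Off the carrier the functionals are set to \<open>0\<close>, so that pointwise
  comparison is antisymmetric.
\<close>

lemma additive_minorant:
  assumes p: "sublinear V p"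
  obtains q where "sublinear V q" "\<And>x. x \<in> carr V \<Longrightarrow> q x \<le> p x"
    "\<And>x y. \<lbrakk>x \<in> carr V; y \<in> carr V\<rbrakk> \<Longrightarrow> q (vadd V x y) = q x + q y"
proof -
  define S where "S = {q. sublinear V q \<and> (\<forall>x\<in>carr V. q x \<le> p x) \<and> (\<forall>x. x \<notin> carr V \<longrightarrow> q x = 0)}"
  define R where "R = (\<lambda>a u :: 'a \<Rightarrow> real. \<forall>x. u x \<le> a x)"
  have po: "partial_order_on S (relation_of R S)"
    by (rule partial_order_on_relation_ofI)
      (auto simp: R_def intro: order_trans intro!: ext antisym)
  have chain: "\<exists>u\<in>S. \<forall>a\<in>C. R a u" if C: "C \<in> Chains (relation_of R S)" for C
  proof (cases "C = {}")
    case True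
    have "(\<lambda>x. if x \<in> carr V then p x else 0) \<in> S"
      unfolding S_def using sublinear_cong_on[OF p] by simp
    with True show ?thesis
      by blast
  next
    case False
    have CS: "q \<in> S" if "q \<in> C" for q
      using C that by (auto simp: Chains_def relation_of_def)
    have cmp: "(\<forall>x. q x \<le> q' x) \<or> (\<forall>x. q' x \<le> q x)" if "q \<in> C" "q' \<in> C" for q q'
      using C that by (auto simp: Chains_def relation_of_def R_def)
    define u where "u = (\<lambda>x. Inf ((\<lambda>q. q x) ` C))"
    have lower: "- p (vscale V (-1) x) \<le> q x" if "q \<in> C" "x \<in> carr V" for q x
      using sublinear_uminus[of q x] CS[OF that(1)] that(2) closed(3)[OF that(2), of "-1"]
      unfolding S_def by force
    have bdd: "bdd_below ((\<lambda>q. q x) ` C)" for x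
    proof (cases "x \<in> carr V")
      case True
      then show ?thesis
        using lower by (intro bdd_belowI2[of _ "- p (vscale V (-1) x)"])
    next
      case False
      then show ?thesis
        using CS unfolding S_def by (intro bdd_belowI2[of _ 0]) fastforce
    qed
    have u_le: "u x \<le> q x" if "q \<in> C" for q x
      unfolding u_def using that by (intro cInf_lower bdd) auto
    have le_u: "r \<le> u x" if "\<And>q. q \<in> C \<Longrightarrow> r \<le> q x" for r x
      unfolding u_def using False that by (intro cInf_greatest) auto
    have "sublinear V u"
      unfolding sublinear_def
    proof (intro conjI ballI allI impI)
      fix x y
      assume xy: "x \<in> carr V" "y \<in> carr V"
      have "u (vadd V x y) - q x \<le> q' y" if q: "q \<in> C" "q' \<in> C" for q q'
      proof -
        obtain r where r: "r \<in> C" "r x \<le> q x" "r y \<le> q' y"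
          using cmp[OF q] q by (metis order_refl)
        then have "u (vadd V x y) \<le> r x + r y"
          using u_le[OF r(1)] CS[OF r(1)] sublinear_vadd xy unfolding S_def
          by (metis (no_types, lifting) mem_Collect_eq order_trans)
        with r show ?thesis by linarith
      qed
      then have "u (vadd V x y) - q x \<le> u y" if "q \<in> C" for q
        using that by (intro le_u)
      then have "u (vadd V x y) - u y \<le> u x"
        by (intro le_u) (simp add: algebra_simps)
      then show "u (vadd V x y) \<le> u x + u y"
        by simp
    next
      fix r :: real and x
      assume r: "0 \<le> r" and x: "x \<in> carr V"
      have le: "u (vscale V (complex_of_real r) x) \<le> r * q x" if "q \<in> C" for q
        using u_le[OF that, of "vscale V (complex_of_real r) x"] CS[OF that]
          sublinear_vscale[of V q x r] r x unfolding S_def by fastforce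
      show "u (vscale V (complex_of_real r) x) \<le> r * u x"
      proof (cases "r = 0")
        case True
        then show ?thesis
          using le False by auto
      next
        case False
        with r have "0 < r" by simp
        then have "u (vscale V (complex_of_real r) x) / r \<le> u x"
          using le by (intro le_u) (simp add: divide_le_eq mult.commute)
        then show ?thesis
          using \<open>0 < r\<close> by (simp add: divide_le_eq mult.commute)
      qed
    qed
    moreover have "u x \<le> p x" if "x \<in> carr V" for x
      using False CS u_le that unfolding S_def by (metis (no_types, lifting) all_not_in_conv mem_Collect_eq order_trans)
    moreover have "u x = 0" if "x \<notin> carr V" for x
    proof -
      have "(\<lambda>q. q x) ` C = {0}"
        using False CS that unfolding S_def by (auto simp: image_def)
      then show ?thesis
        by (simp add: u_def)
    qed
    ultimately have "u \<in> S"
      by (simp add: S_def)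
    then show ?thesis
      using u_le unfolding R_def by blast
  qed
  obtain q where q: "q \<in> S" and min: "\<And>a. a \<in> S \<Longrightarrow> R q a \<Longrightarrow> a = q"
    using predicate_Zorn[OF po chain] by blast
  have q': "sublinear V q" "\<And>x. x \<in> carr V \<Longrightarrow> q x \<le> p x" "\<And>x. x \<notin> carr V \<Longrightarrow> q x = 0"
    using q by (auto simp: S_def)
  have "q (vadd V x y) = q x + q y" if x: "x \<in> carr V" and y: "y \<in> carr V" for x y
  proof (rule antisym)
    let ?l = "\<lambda>x. if x \<in> carr V then lower_towards V q y x else 0"
    have le: "?l z \<le> q z" for z
      using lower_towards_le[OF q'(1) y] q'(3) by simp
    have "?l \<in> S"
      unfolding S_def
      using sublinear_cong_on[OF lower_towards_sublinear[OF q'(1) y], of ?l] le q'(2)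
      by (auto intro: order_trans[OF lower_towards_le[OF q'(1) y]])
    then have "?l = q"
      using le by (intro min) (auto simp: R_def)
    then have "q x = lower_towards V q y x"
      using x by (auto dest: fun_cong[of _ _ x])
    also have "\<dots> \<le> q (vadd V x y) - q y"
      using lower_towards_le_at[OF q'(1) y x, of 1] y by (simp add: vscale_one)
    finally show "q x + q y \<le> q (vadd V x y)"
      by simp
  qed (use q'(1) x y in \<open>simp add: sublinear_vadd\<close>)
  with q' show ?thesis
    by (intro that)
qed

end

definition bounded_functional :: "('a, 'z) cspace_scheme \<Rightarrow> ('a \<Rightarrow> complex) \<Rightarrow> bool" where
  "bounded_functional V l \<longleftrightarrow>
     (\<forall>x\<in>carr V. \<forall>y\<in>carr V. l (vadd V x y) = l x + l y) \<and>
     (\<forall>c. \<forall>x\<in>carr V. l (vscale V c x) = c * l x) \<and>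
     (\<exists>K. \<forall>x\<in>carr V. cmod (l x) \<le> K * vnorm V x)"

text \<open>
  The norm is lowered in the direction \<open>-c\<close>, so an additive minorant \<open>q\<close> has \<open>q c \<le> -\<parallel>c\<parallel>\<close>; and
  \<open>x \<mapsto> q x - \<i> q (\<i> x)\<close> is the complex linear functional with real part \<open>q\<close>.
\<close>

theorem (in complex_seminormed_space) hahn_banach:
  assumes c: "c \<in> carr V"
  obtains l where "bounded_functional V l" "vnorm V c \<noteq> 0 \<Longrightarrow> l c \<noteq> 0"
proof -
  let ?d = "vscale V (-1) c"
  have norm: "sublinear V (vnorm V)"
    by (simp add: sublinear_def seminorm_triangle seminorm_vscale)
  have d: "?d \<in> carr V"
    by (simp add: c closed)
  let ?p = "lower_towards V (vnorm V) ?d"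
  obtain q where q: "sublinear V q" "\<And>x. x \<in> carr V \<Longrightarrow> q x \<le> ?p x"
    "\<And>x y. \<lbrakk>x \<in> carr V; y \<in> carr V\<rbrakk> \<Longrightarrow> q (vadd V x y) = q x + q y"
    using additive_minorant[OF lower_towards_sublinear[OF norm d]] by metis
  have q0: "q (vzero V) = 0"
    by (rule sublinear_vzero[OF q(1)])
  have uminus: "q (vscale V (-1) x) = - q x" if "x \<in> carr V" for x
    using q(3)[of x "vscale V (-1) x"] that vsub_self[OF that]
    by (simp add: closed q0 flip: vsub_def)
  have pos: "q (vscale V (complex_of_real r) x) = r * q x" if r: "0 \<le> r" and x: "x \<in> carr V" for r x
  proof (rule antisym)
    show "q (vscale V (complex_of_real r) x) \<le> r * q x"
      by (rule sublinear_vscale[OF q(1) x r])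
    have "q (vscale V (complex_of_real r) (vscale V (-1) x)) \<le> r * q (vscale V (-1) x)"
      using x by (intro sublinear_vscale[OF q(1) _ r]) (simp add: closed)
    moreover have "vscale V (complex_of_real r) (vscale V (-1) x) =
        vscale V (-1) (vscale V (complex_of_real r) x)"
      using x by (simp add: vscale_vscale)
    ultimately show "r * q x \<le> q (vscale V (complex_of_real r) x)"
      using x by (simp add: uminus closed)
  qed
  have real: "q (vscale V (complex_of_real r) x) = r * q x" if x: "x \<in> carr V" for r x
  proof (cases "0 \<le> r")
    case False
    then have "q (vscale V (complex_of_real (- r)) (vscale V (-1) x)) = (- r) * q (vscale V (-1) x)"
      using x by (intro pos) (simp_all add: closed)
    then show ?thesis
      using x by (simp add: uminus vscale_vscale)
  qed (use pos x in auto)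
  have q_le: "\<bar>q x\<bar> \<le> vnorm V x" if x: "x \<in> carr V" for x
  proof -
    have "q y \<le> vnorm V y" if "y \<in> carr V" for y
      using q(2)[OF that] lower_towards_le[OF norm d that] by simp
    from this[OF x] this[of "vscale V (-1) x"] show ?thesis
      using x by (simp add: uminus closed seminorm_vscale)
  qed
  define l where "l = (\<lambda>x. Complex (q x) (- q (vscale V \<i> x)))"
  have "bounded_functional V l"
    unfolding bounded_functional_def
  proof (intro conjI ballI allI exI)
    fix x y
    assume "x \<in> carr V" "y \<in> carr V"
    then show "l (vadd V x y) = l x + l y"
      by (simp add: l_def q(3) vscale_vadd closed complex_eq_iff)
  next
    fix k x
    assume x: "x \<in> carr V"
    have scale: "q (vscale V (complex_of_real a + complex_of_real b * \<i>) x) = a * q x + b * q (vscale V \<i> x)"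
      for a b
      using x by (simp add: vscale_add q(3) closed real flip: vscale_vscale)
    have "q (vscale V k x) = Re k * q x + Im k * q (vscale V \<i> x)"
      using scale[of "Re k" "Im k"] complex_eq[of k] by (simp add: mult.commute)
    moreover have "q (vscale V \<i> (vscale V k x)) = - Im k * q x + Re k * q (vscale V \<i> x)"
    proof -
      have "\<i> * k = complex_of_real (- Im k) + complex_of_real (Re k) * \<i>"
        by (simp add: complex_eq_iff)
      then show ?thesis
        using scale[of "- Im k" "Re k"] x by (simp add: vscale_vscale)
    qed
    ultimately show "l (vscale V k x) = k * l x"
      by (simp add: l_def complex_eq_iff algebra_simps)
  next
    fix x
    assume x: "x \<in> carr V"
    have "cmod (l x) \<le> \<bar>Re (l x)\<bar> + \<bar>Im (l x)\<bar>"
      by (rule cmod_le)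
    also have "\<dots> \<le> 2 * vnorm V x"
      using q_le[OF x] q_le[of "vscale V \<i> x"] x by (simp add: l_def closed seminorm_vscale)
    finally show "cmod (l x) \<le> 2 * vnorm V x" .
  qed
  moreover have "l c \<noteq> 0" if "vnorm V c \<noteq> 0"
  proof -
    have "q c \<le> ?p c"
      using q(2) c by blast
    have "vadd V c (vscale V 1 ?d) = vzero V"
      using c vsub_self[OF c] by (simp add: vscale_one closed vsub_def)
    have "?p c \<le> - vnorm V ?d"
      using lower_towards_le_at[OF norm d c, of 1] \<open>vadd V c (vscale V 1 ?d) = vzero V\<close>
      by (simp add: seminorm_vzero)
    then have "q c < 0"
      using \<open>q c \<le> ?p c\<close> that seminorm_nonneg[OF c] by (simp add: seminorm_vscale c)
    then show ?thesis
      by (auto simp: l_def complex_eq_iff)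
  qed
  ultimately show ?thesis
    using that by blast
qed

lemma (in complex_normed_space) functionals_separate:
  assumes "x \<in> carr V" "y \<in> carr V" "\<And>l. bounded_functional V l \<Longrightarrow> l x = l y"
  shows "x = y"
proof (rule ccontr)
  assume "x \<noteq> y"
  then have "vnorm V (vsub V x y) \<noteq> 0"
    using assms(1,2) by (metis vnorm_eq_0_iff vsub_closed vsub_eq_vzero)
  moreover obtain l where l: "bounded_functional V l"
    "vnorm V (vsub V x y) \<noteq> 0 \<Longrightarrow> l (vsub V x y) \<noteq> 0"
    using hahn_banach[of "vsub V x y"] assms(1,2) vsub_closed by metis
  moreover have "l (vsub V x y) = l x - l y"
    using l(1) assms(1,2) by (simp add: bounded_functional_def vsub_def closed)
  ultimately show False
    using assms(3)[OF l(1)] by simp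
qed

section \<open>The completion of a seminormed space\<close>

text \<open>The point of the completion that a Cauchy sequence converges to.\<close>

definition limit_point :: "('a, 'z) cspace_scheme \<Rightarrow> (nat \<Rightarrow> 'a) \<Rightarrow> (nat \<Rightarrow> 'a) set" where
  "limit_point V s = null_rel V `` {s}"

definition embed :: "('a, 'z) cspace_scheme \<Rightarrow> 'a \<Rightarrow> (nat \<Rightarrow> 'a) set" where
  "embed V x = limit_point V (\<lambda>n. x)"

context complex_seminormed_space
begin

lemma cauchy_seqs_carr: "s \<in> cauchy_seqs V \<Longrightarrow> s n \<in> carr V"
  by (auto simp: cauchy_seqs_def)

lemma cauchy_seqsI:
  assumes "\<And>n. s n \<in> carr V"
    "\<And>e. 0 < e \<Longrightarrow> \<exists>N. \<forall>m\<ge>N. \<forall>n\<ge>N. vdist V (s m) (s n) < e"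
  shows "s \<in> cauchy_seqs V"
  using assms by (auto simp: cauchy_seqs_def)

lemma cauchy_seqsD:
  assumes "s \<in> cauchy_seqs V" "0 < e"
  obtains N where "\<And>m n. \<lbrakk>N \<le> m; N \<le> n\<rbrakk> \<Longrightarrow> vdist V (s m) (s n) < e"
proof -
  have "\<exists>N. \<forall>m\<ge>N. \<forall>n\<ge>N. vdist V (s m) (s n) < e"
    using assms by (simp add: cauchy_seqs_def)
  then show ?thesis
    using that by blast
qed

end

lemma cauchy_seqs_dominated:
  assumes "s \<in> cauchy_seqs V" "complex_seminormed_space V" "\<And>n. r n \<in> carr W"
    and le: "\<And>m n. vdist W (r m) (r n) \<le> K * vdist V (s m) (s n)"
  shows "r \<in> cauchy_seqs W"
  unfolding cauchy_seqs_def
proof (intro CollectI conjI allI impI)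
  show "range r \<subseteq> carr W"
    using assms(3) by blast
  fix e :: real
  assume "0 < e"
  then have "0 < e / (\<bar>K\<bar> + 1)"
    by (simp add: add_nonneg_pos)
  then obtain N where N: "\<And>m n. \<lbrakk>N \<le> m; N \<le> n\<rbrakk> \<Longrightarrow> vdist V (s m) (s n) < e / (\<bar>K\<bar> + 1)"
    using complex_seminormed_space.cauchy_seqsD[OF assms(2,1)] by blast
  have "vdist W (r m) (r n) < e" if "N \<le> m" "N \<le> n" for m n
  proof -
    have "K * vdist V (s m) (s n) \<le> (\<bar>K\<bar> + 1) * vdist V (s m) (s n)"
      by (intro mult_right_mono complex_seminormed_space.vdist_nonneg assms(2)) simp
    also have "\<dots> < e"
      using N[OF that] by (simp add: pos_less_divide_eq add_nonneg_pos mult.commute)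
    finally show ?thesis
      using le[of m n] by simp
  qed
  then show "\<exists>N. \<forall>m\<ge>N. \<forall>n\<ge>N. vdist W (r m) (r n) < e"
    by blast
qed

context complex_seminormed_space
begin

lemma cauchy_seqs_const: "x \<in> carr V \<Longrightarrow> (\<lambda>n. x) \<in> cauchy_seqs V"
  by (rule cauchy_seqsI) (simp_all add: vdist_self)

lemma cauchy_seqs_vadd:
  assumes s: "s \<in> cauchy_seqs V" and t: "t \<in> cauchy_seqs V"
  shows "(\<lambda>n. vadd V (s n) (t n)) \<in> cauchy_seqs V"
proof (rule cauchy_seqsI)
  note carr = cauchy_seqs_carr[OF s] cauchy_seqs_carr[OF t]
  show "vadd V (s n) (t n) \<in> carr V" for n
    by (simp add: carr closed)
  fix e :: real
  assume e: "0 < e"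
  obtain M where M: "\<And>m n. \<lbrakk>M \<le> m; M \<le> n\<rbrakk> \<Longrightarrow> vdist V (s m) (s n) < e / 2"
    using cauchy_seqsD[OF s, of "e / 2"] e by auto
  obtain N where N: "\<And>m n. \<lbrakk>N \<le> m; N \<le> n\<rbrakk> \<Longrightarrow> vdist V (t m) (t n) < e / 2"
    using cauchy_seqsD[OF t, of "e / 2"] e by auto
  have "vdist V (vadd V (s m) (t m)) (vadd V (s n) (t n)) < e" if "max M N \<le> m" "max M N \<le> n" for m n
    using vdist_vadd[of "s m" "t m" "s n" "t n"] M[of m n] N[of m n] that by (simp add: carr)
  then show "\<exists>N. \<forall>m\<ge>N. \<forall>n\<ge>N. vdist V (vadd V (s m) (t m)) (vadd V (s n) (t n)) < e"
    by blast
qed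

lemma cauchy_seqs_vscale:
  assumes s: "s \<in> cauchy_seqs V"
  shows "(\<lambda>n. vscale V c (s n)) \<in> cauchy_seqs V"
  by (rule cauchy_seqs_dominated[OF s seminormed, of _ _ "cmod c"])
    (simp_all add: cauchy_seqs_carr[OF s] closed vdist_vscale)

lemma null_rel_iff:
  "(s, t) \<in> null_rel V \<longleftrightarrow>
    s \<in> cauchy_seqs V \<and> t \<in> cauchy_seqs V \<and> (\<lambda>n. vdist V (s n) (t n)) \<longlonglongrightarrow> 0"
  by (simp add: null_rel_def)

lemma null_rel_vlim_trans:
  assumes "(\<lambda>n. vdist V (s n) (t n)) \<longlonglongrightarrow> 0" "(\<lambda>n. vdist V (t n) (u n)) \<longlonglongrightarrow> 0"
    "\<And>n. s n \<in> carr V" "\<And>n. t n \<in> carr V" "\<And>n. u n \<in> carr V"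
  shows "(\<lambda>n. vdist V (s n) (u n)) \<longlonglongrightarrow> 0"
proof (rule tendsto_sandwich[OF _ _ tendsto_const])
  show "(\<lambda>n. vdist V (s n) (t n) + vdist V (t n) (u n)) \<longlonglongrightarrow> 0"
    using tendsto_add[OF assms(1,2)] by simp
qed (simp_all add: vdist_nonneg vdist_triangle assms)

lemma equiv_null_rel: "equiv (cauchy_seqs V) (null_rel V)"
proof (rule equivI)
  show "null_rel V \<subseteq> cauchy_seqs V \<times> cauchy_seqs V"
    by (auto simp: null_rel_iff)
  show "refl_on (cauchy_seqs V) (null_rel V)"
    by (auto simp: refl_on_def null_rel_iff vdist_self)
  show "sym (null_rel V)"
    by (auto simp: sym_def null_rel_iff vdist_commute)
  show "trans (null_rel V)"
    unfolding trans_def null_rel_iff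
    by (auto intro: null_rel_vlim_trans cauchy_seqs_carr)
qed

lemma limit_point_eq_iff:
  assumes "s \<in> cauchy_seqs V" "t \<in> cauchy_seqs V"
  shows "limit_point V s = limit_point V t \<longleftrightarrow> (\<lambda>n. vdist V (s n) (t n)) \<longlonglongrightarrow> 0"
  using eq_equiv_class_iff[OF equiv_null_rel assms] assms
  by (simp add: limit_point_def null_rel_iff)

lemma carr_completionE:
  assumes "X \<in> carr (completion V)"
  obtains s where "s \<in> cauchy_seqs V" "X = limit_point V s"
  using assms by (auto simp: completion_def limit_point_def elim: quotientE)

lemma limit_point_closed: "s \<in> cauchy_seqs V \<Longrightarrow> limit_point V s \<in> carr (completion V)"
  by (simp add: completion_def limit_point_def quotientI)

lemma vzero_completion: "vzero (completion V) = embed V (vzero V)"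
  by (simp add: completion_def limit_point_def embed_def)

lemma vadd_completion:
  assumes "s \<in> cauchy_seqs V" "t \<in> cauchy_seqs V"
  shows "vadd (completion V) (limit_point V s) (limit_point V t) =
    limit_point V (\<lambda>n. vadd V (s n) (t n))"
proof -
  have "congruent2 (null_rel V) (null_rel V) (\<lambda>s t. null_rel V `` {\<lambda>n. vadd V (s n) (t n)})"
  proof (rule congruent2I')
    fix s s' t t'
    assume "(s, s') \<in> null_rel V" "(t, t') \<in> null_rel V"
    then have a: "s \<in> cauchy_seqs V" "s' \<in> cauchy_seqs V" "t \<in> cauchy_seqs V" "t' \<in> cauchy_seqs V"
      and l: "(\<lambda>n. vdist V (s n) (s' n) + vdist V (t n) (t' n)) \<longlonglongrightarrow> 0 + 0"
      by (auto simp only: null_rel_iff intro: tendsto_add)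
    have "(\<lambda>n. vdist V (vadd V (s n) (t n)) (vadd V (s' n) (t' n))) \<longlonglongrightarrow> 0"
      by (rule tendsto_sandwich[OF _ _ tendsto_const l[unfolded add_0]])
        (simp_all add: vdist_nonneg vdist_vadd cauchy_seqs_carr a)
    then show "null_rel V `` {\<lambda>n. vadd V (s n) (t n)} = null_rel V `` {\<lambda>n. vadd V (s' n) (t' n)}"
      using limit_point_eq_iff[OF cauchy_seqs_vadd[OF a(1,3)] cauchy_seqs_vadd[OF a(2,4)]]
      by (simp add: limit_point_def)
  qed
  from UN_equiv_class2[OF equiv_null_rel equiv_null_rel this assms] show ?thesis
    by (simp add: completion_def limit_point_def)
qed

lemma vscale_completion:
  assumes "s \<in> cauchy_seqs V"
  shows "vscale (completion V) c (limit_point V s) = limit_point V (\<lambda>n. vscale V c (s n))"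
proof -
  have "congruent (null_rel V) (\<lambda>s. null_rel V `` {\<lambda>n. vscale V c (s n)})"
  proof (rule congruentI)
    fix s s'
    assume "(s, s') \<in> null_rel V"
    then have a: "s \<in> cauchy_seqs V" "s' \<in> cauchy_seqs V"
      and l: "(\<lambda>n. vdist V (s n) (s' n)) \<longlonglongrightarrow> 0"
      by (auto simp: null_rel_iff)
    have "(\<lambda>n. vdist V (vscale V c (s n)) (vscale V c (s' n))) \<longlonglongrightarrow> 0"
      using tendsto_mult_right_zero[OF l, of "cmod c"] by (simp add: vdist_vscale cauchy_seqs_carr a)
    then show "null_rel V `` {\<lambda>n. vscale V c (s n)} = null_rel V `` {\<lambda>n. vscale V c (s' n)}"
      using limit_point_eq_iff a cauchy_seqs_vscale unfolding limit_point_def by blast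
  qed
  from UN_equiv_class[OF equiv_null_rel this assms] show ?thesis
    by (simp add: completion_def limit_point_def)
qed

lemma vsub_completion:
  assumes "s \<in> cauchy_seqs V" "t \<in> cauchy_seqs V"
  shows "vsub (completion V) (limit_point V s) (limit_point V t) =
    limit_point V (\<lambda>n. vsub V (s n) (t n))"
  by (simp add: vsub_def vscale_completion vadd_completion assms cauchy_seqs_vscale)

lemma vnorm_completion:
  assumes s: "s \<in> cauchy_seqs V"
  shows "(\<lambda>n. vnorm V (s n)) \<longlonglongrightarrow> vnorm (completion V) (limit_point V s)"
proof -
  have "Cauchy (\<lambda>n. vnorm V (s n))"
  proof (rule CauchyI)
    fix e :: real
    assume "0 < e"
    then obtain N where N: "\<And>m n. \<lbrakk>N \<le> m; N \<le> n\<rbrakk> \<Longrightarrow> vdist V (s m) (s n) < e"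
      using cauchy_seqsD[OF s] by blast
    have "norm (vnorm V (s m) - vnorm V (s n)) < e" if "N \<le> m" "N \<le> n" for m n
      using N[OF that] norm_diff_le_vdist[of "s m" "s n"] cauchy_seqs_carr[OF s] by simp
    then show "\<exists>N. \<forall>m\<ge>N. \<forall>n\<ge>N. norm (vnorm V (s m) - vnorm V (s n)) < e"
      by blast
  qed
  then obtain r where r: "(\<lambda>n. vnorm V (s n)) \<longlonglongrightarrow> r"
    using real_Cauchy_convergent convergent_def by blast
  have all: "\<forall>t\<in>limit_point V s. (\<lambda>n. vnorm V (t n)) \<longlonglongrightarrow> r"
  proof
    fix t
    assume "t \<in> limit_point V s"
    then have t: "t \<in> cauchy_seqs V" and l: "(\<lambda>n. vdist V (s n) (t n)) \<longlonglongrightarrow> 0"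
      by (auto simp: limit_point_def null_rel_iff)
    have "(\<lambda>n. vnorm V (s n) - vnorm V (t n)) \<longlonglongrightarrow> 0"
      by (rule Lim_null_comparison[OF _ l]) (simp add: norm_diff_le_vdist cauchy_seqs_carr s t)
    then show "(\<lambda>n. vnorm V (t n)) \<longlonglongrightarrow> r"
      using tendsto_diff[OF r] by fastforce
  qed
  have "s \<in> limit_point V s"
    using s by (simp add: limit_point_def null_rel_iff vdist_self)
  then have "(THE r. \<forall>t\<in>limit_point V s. (\<lambda>n. vnorm V (t n)) \<longlonglongrightarrow> r) = r"
    using all by (intro the_equality) (auto dest: LIMSEQ_unique)
  then show ?thesis
    using r by (simp add: completion_def)
qed

lemma complex_normed_space_completion: "complex_normed_space (completion V)"
proof unfold_locales
  let ?C = "completion V"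
  note L = limit_point_closed cauchy_seqs_carr cauchy_seqs_const cauchy_seqs_vadd cauchy_seqs_vscale closed
  note R = vzero_completion embed_def vadd_completion vscale_completion vsub_completion
  show "vzero ?C \<in> carr ?C"
    by (simp add: L R)
  fix x y z c d
  assume "x \<in> carr ?C"
  then obtain s where s: "s \<in> cauchy_seqs V" "x = limit_point V s"
    by (rule carr_completionE)
  show "vscale ?C c x \<in> carr ?C" "vadd ?C x (vzero ?C) = x" "vsub ?C x x = vzero ?C"
    "vscale ?C (c + d) x = vadd ?C (vscale ?C c x) (vscale ?C d x)"
    "vscale ?C c (vscale ?C d x) = vscale ?C (c * d) x" "vscale ?C 1 x = x"
    by (simp_all add: s L R vadd_zero vsub_self vscale_add vscale_vscale vscale_one)
  note ns = vnorm_completion[OF s(1)]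
  show nonneg: "0 \<le> vnorm ?C x"
    using LIMSEQ_le_const[OF ns] seminorm_nonneg[OF cauchy_seqs_carr[OF s(1)]] s(2) by auto
  have "vnorm ?C x = 0 \<longleftrightarrow> (\<lambda>n. vnorm V (s n)) \<longlonglongrightarrow> 0"
    using ns s(2) LIMSEQ_unique by metis
  also have "\<dots> \<longleftrightarrow> x = vzero ?C"
    using limit_point_eq_iff[OF s(1) cauchy_seqs_const[OF vzero_closed]] s
    by (simp add: R vdist_vzero L)
  finally show "vnorm ?C x = 0 \<longleftrightarrow> x = vzero ?C" .
  have "(\<lambda>n. vnorm V (vscale V c (s n))) \<longlonglongrightarrow> cmod c * vnorm ?C x"
    using tendsto_mult_left[OF ns, of "cmod c"] s by (simp add: seminorm_vscale L)
  then show "vnorm ?C (vscale ?C c x) = cmod c * vnorm ?C x"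
    using vnorm_completion[OF cauchy_seqs_vscale[OF s(1)]] s LIMSEQ_unique
    by (metis vscale_completion)
  assume "y \<in> carr ?C"
  then obtain t where t: "t \<in> cauchy_seqs V" "y = limit_point V t"
    by (rule carr_completionE)
  show "vadd ?C x y \<in> carr ?C" "vadd ?C x y = vadd ?C y x"
    "vscale ?C c (vadd ?C x y) = vadd ?C (vscale ?C c x) (vscale ?C c y)"
    by (simp_all add: s t L R vscale_vadd) (simp add: vadd_commute L s t)
  have "vnorm V (vadd V (s n) (t n)) \<le> vnorm V (s n) + vnorm V (t n)" for n
    by (simp add: seminorm_triangle L s t)
  then show "vnorm ?C (vadd ?C x y) \<le> vnorm ?C x + vnorm ?C y"
    using LIMSEQ_le[OF vnorm_completion[OF cauchy_seqs_vadd[OF s(1) t(1)]]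
        tendsto_add[OF ns vnorm_completion[OF t(1)]]]
    by (simp add: s t R)
  assume "z \<in> carr ?C"
  then obtain u where "u \<in> cauchy_seqs V" "z = limit_point V u"
    by (rule carr_completionE)
  then show "vadd ?C (vadd ?C x y) z = vadd ?C x (vadd ?C y z)"
    by (simp add: s t L R vadd_assoc)
qed

lemma embed_closed: "x \<in> carr V \<Longrightarrow> embed V x \<in> carr (completion V)"
  by (simp add: embed_def limit_point_closed cauchy_seqs_const)

lemma vdist_completion:
  assumes "s \<in> cauchy_seqs V" "t \<in> cauchy_seqs V"
  shows "(\<lambda>n. vdist V (s n) (t n)) \<longlonglongrightarrow> vdist (completion V) (limit_point V s) (limit_point V t)"
proof -
  have "(\<lambda>n. vsub V (s n) (t n)) \<in> cauchy_seqs V"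
    by (simp add: vsub_def cauchy_seqs_vadd cauchy_seqs_vscale assms)
  from vnorm_completion[OF this] show ?thesis
    using assms by (simp add: vdist_def limit_point_closed vsub_completion cauchy_seqs_carr)
qed

lemma vdist_embed:
  assumes "x \<in> carr V" "y \<in> carr V"
  shows "vdist (completion V) (embed V x) (embed V y) = vdist V x y"
  using vdist_completion[OF cauchy_seqs_const[OF assms(1)] cauchy_seqs_const[OF assms(2)]]
  by (simp add: embed_def LIMSEQ_const_iff)

lemma vlim_embed:
  assumes s: "s \<in> cauchy_seqs V"
  shows "vlim (completion V) (\<lambda>n. embed V (s n)) (limit_point V s)"
proof -
  interpret C: complex_normed_space "completion V"
    by (rule complex_normed_space_completion)
  show ?thesis
    unfolding vlim_def LIMSEQ_iff
  proof (intro allI impI)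
    fix e :: real
    assume e: "0 < e"
    obtain N where N: "\<And>m n. \<lbrakk>N \<le> m; N \<le> n\<rbrakk> \<Longrightarrow> vdist V (s m) (s n) < e / 2"
      using cauchy_seqsD[OF s, of "e / 2"] e by auto
    have "vdist (completion V) (embed V (s n)) (limit_point V s) \<le> e / 2" if "N \<le> n" for n
      unfolding embed_def
      using vdist_completion[OF cauchy_seqs_const[OF cauchy_seqs_carr[OF s, of n]] s]
      by (rule LIMSEQ_le_const2) (use N[OF that] less_imp_le in blast)
    then show "\<exists>N. \<forall>n\<ge>N. norm (vdist (completion V) (embed V (s n)) (limit_point V s) - 0) < e"
      using e by (intro exI[of _ N]) (force simp: C.vdist_nonneg)
  qed
qed

text \<open>
  A Cauchy sequence in the completion stays within \<open>1 / (n + 1)\<close> of embedded points; these form a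
  Cauchy sequence of \<open>V\<close>, whose class is the limit.
\<close>

lemma complex_banach_space_completion: "complex_banach_space (completion V)"
proof -
  let ?C = "completion V"
  interpret C: complex_normed_space ?C
    by (rule complex_normed_space_completion)
  show ?thesis
  proof (rule C.complex_banach_spaceI)
    fix S
    assume S: "S \<in> cauchy_seqs ?C"
    note SC = C.cauchy_seqs_carr[OF S]
    have "\<exists>v. v \<in> carr V \<and> vdist ?C (S n) (embed V v) < inverse (real (Suc n))" for n
    proof -
      obtain s where s: "s \<in> cauchy_seqs V" "S n = limit_point V s"
        by (rule carr_completionE[OF SC])
      have "\<exists>N. \<forall>k\<ge>N. vdist ?C (embed V (s k)) (S n) < inverse (real (Suc n))"
        using vlim_embed[OF s(1)] unfolding vlim_def LIMSEQ_iff s(2)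
        by (auto simp: C.vdist_nonneg dest!: spec[of _ "inverse (real (Suc n))"])
      then show ?thesis
        using cauchy_seqs_carr[OF s(1)] by (metis C.vdist_commute order_refl)
    qed
    then obtain v where v: "\<And>n. v n \<in> carr V"
      "\<And>n. vdist ?C (S n) (embed V (v n)) < inverse (real (Suc n))"
      by metis
    have near: "(\<lambda>n. vdist ?C (S n) (embed V (v n))) \<longlonglongrightarrow> 0"
      by (rule tendsto_sandwich[OF _ _ tendsto_const LIMSEQ_inverse_real_of_nat])
        (auto simp: C.vdist_nonneg simp del: of_nat_Suc intro!: always_eventually less_imp_le v(2))
    have vC: "v \<in> cauchy_seqs V"
    proof (rule cauchy_seqsI)
      fix e :: real
      assume e: "0 < e"
      obtain M where M: "\<And>m n. \<lbrakk>M \<le> m; M \<le> n\<rbrakk> \<Longrightarrow> vdist ?C (S m) (S n) < e / 3"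
        using C.cauchy_seqsD[OF S, of "e / 3"] e by auto
      have "eventually (\<lambda>n. vdist ?C (S n) (embed V (v n)) < e / 3) sequentially"
        using order_tendstoD(2)[OF near, of "e / 3"] e by simp
      then obtain N where N: "\<And>n. N \<le> n \<Longrightarrow> vdist ?C (S n) (embed V (v n)) < e / 3"
        unfolding eventually_sequentially by blast
      have "vdist V (v m) (v n) < e" if "max M N \<le> m" "max M N \<le> n" for m n
      proof -
        have "vdist V (v m) (v n) = vdist ?C (embed V (v m)) (embed V (v n))"
          by (simp add: vdist_embed v)
        also have "\<dots> \<le> vdist ?C (embed V (v m)) (S m) + vdist ?C (S m) (embed V (v n))"
          by (intro C.vdist_triangle embed_closed v SC)
        also have "vdist ?C (S m) (embed V (v n)) \<le> vdist ?C (S m) (S n) + vdist ?C (S n) (embed V (v n))"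
          by (intro C.vdist_triangle embed_closed v SC)
        finally show ?thesis
          using M[of m n] N[of m] N[of n] that by (simp add: C.vdist_commute[of _ "S m"])
      qed
      then show "\<exists>N. \<forall>m\<ge>N. \<forall>n\<ge>N. vdist V (v m) (v n) < e"
        by blast
    qed (rule v)
    have "vlim ?C S (limit_point V v)"
    proof (rule C.vlim_squeeze)
      show "vdist ?C (S n) (limit_point V v) \<le>
          vdist ?C (S n) (embed V (v n)) + vdist ?C (embed V (v n)) (limit_point V v)" for n
        by (intro C.vdist_triangle embed_closed v SC limit_point_closed vC)
      show "(\<lambda>n. vdist ?C (S n) (embed V (v n)) + vdist ?C (embed V (v n)) (limit_point V v)) \<longlonglongrightarrow> 0"
        using tendsto_add[OF near vlim_embed[OF vC, unfolded vlim_def]] by simp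
    qed
    then show "\<exists>x\<in>carr ?C. vlim ?C S x"
      using limit_point_closed[OF vC] by blast
  qed
qed

lemma vnorm_embed: "x \<in> carr V \<Longrightarrow> vnorm (completion V) (embed V x) = vnorm V x"
  using vnorm_completion[OF cauchy_seqs_const, of x] by (simp add: embed_def LIMSEQ_const_iff)

lemma bounded_op_embed: "bounded_op V (completion V) (embed V)"
  unfolding bounded_op_def linear_op_def
  by (auto simp: embed_closed vnorm_embed intro!: exI[of _ 1])
    (simp_all add: embed_def vadd_completion vscale_completion cauchy_seqs_const)

end

text \<open>
  \<open>f\<close> maps Cauchy sequences to convergent ones and nearby sequences to nearby ones, so \<open>F X\<close> is the
  limit of \<open>f\<close> along any sequence representing \<open>X\<close>.
\<close>

lemma completion_extend:
  assumes V: "complex_seminormed_space V" and G: "complex_banach_space G"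
    and f: "linear_op V G f" and K: "\<And>x. x \<in> carr V \<Longrightarrow> vnorm G (f x) \<le> K * vnorm V x"
  obtains F where "linear_op (completion V) G F" "\<And>x. x \<in> carr V \<Longrightarrow> F (embed V x) = f x"
    "\<And>X. X \<in> carr (completion V) \<Longrightarrow> vnorm G (F X) \<le> K * vnorm (completion V) X"
proof -
  interpret V: complex_seminormed_space V by fact
  interpret G: complex_banach_space G by fact
  interpret C: complex_banach_space "completion V"
    by (rule V.complex_banach_space_completion)
  let ?C = "completion V"
  have fG: "f x \<in> carr G" if "x \<in> carr V" for x
    using that f by (simp add: linear_opD)
  note dist_le = vdist_linear_op_le[OF f K V]
  have cau: "\<exists>y\<in>carr G. vlim G (\<lambda>n. f (s n)) y" if s: "s \<in> cauchy_seqs V" for s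
  proof (rule G.cauchy_convergent, rule cauchy_seqs_dominated[OF s V])
    show "f (s n) \<in> carr G" "vdist G (f (s m)) (f (s n)) \<le> K * vdist V (s m) (s n)" for m n
      by (simp_all add: fG dist_le V.cauchy_seqs_carr[OF s])
  qed
  define F where "F = (\<lambda>X. SOME y. y \<in> carr G \<and>
    (\<exists>s\<in>cauchy_seqs V. X = limit_point V s \<and> vlim G (\<lambda>n. f (s n)) y))"
  have F: "F (limit_point V s) \<in> carr G \<and> vlim G (\<lambda>n. f (s n)) (F (limit_point V s))"
    if s: "s \<in> cauchy_seqs V" for s
  proof -
    obtain y where y: "y \<in> carr G" "vlim G (\<lambda>n. f (s n)) y"
      using cau[OF s] by blast
    then have "\<exists>y. y \<in> carr G \<and>
        (\<exists>t\<in>cauchy_seqs V. limit_point V s = limit_point V t \<and> vlim G (\<lambda>n. f (t n)) y)"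
      using s by blast
    from someI_ex[OF this] obtain t where t: "F (limit_point V s) \<in> carr G" "t \<in> cauchy_seqs V"
      "limit_point V s = limit_point V t" "vlim G (\<lambda>n. f (t n)) (F (limit_point V s))"
      unfolding F_def by blast
    have "(\<lambda>n. vdist V (s n) (t n)) \<longlonglongrightarrow> 0"
      using V.limit_point_eq_iff[OF s t(2)] t(3) by simp
    then have "(\<lambda>n. K * vdist V (s n) (t n) + vdist G (f (t n)) (F (limit_point V s))) \<longlonglongrightarrow> 0"
      using tendsto_add[OF tendsto_mult_right_zero[of _ _ K] t(4)[unfolded vlim_def]] by simp
    moreover have "vdist G (f (s n)) (F (limit_point V s)) \<le>
        K * vdist V (s n) (t n) + vdist G (f (t n)) (F (limit_point V s))" for n
      using G.vdist_triangle[OF fG fG t(1), of "s n" "t n"] dist_le[of "s n" "t n"]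
        V.cauchy_seqs_carr[OF s] V.cauchy_seqs_carr[OF t(2)] by simp
    ultimately have "vlim G (\<lambda>n. f (s n)) (F (limit_point V s))"
      by (intro G.vlim_squeeze)
    with t(1) show ?thesis ..
  qed
  have F_eq: "F (limit_point V s) = y"
    if "s \<in> cauchy_seqs V" "y \<in> carr G" "vlim G (\<lambda>n. f (s n)) y" for s y
    using F[OF that(1)] that G.vlim_unique fG V.cauchy_seqs_carr by metis
  show ?thesis
  proof
    show "F (embed V x) = f x" if "x \<in> carr V" for x
      unfolding embed_def using that by (intro F_eq) (simp_all add: V.cauchy_seqs_const fG G.vlim_const)
    show "linear_op ?C G F"
      unfolding linear_op_def
    proof (intro conjI ballI allI funcsetI)
      fix X
      assume "X \<in> carr ?C"
      then obtain s where s: "s \<in> cauchy_seqs V" "X = limit_point V s"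
        by (rule V.carr_completionE)
      note sV = V.cauchy_seqs_carr[OF s(1)]
      show "F X \<in> carr G"
        using F s by blast
      show "F (vscale ?C c X) = vscale G c (F X)" for c
        unfolding s(2) V.vscale_completion[OF s(1)]
        using F[OF s(1)] G.vlim_vscale[of "\<lambda>n. f (s n)" "F (limit_point V s)" c]
        by (intro F_eq) (simp_all add: V.cauchy_seqs_vscale s G.closed linear_opD[OF f] sV fG)
      fix Y
      assume "Y \<in> carr ?C"
      then obtain t where t: "t \<in> cauchy_seqs V" "Y = limit_point V t"
        by (rule V.carr_completionE)
      note tV = V.cauchy_seqs_carr[OF t(1)]
      show "F (vadd ?C X Y) = vadd G (F X) (F Y)"
        unfolding s(2) t(2) V.vadd_completion[OF s(1) t(1)]
        using F[OF s(1)] F[OF t(1)]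
          G.vlim_vadd[of "\<lambda>n. f (s n)" "F (limit_point V s)" "\<lambda>n. f (t n)" "F (limit_point V t)"]
        by (intro F_eq) (simp_all add: V.cauchy_seqs_vadd s t G.closed linear_opD[OF f] sV tV fG)
    qed
    show "vnorm G (F X) \<le> K * vnorm ?C X" if "X \<in> carr ?C" for X
    proof -
      obtain s where s: "s \<in> cauchy_seqs V" "X = limit_point V s"
        using \<open>X \<in> carr ?C\<close> by (rule V.carr_completionE)
      note sV = V.cauchy_seqs_carr[OF s(1)]
      have "(\<lambda>n. vnorm G (f (s n))) \<longlonglongrightarrow> vnorm G (F X)"
        using F[OF s(1)] s(2) by (intro G.vlim_vnorm) (simp_all add: fG sV)
      moreover have "(\<lambda>n. K * vnorm V (s n)) \<longlonglongrightarrow> K * vnorm ?C X"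
        unfolding s(2) by (intro tendsto_mult_left V.vnorm_completion s)
      ultimately show ?thesis
        by (rule LIMSEQ_le) (simp add: K sV)
    qed
  qed
qed

section \<open>The projective tensor product\<close>

definition bounded_bilinear_op ::
  "('a, 'z) cspace_scheme \<Rightarrow> ('b, 'w) cspace_scheme \<Rightarrow> ('c, 'v) cspace_scheme \<Rightarrow>
   ('a \<Rightarrow> 'b \<Rightarrow> 'c) \<Rightarrow> real \<Rightarrow> bool" where
  "bounded_bilinear_op E F G m K \<longleftrightarrow> 0 \<le> K \<and>
     (\<forall>x\<in>carr E. \<forall>y\<in>carr F. m x y \<in> carr G \<and> vnorm G (m x y) \<le> K * (vnorm E x * vnorm F y) \<and>
        (\<forall>x'\<in>carr E. m (vadd E x x') y = vadd G (m x y) (m x' y)) \<and>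
        (\<forall>y'\<in>carr F. m x (vadd F y y') = vadd G (m x y) (m x y')) \<and>
        (\<forall>c. m (vscale E c x) y = vscale G c (m x y) \<and> m x (vscale F c y) = vscale G c (m x y)))"

lemma bounded_bilinear_opD:
  assumes "bounded_bilinear_op E F G m K" "x \<in> carr E" "y \<in> carr F"
  shows "m x y \<in> carr G" "vnorm G (m x y) \<le> K * (vnorm E x * vnorm F y)"
    "x' \<in> carr E \<Longrightarrow> m (vadd E x x') y = vadd G (m x y) (m x' y)"
    "y' \<in> carr F \<Longrightarrow> m x (vadd F y y') = vadd G (m x y) (m x y')"
    "m (vscale E c x) y = vscale G c (m x y)" "m x (vscale F c y) = vscale G c (m x y)" "0 \<le> K"
  using assms by (auto simp: bounded_bilinear_op_def)

definition tensor_cost ::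
  "('a, 'z) cspace_scheme \<Rightarrow> ('b, 'w) cspace_scheme \<Rightarrow> ('a \<times> 'b) list \<Rightarrow> real" where
  "tensor_cost E F xs = (\<Sum>(x, y)\<leftarrow>xs. vnorm E x * vnorm F y)"

definition bilinear_sum ::
  "('c, 'v) cspace_scheme \<Rightarrow> ('a \<Rightarrow> 'b \<Rightarrow> 'c) \<Rightarrow> ('a \<times> 'b) list \<Rightarrow> 'c" where
  "bilinear_sum G m xs = foldr (\<lambda>(x, y). vadd G (m x y)) xs (vzero G)"

locale seminormed_pair = E: complex_seminormed_space E + F: complex_seminormed_space F
  for E :: "('a, 'z) cspace_scheme" and F :: "('b, 'w) cspace_scheme"
begin

definition "pairs = lists (carr E \<times> carr F)"

lemma pairs_simps [simp]:
  "[] \<in> pairs" "p # xs \<in> pairs \<longleftrightarrow> p \<in> carr E \<times> carr F \<and> xs \<in> pairs"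
  "xs @ ys \<in> pairs \<longleftrightarrow> xs \<in> pairs \<and> ys \<in> pairs"
  by (auto simp: pairs_def)

abbreviation "T \<equiv> alg_tensor E F"

abbreviation scale_pairs :: "complex \<Rightarrow> ('a \<times> 'b) list \<Rightarrow> ('a \<times> 'b) list" where
  "scale_pairs c \<equiv> map (\<lambda>(x, y). (vscale E c x, y))"

lemma scale_pairs_closed: "xs \<in> pairs \<Longrightarrow> scale_pairs c xs \<in> pairs"
  by (induction xs) (auto simp: E.closed)

lemma tensor_of_append:
  "vadd T (tensor_of E F xs) (tensor_of E F ys) = tensor_of E F (xs @ ys)"
  by (auto simp: alg_tensor_def tensor_of_def)

lemma vscale_tensor_of:
  assumes "xs \<in> pairs"
  shows "vscale T c (tensor_of E F xs) = tensor_of E F (scale_pairs c xs)"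
proof -
  have "c * (\<Sum>(x, y)\<leftarrow>xs. \<beta> x y) = (\<Sum>(x, y)\<leftarrow>scale_pairs c xs. \<beta> x y)"
    if "\<beta> \<in> bilinear_forms E F" for \<beta>
    using assms that
    by (induction xs) (auto simp: ring_distribs bilinear_forms_def)
  then show ?thesis
    by (auto simp: alg_tensor_def tensor_of_def)
qed

lemma tensor_of_closed: "xs \<in> pairs \<Longrightarrow> tensor_of E F xs \<in> carr T"
  unfolding alg_tensor_def pairs_def by simp

lemma carr_alg_tensorE:
  assumes "u \<in> carr T"
  obtains xs where "xs \<in> pairs" "u = tensor_of E F xs"
  using assms unfolding alg_tensor_def pairs_def by auto

lemma vzero_alg_tensor: "vzero T = tensor_of E F []"
  by (simp add: alg_tensor_def)

lemma complex_vector_space_alg_tensor: "complex_vector_space T"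
proof unfold_locales
  show "vzero T \<in> carr T"
    by (simp add: vzero_alg_tensor tensor_of_closed)
  fix u v w c d
  assume "u \<in> carr T"
  then obtain xs where xs: "xs \<in> pairs" "u = tensor_of E F xs"
    by (rule carr_alg_tensorE)
  show "vscale T c u \<in> carr T"
    by (simp add: xs vscale_tensor_of tensor_of_closed scale_pairs_closed)
  show "vadd T u (vzero T) = u"
    by (simp add: xs vzero_alg_tensor tensor_of_append)
  show "vsub T u u = vzero T" "vscale T (c + d) u = vadd T (vscale T c u) (vscale T d u)"
    "vscale T c (vscale T d u) = vscale T (c * d) u" "vscale T 1 u = u"
    unfolding vsub_def xs(2) by (auto simp: alg_tensor_def tensor_of_def ring_distribs)
  assume "v \<in> carr T"
  then obtain ys where ys: "ys \<in> pairs" "v = tensor_of E F ys"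
    by (rule carr_alg_tensorE)
  show "vadd T u v \<in> carr T"
    using xs(1) ys(1) by (simp add: xs(2) ys(2) tensor_of_append tensor_of_closed)
  show "vadd T u v = vadd T v u" "vscale T c (vadd T u v) = vadd T (vscale T c u) (vscale T c v)"
    by (auto simp: alg_tensor_def ring_distribs add.commute)
  show "vadd T (vadd T u v) w = vadd T u (vadd T v w)"
    by (auto simp: alg_tensor_def add.assoc)
qed

lemma tensor_cost_nonneg: "xs \<in> pairs \<Longrightarrow> 0 \<le> tensor_cost E F xs"
  by (induction xs) (auto simp: tensor_cost_def E.seminorm_nonneg F.seminorm_nonneg)

lemma tensor_cost_append: "tensor_cost E F (xs @ ys) = tensor_cost E F xs + tensor_cost E F ys"
  by (simp add: tensor_cost_def)

lemma tensor_cost_scale: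
  "xs \<in> pairs \<Longrightarrow> tensor_cost E F (scale_pairs c xs) = cmod c * tensor_cost E F xs"
  by (induction xs) (auto simp: tensor_cost_def E.seminorm_vscale ring_distribs)

lemma vnorm_alg_tensor:
  "vnorm T u = Inf {tensor_cost E F xs | xs. xs \<in> pairs \<and> tensor_of E F xs = u}"
  unfolding alg_tensor_def pairs_def tensor_cost_def by simp

lemma vnorm_tensor_of_le:
  assumes "xs \<in> pairs"
  shows "vnorm T (tensor_of E F xs) \<le> tensor_cost E F xs"
  unfolding vnorm_alg_tensor
  by (rule cInf_lower) (use assms tensor_cost_nonneg in \<open>auto intro!: bdd_belowI[of _ 0]\<close>)

lemma le_vnorm_alg_tensor:
  assumes "u \<in> carr T" "\<And>xs. xs \<in> pairs \<Longrightarrow> tensor_of E F xs = u \<Longrightarrow> r \<le> tensor_cost E F xs"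
  shows "r \<le> vnorm T u"
  unfolding vnorm_alg_tensor
  by (rule cInf_greatest) (use assms in \<open>auto elim!: carr_alg_tensorE\<close>)

lemma complex_seminormed_space_alg_tensor: "complex_seminormed_space T"
proof -
  interpret T: complex_vector_space T
    by (rule complex_vector_space_alg_tensor)
  have scale_le: "vnorm T (vscale T c u) \<le> cmod c * vnorm T u" if u: "u \<in> carr T" for c u
  proof -
    have le: "vnorm T (vscale T c u) \<le> cmod c * tensor_cost E F xs"
      if "xs \<in> pairs" "tensor_of E F xs = u" for xs
      using vnorm_tensor_of_le[OF scale_pairs_closed[OF that(1)], of c]
      by (simp add: vscale_tensor_of tensor_cost_scale that flip: that(2))
    show ?thesis
    proof (cases "c = 0")
      case True
      then show ?thesis
        using le u by (auto elim!: carr_alg_tensorE)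
    next
      case False
      have "vnorm T (vscale T c u) / cmod c \<le> vnorm T u"
        using le False by (intro le_vnorm_alg_tensor u) (simp add: pos_divide_le_eq mult.commute)
      then show ?thesis
        using False by (simp add: pos_divide_le_eq mult.commute)
    qed
  qed
  have nonneg: "0 \<le> vnorm T u" if "u \<in> carr T" for u
    by (rule le_vnorm_alg_tensor[OF that tensor_cost_nonneg])
  show ?thesis
  proof unfold_locales
    fix u v c
    assume u: "u \<in> carr T"
    show "0 \<le> vnorm T u"
      using u by (rule nonneg)
    show "vnorm T (vscale T c u) = cmod c * vnorm T u"
      using nonneg scale_le u by (rule T.homogeneousI)
    assume v: "v \<in> carr T"
    have le: "vnorm T (vadd T u v) \<le> tensor_cost E F xs + tensor_cost E F ys"
      if "xs \<in> pairs" "tensor_of E F xs = u" "ys \<in> pairs" "tensor_of E F ys = v" for xs ys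
      using vnorm_tensor_of_le[of "xs @ ys"] that
      by (auto simp: tensor_of_append tensor_cost_append)
    have "vnorm T (vadd T u v) - tensor_cost E F xs \<le> vnorm T v"
      if "xs \<in> pairs" "tensor_of E F xs = u" for xs
      using le[OF that] by (intro le_vnorm_alg_tensor v) (simp add: diff_le_eq add.commute)
    then have "vnorm T (vadd T u v) - vnorm T v \<le> vnorm T u"
      by (intro le_vnorm_alg_tensor u) (simp add: algebra_simps)
    then show "vnorm T (vadd T u v) \<le> vnorm T u + vnorm T v"
      by simp
  qed
qed

end

sublocale seminormed_pair \<subseteq> T: complex_seminormed_space "alg_tensor E F"
  by (rule complex_seminormed_space_alg_tensor)

sublocale seminormed_pair \<subseteq> P: complex_banach_space "proj_tensor E F"
  unfolding proj_tensor_def by (rule T.complex_banach_space_completion)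

text \<open>
  A bilinear map into \<open>G\<close> respects equality of tensors because the bounded functionals of \<open>G\<close>
  separate points and compose with it to bilinear forms, on which the tensors are tested.
\<close>

lemma (in seminormed_pair) alg_tensor_lift:
  assumes G: "complex_normed_space G" and m: "bounded_bilinear_op E F G m K"
  obtains f where "linear_op T G f"
    "\<And>x y. \<lbrakk>x \<in> carr E; y \<in> carr F\<rbrakk> \<Longrightarrow> f (tensor_of E F [(x, y)]) = m x y"
    "\<And>u. u \<in> carr T \<Longrightarrow> vnorm G (f u) \<le> K * vnorm T u"
proof -
  interpret G: complex_normed_space G by fact
  note mD = bounded_bilinear_opD[OF m]
  have K: "0 \<le> K"
    using m by (simp add: bounded_bilinear_op_def)
  let ?S = "bilinear_sum G m"
  have S: "?S xs \<in> carr G" if "xs \<in> pairs" for xs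
    using that by (induction xs) (auto simp: bilinear_sum_def G.closed mD)
  have S_append: "?S (xs @ ys) = vadd G (?S xs) (?S ys)" if "xs \<in> pairs" "ys \<in> pairs" for xs ys
    using that S
    by (induction xs) (auto simp: bilinear_sum_def G.vadd_zero_left G.vadd_assoc mD)
  have S_scale: "?S (scale_pairs c xs) = vscale G c (?S xs)" if "xs \<in> pairs" for c xs
    using that S
    by (induction xs) (auto simp: bilinear_sum_def G.vscale_vzero G.vscale_vadd mD)
  have S_norm: "vnorm G (?S xs) \<le> K * tensor_cost E F xs" if "xs \<in> pairs" for xs
    using that
  proof (induction xs)
    case Nil
    then show ?case
      by (simp add: bilinear_sum_def tensor_cost_def G.seminorm_vzero)
  next
    case (Cons p xs)
    then obtain x y where p: "p = (x, y)" "x \<in> carr E" "y \<in> carr F" and xs: "xs \<in> pairs"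
      by (cases p) auto
    then show ?case
      using Cons.IH[OF xs] G.seminorm_triangle[OF mD(1)[OF p(2,3)] S[OF xs]] mD(2)[OF p(2,3)]
      by (simp add: bilinear_sum_def tensor_cost_def ring_distribs)
  qed
  have functional: "l (?S xs) = (\<Sum>(x, y)\<leftarrow>xs. l (m x y))"
    if "bounded_functional G l" "xs \<in> pairs" for l xs
  proof -
    have l0: "l (vzero G) = 0"
      using that(1) G.vscale_zero_left[OF G.vzero_closed] G.vzero_closed
      unfolding bounded_functional_def by (metis mult_zero_left)
    show ?thesis
      using that(2) S that(1) l0
      by (induction xs) (auto simp: bilinear_sum_def bounded_functional_def mD)
  qed
  have well_defined: "?S xs = ?S ys"
    if xs: "xs \<in> pairs" and ys: "ys \<in> pairs" and eq: "tensor_of E F xs = tensor_of E F ys" for xs ys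
  proof (rule G.functionals_separate)
    fix l
    assume l: "bounded_functional G l"
    have "(\<lambda>x y. l (m x y)) \<in> bilinear_forms E F"
      using l unfolding bilinear_forms_def bounded_functional_def
      by (auto simp: mD)
    then have "(\<Sum>(x, y)\<leftarrow>xs. l (m x y)) = (\<Sum>(x, y)\<leftarrow>ys. l (m x y))"
      using fun_cong[OF eq, of "\<lambda>x y. l (m x y)"] by (simp add: tensor_of_def)
    then show "l (?S xs) = l (?S ys)"
      by (simp add: functional[OF l] xs ys)
  qed (use S xs ys in auto)
  define f where "f = (\<lambda>u. ?S (SOME xs. xs \<in> pairs \<and> tensor_of E F xs = u))"
  have f: "f (tensor_of E F xs) = ?S xs" if "xs \<in> pairs" for xs
  proof -
    have "\<exists>ys. ys \<in> pairs \<and> tensor_of E F ys = tensor_of E F xs"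
      using that by blast
    from someI_ex[OF this] show ?thesis
      unfolding f_def using that by (intro well_defined) auto
  qed
  show ?thesis
  proof
    show "linear_op T G f"
      unfolding linear_op_def
    proof (intro conjI ballI allI funcsetI)
      fix u
      assume "u \<in> carr T"
      then obtain xs where xs: "xs \<in> pairs" "u = tensor_of E F xs"
        by (rule carr_alg_tensorE)
      show "f u \<in> carr G"
        by (simp add: xs f S)
      show "f (vscale T c u) = vscale G c (f u)" for c
        by (simp add: xs vscale_tensor_of f scale_pairs_closed S_scale)
      fix v
      assume "v \<in> carr T"
      then obtain ys where "ys \<in> pairs" "v = tensor_of E F ys"
        by (rule carr_alg_tensorE)
      with xs show "f (vadd T u v) = vadd G (f u) (f v)"
        by (metis tensor_of_append f S_append pairs_simps(3))
    qed
    show "f (tensor_of E F [(x, y)]) = m x y" if "x \<in> carr E" "y \<in> carr F" for x y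
      using that by (simp add: f bilinear_sum_def G.vadd_zero mD)
    show "vnorm G (f u) \<le> K * vnorm T u" if u: "u \<in> carr T" for u
    proof (cases "K = 0")
      case True
      then show ?thesis
        using u S_norm f by (auto elim!: carr_alg_tensorE)
    next
      case False
      have "vnorm G (f u) / K \<le> tensor_cost E F xs" if "xs \<in> pairs" "tensor_of E F xs = u" for xs
        using S_norm[OF that(1)] f[OF that(1)] that(2) K False
        by (simp add: pos_divide_le_eq mult.commute)
      then have "vnorm G (f u) / K \<le> vnorm T u"
        by (intro le_vnorm_alg_tensor u)
      then show ?thesis
        using K False by (simp add: pos_divide_le_eq mult.commute)
    qed
  qed
qed

context seminormed_pair
begin

abbreviation "P \<equiv> proj_tensor E F"
abbreviation "elem \<equiv> elem_tensor E F"

lemma elem_tensor_eq: "elem x y = embed T (tensor_of E F [(x, y)])"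
  by (simp add: elem_tensor_def embed_def limit_point_def)

lemma bounded_bilinear_tensor_of: "bounded_bilinear_op E F T (\<lambda>x y. tensor_of E F [(x, y)]) 1"
proof -
  have "tensor_of E F [(vadd E x x', y)] = vadd T (tensor_of E F [(x, y)]) (tensor_of E F [(x', y)])"
    "tensor_of E F [(x, vadd F y y')] = vadd T (tensor_of E F [(x, y)]) (tensor_of E F [(x, y')])"
    "tensor_of E F [(vscale E c x, y)] = vscale T c (tensor_of E F [(x, y)])"
    "tensor_of E F [(x, vscale F c y)] = vscale T c (tensor_of E F [(x, y)])"
    if "x \<in> carr E" "y \<in> carr F" "x' \<in> carr E" "y' \<in> carr F" for x x' y y' c
    using that by (auto simp: tensor_of_def alg_tensor_def bilinear_forms_def intro!: restrict_ext)
  moreover have "vnorm T (tensor_of E F [(x, y)]) \<le> vnorm E x * vnorm F y"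
    if "x \<in> carr E" "y \<in> carr F" for x y
    using vnorm_tensor_of_le[of "[(x, y)]"] that by (simp add: tensor_cost_def)
  ultimately show ?thesis
    by (auto simp: bounded_bilinear_op_def tensor_of_closed)
qed

lemma bounded_bilinear_elem_tensor: "bounded_bilinear_op E F P elem 1"
proof -
  note D = bounded_bilinear_opD[OF bounded_bilinear_tensor_of]
  note L = bounded_op_linear[OF T.bounded_op_embed]
  show ?thesis
    unfolding bounded_bilinear_op_def elem_tensor_eq proj_tensor_def
    using D(1,2) by (auto simp: T.embed_closed T.vnorm_embed D(3-6) linear_opD(2,3)[OF L])
qed

lemmas elem_tensor_closed = bounded_bilinear_opD(1)[OF bounded_bilinear_elem_tensor]

lemmas elem_tensor_linear = bounded_bilinear_opD(3-6)[OF bounded_bilinear_elem_tensor]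

lemma vnorm_elem_tensor_le:
  "\<lbrakk>x \<in> carr E; y \<in> carr F\<rbrakk> \<Longrightarrow> vnorm P (elem x y) \<le> vnorm E x * vnorm F y"
  using bounded_bilinear_opD(2)[OF bounded_bilinear_elem_tensor] by simp

text \<open>Finite sums of elementary tensors are dense.\<close>

lemma proj_tensor_induct [consumes 1, case_names elem add lim]:
  assumes u: "u \<in> carr P"
    and elem: "\<And>x y. \<lbrakk>x \<in> carr E; y \<in> carr F\<rbrakk> \<Longrightarrow> Q (elem x y)"
    and add: "\<And>u v. \<lbrakk>u \<in> carr P; v \<in> carr P; Q u; Q v\<rbrakk> \<Longrightarrow> Q (vadd P u v)"
    and lim: "\<And>s u. \<lbrakk>\<And>n. s n \<in> carr P; u \<in> carr P; vlim P s u; \<And>n. Q (s n)\<rbrakk> \<Longrightarrow> Q u"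
  shows "Q u"
proof -
  note L = bounded_op_linear[OF T.bounded_op_embed]
  have sums: "Q (embed T (tensor_of E F xs))" if "xs \<in> pairs" for xs
    using that
  proof (induction xs)
    case Nil
    have "tensor_of E F [] = tensor_of E F [(vzero E, vzero F)]"
      using bounded_bilinear_opD(5)[OF bounded_bilinear_tensor_of E.vzero_closed F.vzero_closed, of 0]
      by (simp add: E.vscale_vzero T.vscale_zero_left tensor_of_closed vzero_alg_tensor E.closed F.closed)
    then show ?case
      using elem[OF E.vzero_closed F.vzero_closed] by (simp add: elem_tensor_eq)
  next
    case (Cons p xs)
    then obtain x y where p: "p = (x, y)" "x \<in> carr E" "y \<in> carr F" and xs: "xs \<in> pairs"
      by (cases p) auto
    have "embed T (tensor_of E F (p # xs)) = vadd P (elem x y) (embed T (tensor_of E F xs))"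
      using tensor_of_append[of "[p]" xs] p xs
      by (simp add: elem_tensor_eq proj_tensor_def tensor_of_closed flip: linear_opD(2)[OF L])
    then show ?case
      using add[OF elem_tensor_closed[OF p(2,3)] _ elem[OF p(2,3)] Cons.IH[OF xs]] xs
      by (simp add: proj_tensor_def T.embed_closed tensor_of_closed)
  qed
  obtain s where s: "s \<in> cauchy_seqs T" "u = limit_point T s"
    using u unfolding proj_tensor_def by (rule T.carr_completionE)
  have sT: "s n \<in> carr T" for n
    using T.cauchy_seqs_carr[OF s(1)] .
  show ?thesis
  proof (rule lim)
    show "embed T (s n) \<in> carr P" for n
      by (simp add: proj_tensor_def T.embed_closed sT)
    show "vlim P (\<lambda>n. embed T (s n)) u"
      unfolding proj_tensor_def s(2) by (rule T.vlim_embed[OF s(1)])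
    show "Q (embed T (s n))" for n
      using sT[of n] by (auto elim!: carr_alg_tensorE simp: sums)
  qed fact
qed

lemma proj_tensor_op_eqI:
  assumes f: "bounded_op P G f" and g: "bounded_op P G g" and G: "complex_normed_space G"
    and eq: "\<And>x y. \<lbrakk>x \<in> carr E; y \<in> carr F\<rbrakk> \<Longrightarrow> f (elem x y) = g (elem x y)"
    and u: "u \<in> carr P"
  shows "f u = g u"
  using u
proof (induction rule: proj_tensor_induct)
  case (elem x y)
  then show ?case by (rule eq)
next
  case (add u v)
  then show ?case
    using f g by (simp add: bounded_op_def linear_op_def)
next
  case (lim s u)
  interpret G: complex_normed_space G by fact
  have D: "f u \<in> carr G" "g u \<in> carr G" "g (s n) \<in> carr G" for n
    using f g lim(1,2) by (simp_all add: bounded_op_def linear_op_def Pi_iff)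
  note V = vlim_bounded_op[OF _ P.seminormed G.seminormed]
  have "vlim G (\<lambda>n. f (s n)) (f u)" "vlim G (\<lambda>n. g (s n)) (g u)"
    by (rule V[OF f lim(1-3)], rule V[OF g lim(1-3)])
  then show ?case
    using lim(4) D by (intro G.vlim_unique[of "\<lambda>n. g (s n)"]) simp_all
qed

text \<open>
  The defining description of the lift is met by the extension to the completion of the lift from
  the algebraic tensor product, and by no other map, as elementary tensors determine an operator.
\<close>

lemma tensor_lift:
  assumes G: "complex_banach_space G" and m: "bounded_bilinear_op E F G m K"
  shows "bounded_op P G (tensor_lift E F G m)"
    and "\<lbrakk>x \<in> carr E; y \<in> carr F\<rbrakk> \<Longrightarrow> tensor_lift E F G m (elem x y) = m x y"
    and "u \<in> carr P \<Longrightarrow> vnorm G (tensor_lift E F G m u) \<le> K * vnorm P u"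
proof -
  interpret G: complex_banach_space G by fact
  obtain f where f: "linear_op T G f"
    "\<And>x y. \<lbrakk>x \<in> carr E; y \<in> carr F\<rbrakk> \<Longrightarrow> f (tensor_of E F [(x, y)]) = m x y"
    "\<And>u. u \<in> carr T \<Longrightarrow> vnorm G (f u) \<le> K * vnorm T u"
    using alg_tensor_lift[OF G.complex_normed_space_axioms m] by blast
  obtain h where h: "linear_op P G h" "\<And>u. u \<in> carr T \<Longrightarrow> h (embed T u) = f u"
    "\<And>u. u \<in> carr P \<Longrightarrow> vnorm G (h u) \<le> K * vnorm P u"
    using completion_extend[OF T.seminormed G f(1) f(3)]
    unfolding proj_tensor_def by blast
  let ?h = "restrict h (carr P)"
  have 1: "bounded_op P G ?h"
    using h(1,3) by (auto simp: bounded_op_def linear_op_def P.closed)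
  have 2: "?h (elem x y) = m x y" if "x \<in> carr E" "y \<in> carr F" for x y
    using that h(2) f(2) elem_tensor_closed[OF that] by (simp add: elem_tensor_eq tensor_of_closed)
  have "tensor_lift E F G m = ?h"
    unfolding tensor_lift_def
  proof (rule the_equality)
    fix g
    assume g: "g \<in> extensional (carr P) \<and> bounded_op P G g \<and>
      (\<forall>x\<in>carr E. \<forall>y\<in>carr F. g (elem x y) = m x y)"
    show "g = ?h"
    proof (rule extensionalityI[of _ "carr P"])
      show "g u = ?h u" if "u \<in> carr P" for u
        by (rule proj_tensor_op_eqI[OF _ 1 G.complex_normed_space_axioms _ that])
          (use g in blast, metis g 2)
    qed (use g in auto)
  qed (use 1 2 in auto)
  then show "bounded_op P G (tensor_lift E F G m)"
    "\<lbrakk>x \<in> carr E; y \<in> carr F\<rbrakk> \<Longrightarrow> tensor_lift E F G m (elem x y) = m x y"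
    "u \<in> carr P \<Longrightarrow> vnorm G (tensor_lift E F G m u) \<le> K * vnorm P u"
    using 1 2 h(3) by simp_all
qed

lemma elem_tensor_vzero:
  "y \<in> carr F \<Longrightarrow> elem (vzero E) y = vzero P" "x \<in> carr E \<Longrightarrow> elem x (vzero F) = vzero P"
  using elem_tensor_linear(3)[OF E.vzero_closed, of y 0] elem_tensor_linear(4)[OF _ F.vzero_closed, of x 0]
  by (simp_all add: E.vscale_vzero F.vscale_vzero P.vscale_zero_left elem_tensor_closed E.closed F.closed)

end

section \<open>From projectivity to a splitting of the product map\<close>

lemma complex_banach_space_cong:
  assumes "complex_banach_space V"
    and eq: "carr W = carr V" "vzero W = vzero V" "vadd W = vadd V" "vscale W = vscale V" "vnorm W = vnorm V"
  shows "complex_banach_space W"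
proof -
  interpret V: complex_banach_space V by fact
  have sub: "vsub W = vsub V"
    by (intro ext) (simp add: vsub_def eq)
  have dist: "vdist W = vdist V"
    by (intro ext) (simp add: vdist_def eq sub)
  show ?thesis
    by unfold_locales
      (simp_all add: eq sub dist V.closed V.vadd_ac V.vadd_zero V.vsub_self V.vscale_vadd
        V.vscale_add V.vscale_vscale V.vscale_one V.vnorm_nonneg V.vnorm_eq_0_iff V.vnorm_triangle
        V.vnorm_vscale V.complete)
qed

lemma bimodule_on_simps [simp]:
  "carr (bimodule_on V l r) = carr V" "vzero (bimodule_on V l r) = vzero V"
  "vadd (bimodule_on V l r) = vadd V" "vscale (bimodule_on V l r) = vscale V"
  "vnorm (bimodule_on V l r) = vnorm V" "lact (bimodule_on V l r) = l" "ract (bimodule_on V l r) = r"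
  by (simp_all add: bimodule_on_def)

lemma regular_bimodule_simps [simp]:
  "carr (regular_bimodule A) = carr A" "vzero (regular_bimodule A) = vzero A"
  "vadd (regular_bimodule A) = vadd A" "vscale (regular_bimodule A) = vscale A"
  "vnorm (regular_bimodule A) = vnorm A" "lact (regular_bimodule A) = amul A"
  "ract (regular_bimodule A) = amul A"
  by (simp_all add: regular_bimodule_def)

lemma tensor_bimodule_simps [simp]:
  "carr (tensor_bimodule A) = carr (proj_tensor A A)"
  "vzero (tensor_bimodule A) = vzero (proj_tensor A A)"
  "vadd (tensor_bimodule A) = vadd (proj_tensor A A)"
  "vscale (tensor_bimodule A) = vscale (proj_tensor A A)"
  "vnorm (tensor_bimodule A) = vnorm (proj_tensor A A)"
  by (simp_all add: tensor_bimodule_def)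

lemma bounded_op_simps [simp]:
  "bounded_op (regular_bimodule A) W k \<longleftrightarrow> bounded_op A W k"
  "bounded_op V (tensor_bimodule A) g \<longleftrightarrow> bounded_op V (proj_tensor A A) g"
  "bounded_op V (regular_bimodule A) h \<longleftrightarrow> bounded_op V A h"
  "bounded_op V (bimodule_on X l r) f \<longleftrightarrow> bounded_op V X f"
  "bounded_op (bimodule_on X l r) W i \<longleftrightarrow> bounded_op X W i"
  by (simp_all add: bounded_op_def linear_op_def)

definition prod_space :: "('a, 'z) cspace_scheme \<Rightarrow> ('b, 'w) cspace_scheme \<Rightarrow> ('a \<times> 'b) cspace" where
  "prod_space V W =
     \<lparr>carr = carr V \<times> carr W, vzero = (vzero V, vzero W),
      vadd = (\<lambda>(x, y) (x', y'). (vadd V x x', vadd W y y')),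
      vscale = (\<lambda>c (x, y). (vscale V c x, vscale W c y)),
      vnorm = (\<lambda>(x, y). vnorm V x + vnorm W y)\<rparr>"

lemma prod_space_simps [simp]:
  "carr (prod_space V W) = carr V \<times> carr W" "vzero (prod_space V W) = (vzero V, vzero W)"
  "vadd (prod_space V W) (x, y) (x', y') = (vadd V x x', vadd W y y')"
  "vscale (prod_space V W) c (x, y) = (vscale V c x, vscale W c y)"
  "vnorm (prod_space V W) (x, y) = vnorm V x + vnorm W y"
  by (simp_all add: prod_space_def)

lemma vsub_prod_space [simp]:
  "vsub (prod_space V W) (x, y) (x', y') = (vsub V x x', vsub W y y')"
  by (simp add: vsub_def)

lemma complex_banach_space_prod:
  assumes V: "complex_banach_space V" and W: "complex_banach_space W"
  shows "complex_banach_space (prod_space V W)"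
proof -
  interpret V: complex_banach_space V by fact
  interpret W: complex_banach_space W by fact
  let ?P = "prod_space V W"
  interpret P: complex_normed_space ?P
  proof unfold_locales
    show "vnorm ?P x = 0 \<longleftrightarrow> x = vzero ?P" if "x \<in> carr ?P" for x
      using that V.vnorm_nonneg[of "fst x"] W.vnorm_nonneg[of "snd x"]
      by (cases x) (auto simp: V.vnorm_eq_0_iff[symmetric] W.vnorm_eq_0_iff[symmetric]
          V.seminorm_vzero W.seminorm_vzero add_nonneg_eq_0_iff)
    show "vnorm ?P (vadd ?P x y) \<le> vnorm ?P x + vnorm ?P y" if "x \<in> carr ?P" "y \<in> carr ?P" for x y
      using that V.vnorm_triangle[of "fst x" "fst y"] W.vnorm_triangle[of "snd x" "snd y"]
      by (cases x; cases y) auto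
  qed (auto simp: V.closed W.closed V.vadd_ac W.vadd_ac V.vadd_zero W.vadd_zero V.vsub_self
      W.vsub_self V.vscale_vadd W.vscale_vadd V.vscale_add W.vscale_add V.vscale_vscale
      W.vscale_vscale V.vscale_one W.vscale_one V.vnorm_nonneg W.vnorm_nonneg V.vnorm_vscale
      W.vnorm_vscale ring_distribs)
  have dist: "vdist ?P x y = vdist V (fst x) (fst y) + vdist W (snd x) (snd y)"
    if "x \<in> carr ?P" "y \<in> carr ?P" for x y
    using that by (cases x; cases y) (simp add: vdist_def)
  show ?thesis
  proof (rule P.complex_banach_spaceI)
    fix s
    assume s: "s \<in> cauchy_seqs ?P"
    have sP: "s n \<in> carr ?P" for n
      by (rule P.cauchy_seqs_carr[OF s])
    then have s12: "fst (s n) \<in> carr V" "snd (s n) \<in> carr W" for n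
      by (auto simp: mem_Times_iff)
    have "(\<lambda>n. fst (s n)) \<in> cauchy_seqs V"
      by (rule cauchy_seqs_dominated[OF s P.seminormed, of _ _ 1])
        (simp_all only: s12 dist[OF sP sP], simp add: W.vdist_nonneg)
    then obtain x where x: "x \<in> carr V" "vlim V (\<lambda>n. fst (s n)) x"
      using V.cauchy_convergent by blast
    have "(\<lambda>n. snd (s n)) \<in> cauchy_seqs W"
      by (rule cauchy_seqs_dominated[OF s P.seminormed, of _ _ 1])
        (simp_all only: s12 dist[OF sP sP], simp add: V.vdist_nonneg)
    then obtain y where y: "y \<in> carr W" "vlim W (\<lambda>n. snd (s n)) y"
      using W.cauchy_convergent by blast
    have xy: "(x, y) \<in> carr ?P"
      using x y by simp
    have "vlim ?P s (x, y)"
      unfolding vlim_def dist[OF sP xy]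
      using tendsto_add[OF x(2)[unfolded vlim_def] y(2)[unfolded vlim_def]] by simp
    with xy show "\<exists>x\<in>carr ?P. vlim ?P s x"
      by blast
  qed
qed

lemma bounded_op_amul:
  assumes "complex_banach_algebra A" "a \<in> carr A"
  shows "bounded_op A A (amul A a)" "bounded_op A A (\<lambda>x. amul A x a)"
proof -
  interpret complex_banach_algebra A by fact
  show "bounded_op A A (amul A a)" "bounded_op A A (\<lambda>x. amul A x a)"
    using assms(2) vnorm_amul unfolding bounded_op_def linear_op_def
    by (auto simp: amul_closed amul_vadd_left amul_vadd_right amul_vscale_left amul_vscale_right
        intro!: exI[of _ "vnorm A a"]) (simp_all add: mult.commute)
qed

sublocale complex_banach_algebra \<subseteq> TT: seminormed_pair A A
  by unfold_locales

context complex_banach_algebra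
begin

abbreviation "AA \<equiv> proj_tensor A A"
abbreviation "ten \<equiv> elem_tensor A A"
abbreviation "ltensor \<equiv> lact (tensor_bimodule A)"
abbreviation "rtensor \<equiv> ract (tensor_bimodule A)"

lemma bounded_bilinear_ltensor:
  assumes a: "a \<in> carr A"
  shows "bounded_bilinear_op A A AA (\<lambda>x y. ten (amul A a x) y) (vnorm A a)"
proof -
  have "vnorm AA (ten (amul A a x) y) \<le> vnorm A a * (vnorm A x * vnorm A y)"
    if "x \<in> carr A" "y \<in> carr A" for x y
    using TT.vnorm_elem_tensor_le[of "amul A a x" y] that a
      mult_right_mono[OF vnorm_amul[OF a that(1)] vnorm_nonneg[OF that(2)]]
    by (simp add: amul_closed mult.assoc)
  then show ?thesis
    using a by (simp add: bounded_bilinear_op_def vnorm_nonneg TT.elem_tensor_closed amul_closed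
        amul_vadd_right amul_vscale_right TT.elem_tensor_linear)
qed

lemma bounded_bilinear_rtensor:
  assumes a: "a \<in> carr A"
  shows "bounded_bilinear_op A A AA (\<lambda>x y. ten x (amul A y a)) (vnorm A a)"
proof -
  have "vnorm AA (ten x (amul A y a)) \<le> vnorm A a * (vnorm A x * vnorm A y)"
    if "x \<in> carr A" "y \<in> carr A" for x y
    using TT.vnorm_elem_tensor_le[of x "amul A y a"] that a
      mult_left_mono[OF vnorm_amul[OF that(2) a] vnorm_nonneg[OF that(1)]]
    by (simp add: amul_closed ac_simps)
  then show ?thesis
    using a by (simp add: bounded_bilinear_op_def vnorm_nonneg TT.elem_tensor_closed amul_closed
        amul_vadd_left amul_vscale_left TT.elem_tensor_linear)
qed

lemma bounded_bilinear_amul: "bounded_bilinear_op A A A (amul A) 1"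
  by (simp add: bounded_bilinear_op_def amul_closed vnorm_amul amul_vadd_left amul_vadd_right
      amul_vscale_left amul_vscale_right)

lemma ltensor:
  assumes a: "a \<in> carr A"
  shows "bounded_op AA AA (ltensor a)"
    and "\<lbrakk>x \<in> carr A; y \<in> carr A\<rbrakk> \<Longrightarrow> ltensor a (ten x y) = ten (amul A a x) y"
    and "u \<in> carr AA \<Longrightarrow> vnorm AA (ltensor a u) \<le> vnorm A a * vnorm AA u"
  using TT.tensor_lift[OF TT.P.complex_banach_space_axioms bounded_bilinear_ltensor[OF a]]
  by (simp_all add: tensor_bimodule_def)

lemma rtensor:
  assumes a: "a \<in> carr A"
  shows "bounded_op AA AA (\<lambda>u. rtensor u a)"
    and "\<lbrakk>x \<in> carr A; y \<in> carr A\<rbrakk> \<Longrightarrow> rtensor (ten x y) a = ten x (amul A y a)"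
    and "u \<in> carr AA \<Longrightarrow> vnorm AA (rtensor u a) \<le> vnorm A a * vnorm AA u"
  using TT.tensor_lift[OF TT.P.complex_banach_space_axioms bounded_bilinear_rtensor[OF a]]
  by (simp_all add: tensor_bimodule_def)

lemma product_map:
  shows "bounded_op AA A (product_map A)"
    and "\<lbrakk>x \<in> carr A; y \<in> carr A\<rbrakk> \<Longrightarrow> product_map A (ten x y) = amul A x y"
  using TT.tensor_lift[OF complex_banach_space_axioms bounded_bilinear_amul]
  by (simp_all add: product_map_def)

lemmas ltensor_linear = linear_opD[OF bounded_op_linear[OF ltensor(1)]]
lemmas rtensor_linear = linear_opD[OF bounded_op_linear[OF rtensor(1)]]
lemmas product_map_linear = linear_opD[OF bounded_op_linear[OF product_map(1)]]

lemmas AA_eqI = TT.proj_tensor_op_eqI[OF _ _ TT.P.complex_normed_space_axioms]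

lemmas bounded_op_AA = bounded_op_compose[OF _ _ TT.P.seminormed
    TT.P.seminormed]
  bounded_op_vadd[OF _ _ TT.P.seminormed TT.P.seminormed]
  bounded_op_vscale[OF _ TT.P.seminormed TT.P.seminormed]

lemma complex_banach_bimodule_tensor: "complex_banach_bimodule A (tensor_bimodule A)"
proof -
  interpret Y: complex_banach_space "tensor_bimodule A"
    by (rule complex_banach_space_cong[OF TT.P.complex_banach_space_axioms]) simp_all
  note elem_simps = ltensor(2) rtensor(2) amul_closed closed amul_vadd_left amul_vadd_right
    amul_vscale_left amul_vscale_right amul_assoc TT.elem_tensor_linear
  show ?thesis
  proof unfold_locales
    fix a b u v c
    assume a: "a \<in> carr A"
    {
      assume u: "u \<in> carr (tensor_bimodule A)"
      then have u': "u \<in> carr AA"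
        by simp
      show "ltensor a u \<in> carr (tensor_bimodule A)" "rtensor u a \<in> carr (tensor_bimodule A)"
        "ltensor a (vscale (tensor_bimodule A) c u) = vscale (tensor_bimodule A) c (ltensor a u)"
        "rtensor (vscale (tensor_bimodule A) c u) a = vscale (tensor_bimodule A) c (rtensor u a)"
        using a u by (simp_all add: ltensor_linear rtensor_linear)
      show "ltensor (vscale A c a) u = vscale (tensor_bimodule A) c (ltensor a u)"
        unfolding tensor_bimodule_simps
        by (rule AA_eqI[OF _ _ _ u']) (simp_all add: bounded_op_AA ltensor(1) a closed elem_simps)
      show "rtensor u (vscale A c a) = vscale (tensor_bimodule A) c (rtensor u a)"
        unfolding tensor_bimodule_simps
        by (rule AA_eqI[OF _ _ _ u']) (simp_all add: bounded_op_AA rtensor(1) a closed elem_simps)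
      assume b: "b \<in> carr A"
      show "ltensor (vadd A a b) u = vadd (tensor_bimodule A) (ltensor a u) (ltensor b u)"
        unfolding tensor_bimodule_simps
        by (rule AA_eqI[OF _ _ _ u']) (simp_all add: bounded_op_AA ltensor(1) a b closed elem_simps)
      show "rtensor u (vadd A a b) = vadd (tensor_bimodule A) (rtensor u a) (rtensor u b)"
        unfolding tensor_bimodule_simps
        by (rule AA_eqI[OF _ _ _ u']) (simp_all add: bounded_op_AA rtensor(1) a b closed elem_simps)
      show "ltensor a (ltensor b u) = ltensor (amul A a b) u"
        by (rule AA_eqI[OF _ _ _ u'])
          (simp_all add: bounded_op_AA(1)[OF ltensor(1) ltensor(1)] ltensor(1) a b amul_closed elem_simps)
      show "rtensor (rtensor u a) b = rtensor u (amul A a b)"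
        by (rule AA_eqI[OF _ _ _ u'])
          (simp_all add: bounded_op_AA(1)[OF rtensor(1) rtensor(1)] rtensor(1) a b amul_closed elem_simps)
      show "rtensor (ltensor a u) b = ltensor a (rtensor u b)"
        by (rule AA_eqI[OF _ _ _ u'])
          (simp_all add: bounded_op_AA(1)[OF ltensor(1) rtensor(1)]
            bounded_op_AA(1)[OF rtensor(1) ltensor(1)] a b amul_closed elem_simps)
    }
    assume "u \<in> carr (tensor_bimodule A)" "v \<in> carr (tensor_bimodule A)"
    then show "ltensor a (vadd (tensor_bimodule A) u v) = vadd (tensor_bimodule A) (ltensor a u) (ltensor a v)"
      "rtensor (vadd (tensor_bimodule A) u v) a = vadd (tensor_bimodule A) (rtensor u a) (rtensor v a)"
      using a by (simp_all add: ltensor_linear rtensor_linear)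
  next
    show "\<exists>K. \<forall>b\<in>carr A. \<forall>y\<in>carr (tensor_bimodule A).
        vnorm (tensor_bimodule A) (ltensor b y) \<le> K * vnorm A b * vnorm (tensor_bimodule A) y \<and>
        vnorm (tensor_bimodule A) (rtensor y b) \<le> K * vnorm A b * vnorm (tensor_bimodule A) y"
      by (intro exI[of _ 1]) (simp add: ltensor(3) rtensor(3))
  qed
qed

end

sublocale complex_banach_algebra \<subseteq> TB: complex_banach_bimodule A "tensor_bimodule A"
  by (rule complex_banach_bimodule_tensor)

context complex_banach_algebra
begin

lemma product_map_ltensor:
  "\<lbrakk>a \<in> carr A; u \<in> carr AA\<rbrakk> \<Longrightarrow> product_map A (ltensor a u) = amul A a (product_map A u)"
  by (rule TT.proj_tensor_op_eqI[OF _ _ complex_normed_space_axioms])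
    (simp_all add: ltensor product_map amul_closed amul_assoc
      bounded_op_compose[OF ltensor(1) product_map(1) TT.P.seminormed
        TT.P.seminormed]
      bounded_op_compose[OF product_map(1) bounded_op_amul(1)[OF complex_banach_algebra_axioms]
        TT.P.seminormed seminormed])

lemma product_map_rtensor:
  "\<lbrakk>a \<in> carr A; u \<in> carr AA\<rbrakk> \<Longrightarrow> product_map A (rtensor u a) = amul A (product_map A u) a"
  by (rule TT.proj_tensor_op_eqI[OF _ _ complex_normed_space_axioms])
    (simp_all add: rtensor product_map amul_closed amul_assoc
      bounded_op_compose[OF rtensor(1) product_map(1) TT.P.seminormed
        TT.P.seminormed]
      bounded_op_compose[OF product_map(1) bounded_op_amul(2)[OF complex_banach_algebra_axioms]
        TT.P.seminormed seminormed])

text \<open>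
  A bounded functional \<open>l\<close> with \<open>l c \<noteq> 0\<close> gives the bilinear map \<open>(x, y) \<mapsto> l(x) y\<close>, whose lift
  does not vanish at \<open>c \<otimes> c\<close>.
\<close>

lemma elem_tensor_self_eq_vzero:
  assumes c: "c \<in> carr A" and zero: "ten c c = vzero AA"
  shows "c = vzero A"
proof (rule ccontr)
  assume "c \<noteq> vzero A"
  then have nz: "vnorm A c \<noteq> 0"
    using c vnorm_eq_0_iff by blast
  then obtain l where l: "bounded_functional A l" "l c \<noteq> 0"
    using hahn_banach[OF c] by metis
  then obtain K where K: "\<And>x. x \<in> carr A \<Longrightarrow> cmod (l x) \<le> K * vnorm A x"
    unfolding bounded_functional_def by blast
  have "vnorm A (vscale A (l x) y) \<le> \<bar>K\<bar> * (vnorm A x * vnorm A y)"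
    if "x \<in> carr A" "y \<in> carr A" for x y
  proof -
    have "cmod (l x) \<le> \<bar>K\<bar> * vnorm A x"
      using K[OF that(1)] abs_ge_self[of K] vnorm_nonneg[OF that(1)]
      by (meson mult_right_mono order_trans)
    from mult_right_mono[OF this vnorm_nonneg[OF that(2)]] show ?thesis
      using that by (simp add: vnorm_vscale mult.assoc)
  qed
  then have m: "bounded_bilinear_op A A A (\<lambda>x y. vscale A (l x) y) \<bar>K\<bar>"
    using l(1) by (simp add: bounded_bilinear_op_def bounded_functional_def closed vscale_vadd
        vscale_add vscale_vscale mult.commute)
  let ?f = "tensor_lift A A A (\<lambda>x y. vscale A (l x) y)"
  note f = TT.tensor_lift[OF complex_banach_space_axioms m]
  have "vscale A (l c) c = ?f (ten c c)"
    using f(2) c by simp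
  also have "\<dots> = vzero A"
    using f(1) by (simp add: zero bounded_op_def linear_op_vzero complex_vector_space_axioms
        TT.P.complex_vector_space_axioms)
  finally have "vnorm A (vscale A (l c) c) = 0"
    by (simp add: seminorm_vzero)
  with nz l(2) c show False
    by (simp add: vnorm_vscale)
qed

text \<open>
  With the adjoined unit \<open>e\<close>, this is \<open>(A \<oplus> \<complex>e) \<otimes> A\<close>: the pair \<open>(u, b)\<close> stands for
  \<open>u + e \<otimes> b\<close>.
\<close>

definition unitized_tensor :: "('a, ('a, 'a) ptensor \<times> 'a) cbimodule" where
  "unitized_tensor = bimodule_on (prod_space AA A)
     (\<lambda>a (u, b). (vadd AA (ltensor a u) (ten a b), vzero A))
     (\<lambda>(u, b) a. (rtensor u a, amul A b a))"

lemma unitized_tensor_simps [simp]: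
  "carr unitized_tensor = carr AA \<times> carr A"
  "vadd unitized_tensor (u, b) (u', b') = (vadd AA u u', vadd A b b')"
  "vscale unitized_tensor k (u, b) = (vscale AA k u, vscale A k b)"
  "vnorm unitized_tensor (u, b) = vnorm AA u + vnorm A b"
  "lact unitized_tensor a (u, b) = (vadd AA (ltensor a u) (ten a b), vzero A)"
  "ract unitized_tensor (u, b) a = (rtensor u a, amul A b a)"
  by (simp_all add: unitized_tensor_def)

lemma amul_vzero_left: "x \<in> carr A \<Longrightarrow> amul A (vzero A) x = vzero A"
  using amul_vscale_left[OF vzero_closed, of x 0] by (simp add: vscale_vzero vscale_zero_left closed amul_closed)

lemma complex_banach_bimodule_unitized: "complex_banach_bimodule A unitized_tensor"
proof -
  let ?Y = unitized_tensor
  interpret Y: complex_banach_space ?Y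
    unfolding unitized_tensor_def
    by (rule complex_banach_space_cong[OF complex_banach_space_prod[OF TT.P.complex_banach_space_axioms
            complex_banach_space_axioms]]) simp_all
  note T = TB.lact_closed[simplified] TB.ract_closed[simplified] TB.lact_vadd[simplified]
    TB.ract_vadd[simplified] TB.vadd_lact[simplified] TB.vadd_ract[simplified]
    TB.lact_vscale[simplified] TB.ract_vscale[simplified] TB.vscale_lact[simplified]
    TB.vscale_ract[simplified] TB.lact_lact[simplified] TB.ract_ract[simplified]
    TB.lact_ract[simplified]
  note S = TT.P.closed closed amul_closed TT.elem_tensor_closed
  show ?thesis
  proof unfold_locales
    fix a b x y c
    assume a: "a \<in> carr A"
    {
      assume "y \<in> carr ?Y"
      then obtain u v where y: "y = (u, v)" "u \<in> carr AA" "v \<in> carr A"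
        by auto
      show "lact ?Y a y \<in> carr ?Y" "ract ?Y y a \<in> carr ?Y"
        "lact ?Y a (vscale ?Y c y) = vscale ?Y c (lact ?Y a y)"
        "ract ?Y (vscale ?Y c y) a = vscale ?Y c (ract ?Y y a)"
        "lact ?Y (vscale A c a) y = vscale ?Y c (lact ?Y a y)"
        "ract ?Y y (vscale A c a) = vscale ?Y c (ract ?Y y a)"
        using a by (simp_all add: y T S vscale_vzero TT.P.vscale_vadd TT.elem_tensor_linear
            amul_vscale_left amul_vscale_right)
      assume b: "b \<in> carr A"
      show "lact ?Y (vadd A a b) y = vadd ?Y (lact ?Y a y) (lact ?Y b y)"
        using a b by (simp add: y T S vadd_zero TT.P.vadd_ac TT.elem_tensor_linear)
      show "ract ?Y y (vadd A a b) = vadd ?Y (ract ?Y y a) (ract ?Y y b)"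
        "ract ?Y (ract ?Y y a) b = ract ?Y y (amul A a b)"
        using a b by (simp_all add: y T S amul_vadd_right amul_assoc)
      show "lact ?Y a (lact ?Y b y) = lact ?Y (amul A a b) y"
        "ract ?Y (lact ?Y a y) b = lact ?Y a (ract ?Y y b)"
        using a b by (simp_all add: y T S ltensor(2) rtensor(2) TT.elem_tensor_vzero TT.P.vadd_zero
            amul_vzero_left)
    }
    assume "x \<in> carr ?Y" "y \<in> carr ?Y"
    then obtain u v u' v' where "x = (u, v)" "u \<in> carr AA" "v \<in> carr A"
      "y = (u', v')" "u' \<in> carr AA" "v' \<in> carr A"
      by auto
    then show "lact ?Y a (vadd ?Y x y) = vadd ?Y (lact ?Y a x) (lact ?Y a y)"
      "ract ?Y (vadd ?Y x y) a = vadd ?Y (ract ?Y x a) (ract ?Y y a)"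
      using a by (simp_all add: T S vadd_zero TT.P.vadd_ac TT.elem_tensor_linear amul_vadd_left)
  next
    have "vnorm ?Y (lact ?Y b y) \<le> 1 * vnorm A b * vnorm ?Y y \<and>
        vnorm ?Y (ract ?Y y b) \<le> 1 * vnorm A b * vnorm ?Y y" if b: "b \<in> carr A" and Y: "y \<in> carr ?Y" for b y
    proof -
      obtain u v where y: "y = (u, v)" "u \<in> carr AA" "v \<in> carr A"
        using Y by auto
      have "vnorm AA (vadd AA (ltensor b u) (ten b v)) \<le> vnorm A b * vnorm AA u + vnorm A b * vnorm A v"
        using TT.P.vnorm_triangle[of "ltensor b u" "ten b v"] ltensor(3)[OF b y(2)]
          TT.vnorm_elem_tensor_le[OF b y(3)] b y by (simp add: T S)
      moreover have "vnorm AA (rtensor u b) + vnorm A (amul A v b) \<le>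
          vnorm A b * vnorm AA u + vnorm A b * vnorm A v"
        using rtensor(3)[OF b y(2)] vnorm_amul[OF y(3) b] by (simp add: mult.commute)
      ultimately show ?thesis
        by (simp add: y(1) seminorm_vzero ring_distribs)
    qed
    then show "\<exists>K. \<forall>b\<in>carr A. \<forall>y\<in>carr ?Y.
        vnorm ?Y (lact ?Y b y) \<le> K * vnorm A b * vnorm ?Y y \<and>
        vnorm ?Y (ract ?Y y b) \<le> K * vnorm A b * vnorm ?Y y"
      by blast
  qed
qed

text \<open>
  Let \<open>\<psi> = (\<alpha>, \<beta>)\<close> split \<open>(u, b) \<mapsto> \<pi> u + b\<close>.  The actions give \<open>\<beta> b \<cdot> a = \<beta> (b a) = 0\<close> and
  \<open>\<alpha> (a b) = a \<cdot> \<alpha> b + a \<otimes> \<beta> b\<close>.  For \<open>c = \<beta> b\<close> left multiplication by \<open>c\<close> is zero, so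
  \<open>0 = \<alpha> (c b) = c \<otimes> c\<close>.  Hence \<open>\<beta> = 0\<close>, and \<open>\<alpha>\<close> is the splitting.
\<close>

theorem biprojective_splitting:
  assumes "biprojective A"
  obtains \<rho> where "bimodule_morphism A (regular_bimodule A) (tensor_bimodule A) \<rho>"
    "\<And>a. a \<in> carr A \<Longrightarrow> product_map A (\<rho> a) = a"
proof -
  let ?Y = unitized_tensor
  let ?\<phi> = "\<lambda>(u, b). vadd A (product_map A u) b"
  note T = TB.lact_closed[simplified] TB.ract_closed[simplified]
  obtain K where K: "0 \<le> K" "\<And>u. u \<in> carr AA \<Longrightarrow> vnorm A (product_map A u) \<le> K * vnorm AA u"
    by (rule bounded_op_bound[OF product_map(1) TT.P.seminormed]) blast
  have mor: "bimodule_morphism A ?Y (regular_bimodule A) ?\<phi>"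
    unfolding bimodule_morphism_def bounded_op_simps
    unfolding bounded_op_def
  proof (intro conjI exI ballI)
    show "linear_op ?Y A ?\<phi>"
      unfolding linear_op_def
      by (auto simp: product_map_linear closed vscale_vadd) (simp add: vadd_ac closed product_map_linear)
    show "vnorm A (?\<phi> y) \<le> (K + 1) * vnorm ?Y y" if Y: "y \<in> carr ?Y" for y
    proof -
      obtain u v where y: "y = (u, v)" "u \<in> carr AA" "v \<in> carr A"
        using Y by auto
      have "K * vnorm AA u + vnorm A v \<le> (K + 1) * (vnorm AA u + vnorm A v)"
        using K(1) TT.P.vnorm_nonneg[OF y(2)] vnorm_nonneg[OF y(3)] by (simp add: ring_distribs)
      then show ?thesis
        using vnorm_triangle[of "product_map A u" v] K(2)[OF y(2)] y by (simp add: product_map_linear)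
    qed
    fix b y
    assume b: "b \<in> carr A" and "y \<in> carr ?Y"
    then obtain u v where y: "y = (u, v)" "u \<in> carr AA" "v \<in> carr A"
      by auto
    show "?\<phi> (lact ?Y b y) = lact (regular_bimodule A) b (?\<phi> y)"
      using b y by (simp add: product_map_linear product_map(2) product_map_ltensor vadd_zero
          amul_vadd_right amul_closed closed T TT.elem_tensor_closed)
    show "?\<phi> (ract ?Y y b) = ract (regular_bimodule A) (?\<phi> y) b"
      using b y by (simp add: product_map_linear product_map_rtensor amul_vadd_left)
  qed
  have pm0: "product_map A (vzero AA) = vzero A"
    using product_map(1) by (simp add: bounded_op_def linear_op_vzero complex_vector_space_axioms
        TT.P.complex_vector_space_axioms)
  let ?\<sigma> = "\<lambda>b. (vzero AA, b)"
  have sigma: "bounded_op (regular_bimodule A) ?Y ?\<sigma>"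
    unfolding bounded_op_simps
    unfolding bounded_op_def linear_op_def
    by (auto simp: TT.P.closed TT.P.vadd_zero TT.P.vscale_vzero TT.P.seminorm_vzero intro!: exI[of _ 1])
  have split: "?\<phi> (?\<sigma> b) = b" if "b \<in> carr A" for b
    using that by (simp add: pm0 vadd_zero_left)
  have "?\<phi> ` carr ?Y = carr (regular_bimodule A)"
  proof
    show "?\<phi> ` carr ?Y \<subseteq> carr (regular_bimodule A)"
      by (auto simp: product_map_linear closed)
    show "carr (regular_bimodule A) \<subseteq> ?\<phi> ` carr ?Y"
    proof
      fix b
      assume "b \<in> carr (regular_bimodule A)"
      then show "b \<in> ?\<phi> ` carr ?Y"
        using split[of b] by (intro image_eqI[of _ _ "?\<sigma> b"]) (auto simp: TT.P.closed)
    qed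
  qed
  then obtain \<psi> where \<psi>: "bimodule_morphism A (regular_bimodule A) ?Y \<psi>"
    "\<And>p. p \<in> carr A \<Longrightarrow> ?\<phi> (\<psi> p) = p"
    using assms complex_banach_bimodule_unitized mor sigma split
    unfolding biprojective_def projective_bimodule_def
    by (metis (lifting) regular_bimodule_simps(1))
  define \<alpha> where "\<alpha> = (\<lambda>b. fst (\<psi> b))"
  define \<beta> where "\<beta> = (\<lambda>b. snd (\<psi> b))"
  have \<psi>_eq: "\<psi> b = (\<alpha> b, \<beta> b)" for b
    by (simp add: \<alpha>_def \<beta>_def)
  have bd: "bounded_op A ?Y \<psi>"
    using \<psi>(1) by (simp add: bimodule_morphism_def)
  note lin = linear_opD[OF bounded_op_linear[OF bd]]
  have \<alpha>: "\<alpha> b \<in> carr AA" and \<beta>: "\<beta> b \<in> carr A" if "b \<in> carr A" for b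
    using lin(1)[OF that] by (auto simp: \<psi>_eq)
  have act: "\<forall>a\<in>carr A. \<forall>b\<in>carr A.
      (\<alpha> (amul A a b) = vadd AA (ltensor a (\<alpha> b)) (ten a (\<beta> b)) \<and> \<beta> (amul A a b) = vzero A) \<and>
      \<alpha> (amul A b a) = rtensor (\<alpha> b) a \<and> \<beta> (amul A b a) = amul A (\<beta> b) a"
    using \<psi>(1)
    unfolding bimodule_morphism_def regular_bimodule_simps \<psi>_eq unitized_tensor_simps prod.inject
    by blast
  have left: "\<alpha> (amul A a b) = vadd AA (ltensor a (\<alpha> b)) (ten a (\<beta> b))"
    and right: "\<alpha> (amul A b a) = rtensor (\<alpha> b) a" "\<beta> (amul A b a) = amul A (\<beta> b) a"
    and "\<beta> (amul A a b) = vzero A"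
    if "a \<in> carr A" "b \<in> carr A" for a b
    using act that by blast+
  then have \<beta>_mult: "amul A (\<beta> b) a = vzero A" if "a \<in> carr A" "b \<in> carr A" for a b
    using that by metis
  have \<beta>_zero: "\<beta> b = vzero A" if b: "b \<in> carr A" for b
  proof (rule elem_tensor_self_eq_vzero[OF \<beta>[OF b]])
    have "\<psi> (vzero A) = vzero ?Y"
      using bd complex_banach_bimodule_unitized
      by (auto simp: bounded_op_def complex_banach_bimodule_def complex_banach_space_def
          complex_normed_space_def intro!: linear_op_vzero complex_vector_space_axioms)
    then have "\<alpha> (vzero A) = vzero AA"
      by (simp add: \<alpha>_def unitized_tensor_def)
    moreover have "ltensor (\<beta> b) (\<alpha> b) = vscale AA 0 (\<alpha> b)"
    proof (rule AA_eqI[OF _ _ _ \<alpha>[OF b]])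
      show "bounded_op AA AA (ltensor (\<beta> b))"
        by (rule ltensor(1)[OF \<beta>[OF b]])
      show "bounded_op AA AA (vscale AA 0)"
        unfolding bounded_op_def linear_op_def
        by (auto simp: TT.P.vscale_zero_left TT.P.closed TT.P.vadd_zero TT.P.vscale_vzero
            TT.P.seminorm_vzero intro!: exI[of _ 0])
    qed (simp add: ltensor(2)[OF \<beta>[OF b]] \<beta>_mult b TT.elem_tensor_vzero TT.P.vscale_zero_left
        TT.elem_tensor_closed)
    ultimately show "ten (\<beta> b) (\<beta> b) = vzero AA"
      using left[OF \<beta>[OF b] b] b
      by (simp add: \<beta>_mult TT.P.vscale_zero_left \<alpha> \<beta> TT.P.vadd_zero_left TT.elem_tensor_closed)
  qed
  have "bimodule_morphism A (regular_bimodule A) (tensor_bimodule A) \<alpha>"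
    unfolding bimodule_morphism_def bounded_op_simps
  proof (intro conjI ballI)
    obtain M where M: "\<And>b. b \<in> carr A \<Longrightarrow> vnorm ?Y (\<psi> b) \<le> M * vnorm A b"
      by (rule bounded_op_bound[OF bd seminormed]) blast
    have "vnorm AA (\<alpha> b) \<le> M * vnorm A b" if "b \<in> carr A" for b
      using M[OF that] vnorm_nonneg[OF \<beta>[OF that]] by (simp add: \<psi>_eq)
    moreover have "linear_op A AA \<alpha>"
      using lin unfolding linear_op_def by (auto simp: \<psi>_eq \<alpha>)
    ultimately show "bounded_op A AA \<alpha>"
      unfolding bounded_op_def by blast
    fix a b
    assume a: "a \<in> carr A" and "b \<in> carr (regular_bimodule A)"
    then have b: "b \<in> carr A"
      by simp
    show "\<alpha> (lact (regular_bimodule A) a b) = ltensor a (\<alpha> b)"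
      using left[OF a b] by (simp add: a b \<beta>_zero TT.elem_tensor_vzero TT.P.vadd_zero T \<alpha>)
    show "\<alpha> (ract (regular_bimodule A) b a) = rtensor (\<alpha> b) a"
      using right(1)[OF a b] by simp
  qed
  moreover have "product_map A (\<alpha> a) = a" if "a \<in> carr A" for a
    using \<psi>(2)[OF that] that by (simp add: \<psi>_eq \<beta>_zero vadd_zero product_map_linear \<alpha>)
  ultimately show ?thesis
    by (rule that)
qed

end

section \<open>The Banach algebra of a continuous field\<close>

lemma (in complex_normed_space) is_seminormed: "complex_seminormed_space V"
  by (rule seminormed)

lemma continuous_map_real_near:
  assumes "continuous_map X euclideanreal f" "t \<in> topspace X" "0 < e"
  obtains N where "openin X N" "t \<in> N" "\<And>s. s \<in> N \<Longrightarrow> \<bar>f s - f t\<bar> < e"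
proof
  show "openin X {s \<in> topspace X. f s \<in> ball (f t) e}"
    using assms(1) by (rule openin_continuous_map_preimage) simp
qed (use assms in \<open>auto simp: dist_real_def abs_minus_commute\<close>)

lemma vanishing_at_infinity_le:
  assumes "vanishing_at_infinity X f" "\<And>t. t \<in> topspace X \<Longrightarrow> \<bar>g t\<bar> \<le> C * \<bar>f t\<bar>"
  shows "vanishing_at_infinity X g"
  unfolding vanishing_at_infinity_def
proof (intro allI impI)
  fix e :: real
  assume e: "0 < e"
  then obtain K where K: "compactin X K" "\<And>t. t \<in> topspace X - K \<Longrightarrow> \<bar>f t\<bar> < e / (\<bar>C\<bar> + 1)"
    using assms(1) unfolding vanishing_at_infinity_def
    by (meson abs_ge_zero add_nonneg_pos divide_pos_pos zero_less_one)
  have "\<bar>g t\<bar> < e" if t: "t \<in> topspace X - K" for t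
  proof -
    have "\<bar>g t\<bar> \<le> C * \<bar>f t\<bar>"
      using assms(2) t by simp
    also have "\<dots> \<le> (\<bar>C\<bar> + 1) * \<bar>f t\<bar>"
      by (intro mult_right_mono) auto
    also have "\<dots> < e"
      using K(2)[OF t] by (simp add: pos_less_divide_eq add_nonneg_pos mult.commute)
    finally show ?thesis .
  qed
  with K(1) show "\<exists>K. compactin X K \<and> (\<forall>t\<in>topspace X - K. \<bar>g t\<bar> < e)"
    by blast
qed

lemma vanishing_at_infinity_add:
  assumes "vanishing_at_infinity X f" "vanishing_at_infinity X g"
    and le: "\<And>t. t \<in> topspace X \<Longrightarrow> \<bar>h t\<bar> \<le> \<bar>f t\<bar> + \<bar>g t\<bar>"
  shows "vanishing_at_infinity X h"
  unfolding vanishing_at_infinity_def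
proof (intro allI impI)
  fix e :: real
  assume "0 < e"
  then have "0 < e / 2" by simp
  then obtain K L where K: "compactin X K" "\<And>t. t \<in> topspace X - K \<Longrightarrow> \<bar>f t\<bar> < e / 2"
    and L: "compactin X L" "\<And>t. t \<in> topspace X - L \<Longrightarrow> \<bar>g t\<bar> < e / 2"
    using assms(1,2) unfolding vanishing_at_infinity_def by meson
  have "\<bar>h t\<bar> < e" if "t \<in> topspace X - (K \<union> L)" for t
    using le[of t] K(2)[of t] L(2)[of t] that by auto
  then show "\<exists>K. compactin X K \<and> (\<forall>t\<in>topspace X - K. \<bar>h t\<bar> < e)"
    using compactin_Un[OF K(1) L(1)] by blast
qed

locale banach_field =
  fixes U :: "('t, 'a) cfield"
  assumes continuous_field: "continuous_field U"
begin

abbreviation "X \<equiv> base U"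
abbreviation "\<Omega> \<equiv> topspace (base U)"
abbreviation "F \<equiv> fibre U"
abbreviation "\<A> \<equiv> field_algebra U"

lemma fibre_algebra: "t \<in> \<Omega> \<Longrightarrow> complex_banach_algebra (F t)"
  using continuous_field by (simp add: continuous_field_def)

lemma fibre_normed: "t \<in> \<Omega> \<Longrightarrow> complex_normed_space (F t)"
  using fibre_algebra complex_banach_algebra.axioms(1) complex_banach_space.axioms(1) by blast

lemma fibre_seminormed: "t \<in> \<Omega> \<Longrightarrow> complex_seminormed_space (F t)"
  by (rule complex_normed_space.is_seminormed[OF fibre_normed])

lemma fibre_space: "t \<in> \<Omega> \<Longrightarrow> complex_vector_space (F t)"
  using fibre_normed complex_normed_space.axioms(1) by blast

lemmas fibre_closed = complex_vector_space.closed[OF fibre_space]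
  complex_banach_algebra.amul_closed[OF fibre_algebra]

lemma section_carr: "\<lbrakk>x \<in> sections U; t \<in> \<Omega>\<rbrakk> \<Longrightarrow> x t \<in> carr (F t)"
  and section_extensional: "x \<in> sections U \<Longrightarrow> x \<in> extensional \<Omega>"
  using continuous_field
  by (auto simp: continuous_field_def subalgebra_of_product_def all_sections_def Let_def PiE_def)

lemma section_ops:
  "(\<lambda>t\<in>\<Omega>. vzero (F t)) \<in> sections U"
  "\<lbrakk>x \<in> sections U; y \<in> sections U\<rbrakk> \<Longrightarrow> (\<lambda>t\<in>\<Omega>. vadd (F t) (x t) (y t)) \<in> sections U"
  "\<lbrakk>x \<in> sections U; y \<in> sections U\<rbrakk> \<Longrightarrow> (\<lambda>t\<in>\<Omega>. amul (F t) (x t) (y t)) \<in> sections U"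
  "x \<in> sections U \<Longrightarrow> (\<lambda>t\<in>\<Omega>. vscale (F t) c (x t)) \<in> sections U"
  using continuous_field
  by (auto simp: continuous_field_def subalgebra_of_product_def section_algebra_def Let_def)

lemma continuous_norm: "x \<in> sections U \<Longrightarrow> continuous_map X euclideanreal (\<lambda>t. vnorm (F t) (x t))"
  using continuous_field by (simp add: continuous_field_def)

lemma sectionI:
  assumes "\<And>t. t \<in> \<Omega> \<Longrightarrow> x t \<in> carr (F t)" "x \<in> extensional \<Omega>"
    and "\<And>t e. \<lbrakk>t \<in> \<Omega>; 0 < e\<rbrakk> \<Longrightarrow> \<exists>x'\<in>sections U. \<exists>N. openin X N \<and> t \<in> N \<and>
      (\<forall>s\<in>N. vdist (F s) (x s) (x' s) \<le> e)"
  shows "x \<in> sections U"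
proof -
  have "x \<in> local_closure X F (sections U)"
    using assms by (auto simp: local_closure_def all_sections_def PiE_iff)
  then show ?thesis
    using continuous_field by (auto simp: continuous_field_def)
qed

lemma carr_field_algebra:
  "x \<in> carr \<A> \<longleftrightarrow> x \<in> sections U \<and> vanishing_at_infinity X (\<lambda>t. vnorm (F t) (x t))"
  by (simp add: field_algebra_def section_algebra_def)

lemma field_ops:
  "vzero \<A> = (\<lambda>t\<in>\<Omega>. vzero (F t))"
  "vadd \<A> x y = (\<lambda>t\<in>\<Omega>. vadd (F t) (x t) (y t))"
  "vscale \<A> c x = (\<lambda>t\<in>\<Omega>. vscale (F t) c (x t))"
  "amul \<A> x y = (\<lambda>t\<in>\<Omega>. amul (F t) (x t) (y t))"
  "vnorm \<A> x = Sup (insert 0 ((\<lambda>t. vnorm (F t) (x t)) ` \<Omega>))"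
  by (simp_all add: field_algebra_def section_algebra_def)

lemma vsub_field: "t \<in> \<Omega> \<Longrightarrow> vsub \<A> x y t = vsub (F t) (x t) (y t)"
  by (simp add: vsub_def field_ops)

lemma field_carr: "\<lbrakk>x \<in> carr \<A>; t \<in> \<Omega>\<rbrakk> \<Longrightarrow> x t \<in> carr (F t)"
  by (simp add: carr_field_algebra section_carr)

lemma norm_nonneg: "\<lbrakk>x \<in> carr \<A>; t \<in> \<Omega>\<rbrakk> \<Longrightarrow> 0 \<le> vnorm (F t) (x t)"
  by (simp add: complex_normed_space.vnorm_nonneg[OF fibre_normed] field_carr)

lemma field_eqI:
  assumes "x \<in> extensional \<Omega>" "y \<in> extensional \<Omega>" "\<And>t. t \<in> \<Omega> \<Longrightarrow> x t = y t"
  shows "x = y"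
  using assms by (rule extensionalityI)

lemma field_norm_bdd:
  assumes x: "x \<in> carr \<A>"
  shows "bdd_above (insert 0 ((\<lambda>t. vnorm (F t) (x t)) ` \<Omega>))"
proof -
  have "continuous_map X euclideanreal (\<lambda>t. vnorm (F t) (x t))"
    and "vanishing_at_infinity X (\<lambda>t. vnorm (F t) (x t))"
    using x by (simp_all add: carr_field_algebra continuous_norm)
  then obtain K where K: "compactin X K" "\<forall>t\<in>\<Omega> - K. \<bar>vnorm (F t) (x t)\<bar> < 1"
    and cont: "continuous_map X euclideanreal (\<lambda>t. vnorm (F t) (x t))"
    unfolding vanishing_at_infinity_def by (meson zero_less_one)
  have "compact ((\<lambda>t. vnorm (F t) (x t)) ` K)"
    using image_compactin[OF K(1) cont] by simp
  then have "bdd_above ((\<lambda>t. vnorm (F t) (x t)) ` K)"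
    by (intro bounded_imp_bdd_above compact_imp_bounded)
  then obtain M where M: "\<And>t. t \<in> K \<Longrightarrow> vnorm (F t) (x t) \<le> M"
    unfolding bdd_above_def by blast
  have "vnorm (F t) (x t) \<le> max 1 M" if "t \<in> \<Omega>" for t
  proof (cases "t \<in> K")
    case True
    then show ?thesis using M[OF True] by simp
  next
    case False
    then show ?thesis using bspec[OF K(2), of t] that by auto
  qed
  then show ?thesis
    by (intro bdd_aboveI[of _ "max 1 M"]) auto
qed

lemma norm_le_field_norm: "\<lbrakk>x \<in> carr \<A>; t \<in> \<Omega>\<rbrakk> \<Longrightarrow> vnorm (F t) (x t) \<le> vnorm \<A> x"
  unfolding field_ops by (intro cSup_upper field_norm_bdd) auto

lemma field_norm_le:
  "\<lbrakk>0 \<le> M; \<And>t. t \<in> \<Omega> \<Longrightarrow> vnorm (F t) (x t) \<le> M\<rbrakk> \<Longrightarrow> vnorm \<A> x \<le> M"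
  unfolding field_ops by (intro cSup_least) auto

lemma field_norm_nonneg: "x \<in> carr \<A> \<Longrightarrow> 0 \<le> vnorm \<A> x"
  unfolding field_ops by (intro cSup_upper field_norm_bdd) auto

lemma field_closed:
  "vzero \<A> \<in> carr \<A>"
  "\<lbrakk>x \<in> carr \<A>; y \<in> carr \<A>\<rbrakk> \<Longrightarrow> vadd \<A> x y \<in> carr \<A>"
  "x \<in> carr \<A> \<Longrightarrow> vscale \<A> c x \<in> carr \<A>"
  "\<lbrakk>x \<in> carr \<A>; y \<in> carr \<A>\<rbrakk> \<Longrightarrow> amul \<A> x y \<in> carr \<A>"
proof -
  show "vzero \<A> \<in> carr \<A>"
    unfolding carr_field_algebra vanishing_at_infinity_def
    by (simp add: field_ops section_ops complex_seminormed_space.seminorm_vzero[OF fibre_seminormed])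
      (metis compactin_empty)
  note norms = complex_normed_space.vnorm_nonneg[OF fibre_normed]
    complex_normed_space.vnorm_triangle[OF fibre_normed]
    complex_normed_space.vnorm_vscale[OF fibre_normed] fibre_closed field_carr
  assume x: "x \<in> carr \<A>"
  then have vx: "vanishing_at_infinity X (\<lambda>t. vnorm (F t) (x t))" and sx: "x \<in> sections U"
    by (simp_all add: carr_field_algebra)
  have "vanishing_at_infinity X (\<lambda>t. vnorm (F t) (vscale \<A> c x t))"
    by (rule vanishing_at_infinity_le[OF vx, of _ "cmod c"]) (simp add: field_ops norms x abs_mult)
  then show "vscale \<A> c x \<in> carr \<A>"
    using sx by (simp add: carr_field_algebra field_ops section_ops)
  assume y: "y \<in> carr \<A>"
  then have vy: "vanishing_at_infinity X (\<lambda>t. vnorm (F t) (y t))" and sy: "y \<in> sections U"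
    by (simp_all add: carr_field_algebra)
  have "vanishing_at_infinity X (\<lambda>t. vnorm (F t) (vadd \<A> x y t))"
    by (rule vanishing_at_infinity_add[OF vx vy]) (simp add: field_ops norms x y)
  then show "vadd \<A> x y \<in> carr \<A>"
    using sx sy by (simp add: carr_field_algebra field_ops section_ops)
  have "vanishing_at_infinity X (\<lambda>t. vnorm (F t) (amul \<A> x y t))"
  proof (rule vanishing_at_infinity_le[OF vy, of _ "vnorm \<A> x"])
    fix t
    assume t: "t \<in> \<Omega>"
    have "vnorm (F t) (amul (F t) (x t) (y t)) \<le> vnorm (F t) (x t) * vnorm (F t) (y t)"
      using complex_banach_algebra.vnorm_amul[OF fibre_algebra] t x y by (simp add: field_carr)
    also have "\<dots> \<le> vnorm \<A> x * vnorm (F t) (y t)"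
      using t x y by (intro mult_right_mono norm_le_field_norm norm_nonneg)
    finally show "\<bar>vnorm (F t) (amul \<A> x y t)\<bar> \<le> vnorm \<A> x * \<bar>vnorm (F t) (y t)\<bar>"
      using t x y by (simp add: field_ops norms)
  qed
  then show "amul \<A> x y \<in> carr \<A>"
    using sx sy by (simp add: carr_field_algebra field_ops section_ops)
qed

lemma field_extensional:
  "x \<in> carr \<A> \<Longrightarrow> x \<in> extensional \<Omega>" "vzero \<A> \<in> extensional \<Omega>" "vadd \<A> x y \<in> extensional \<Omega>"
  "vscale \<A> c x \<in> extensional \<Omega>" "amul \<A> x y \<in> extensional \<Omega>" "vsub \<A> x y \<in> extensional \<Omega>"
  by (simp_all add: carr_field_algebra section_extensional field_ops vsub_def)

lemma complex_vector_space_field: "complex_vector_space \<A>"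
proof unfold_locales
  show "vzero \<A> \<in> carr \<A>"
    by (rule field_closed)
  fix x y z c d
  assume x: "x \<in> carr \<A>"
  note D = x field_carr[OF x] fibre_closed field_ops(1-4) vsub_field
  show "vscale \<A> c x \<in> carr \<A>"
    using x by (rule field_closed)
  show "vadd \<A> x (vzero \<A>) = x" "vsub \<A> x x = vzero \<A>" "vscale \<A> 1 x = x"
    "vscale \<A> (c + d) x = vadd \<A> (vscale \<A> c x) (vscale \<A> d x)"
    "vscale \<A> c (vscale \<A> d x) = vscale \<A> (c * d) x"
    by (rule field_eqI; simp add: field_extensional D complex_vector_space.vadd_zero[OF fibre_space]
        complex_vector_space.vsub_self[OF fibre_space] complex_vector_space.vscale_one[OF fibre_space]
        complex_vector_space.vscale_add[OF fibre_space] complex_vector_space.vscale_vscale[OF fibre_space])+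
  assume y: "y \<in> carr \<A>"
  note D = D y field_carr[OF y]
  show "vadd \<A> x y \<in> carr \<A>"
    using x y by (rule field_closed)
  show "vadd \<A> x y = vadd \<A> y x" "vscale \<A> c (vadd \<A> x y) = vadd \<A> (vscale \<A> c x) (vscale \<A> c y)"
    by (rule field_eqI; simp add: field_extensional D complex_vector_space.vscale_vadd[OF fibre_space]
        complex_vector_space.vadd_commute[OF fibre_space])+
  assume z: "z \<in> carr \<A>"
  show "vadd \<A> (vadd \<A> x y) z = vadd \<A> x (vadd \<A> y z)"
    by (rule field_eqI) (simp_all add: field_extensional D z field_carr[OF z]
        complex_vector_space.vadd_assoc[OF fibre_space])
qed

lemma complex_normed_space_field: "complex_normed_space \<A>"
proof -
  interpret A: complex_vector_space \<A>
    by (rule complex_vector_space_field)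
  show ?thesis
  proof unfold_locales
    fix x y c
    assume x: "x \<in> carr \<A>"
    show "0 \<le> vnorm \<A> x"
      using x by (rule field_norm_nonneg)
    show "vnorm \<A> x = 0 \<longleftrightarrow> x = vzero \<A>"
    proof
      assume 0: "vnorm \<A> x = 0"
      show "x = vzero \<A>"
      proof (rule field_eqI)
        fix t
        assume t: "t \<in> \<Omega>"
        then have "vnorm (F t) (x t) = 0"
          using norm_le_field_norm[OF x t] norm_nonneg[OF x t] 0 by simp
        then show "x t = vzero \<A> t"
          using complex_normed_space.vnorm_eq_0_iff[OF fibre_normed] t x by (simp add: field_ops field_carr)
      qed (simp_all add: field_extensional x)
    next
      assume 0: "x = vzero \<A>"
      have "vnorm \<A> x \<le> 0"
        by (rule field_norm_le)
          (simp_all add: 0 field_ops complex_seminormed_space.seminorm_vzero[OF fibre_seminormed])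
      then show "vnorm \<A> x = 0"
        using field_norm_nonneg[OF x] by simp
    qed
    have "vnorm \<A> (vscale \<A> k z) \<le> cmod k * vnorm \<A> z" if "z \<in> carr \<A>" for k z
      by (rule field_norm_le)
        (simp_all add: field_norm_nonneg that field_carr field_ops(3) mult_left_mono norm_le_field_norm
          complex_normed_space.vnorm_vscale[OF fibre_normed])
    with field_norm_nonneg show "vnorm \<A> (vscale \<A> c x) = cmod c * vnorm \<A> x"
      using x by (rule A.homogeneousI)
    assume y: "y \<in> carr \<A>"
    show "vnorm \<A> (vadd \<A> x y) \<le> vnorm \<A> x + vnorm \<A> y"
    proof (rule field_norm_le)
      fix t
      assume t: "t \<in> \<Omega>"
      have "vnorm (F t) (vadd (F t) (x t) (y t)) \<le> vnorm (F t) (x t) + vnorm (F t) (y t)"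
        using complex_normed_space.vnorm_triangle[OF fibre_normed] t x y by (simp add: field_carr)
      then show "vnorm (F t) (vadd \<A> x y t) \<le> vnorm \<A> x + vnorm \<A> y"
        using norm_le_field_norm[OF x t] norm_le_field_norm[OF y t] t by (simp add: field_ops)
    qed (simp add: field_norm_nonneg x y)
  qed
qed

lemma vdist_fibre_le:
  assumes "x \<in> carr \<A>" "y \<in> carr \<A>" "t \<in> \<Omega>"
  shows "vdist (F t) (x t) (y t) \<le> vdist \<A> x y"
proof -
  interpret A: complex_normed_space \<A>
    by (rule complex_normed_space_field)
  show ?thesis
    using norm_le_field_norm[OF A.vsub_closed[OF assms(1,2)] assms(3)] assms
    by (simp add: vdist_def field_carr vsub_field)
qed

lemma vdist_field_le:
  assumes "x \<in> carr \<A>" "y \<in> carr \<A>" "0 \<le> M" "\<And>t. t \<in> \<Omega> \<Longrightarrow> vdist (F t) (x t) (y t) \<le> M"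
  shows "vdist \<A> x y \<le> M"
proof -
  interpret A: complex_normed_space \<A>
    by (rule complex_normed_space_field)
  have "vnorm (F t) (vsub \<A> x y t) \<le> M" if "t \<in> \<Omega>" for t
    using assms(4)[OF that] assms that by (simp add: vdist_def field_carr vsub_field)
  then show ?thesis
    using field_norm_le[OF assms(3), of "vsub \<A> x y"] assms by (simp add: vdist_def)
qed

lemma complex_banach_space_field: "complex_banach_space \<A>"
proof -
  interpret A: complex_normed_space \<A>
    by (rule complex_normed_space_field)
  show ?thesis
  proof (rule A.complex_banach_spaceI)
    fix s
    assume s: "s \<in> cauchy_seqs \<A>"
    have sA: "s n \<in> carr \<A>" for n
      by (rule A.cauchy_seqs_carr[OF s])
    have "\<exists>y\<in>carr (F t). vlim (F t) (\<lambda>n. s n t) y" if t: "t \<in> \<Omega>" for t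
    proof -
      interpret Ft: complex_banach_algebra "F t"
        by (rule fibre_algebra[OF t])
      show ?thesis
        by (rule Ft.cauchy_convergent, rule cauchy_seqs_dominated[OF s A.seminormed, of _ _ 1])
          (simp_all add: field_carr sA t vdist_fibre_le)
    qed
    then obtain l where l: "\<And>t. t \<in> \<Omega> \<Longrightarrow> l t \<in> carr (F t)" "\<And>t. t \<in> \<Omega> \<Longrightarrow> vlim (F t) (\<lambda>n. s n t) (l t)"
      by metis
    define x where "x = (\<lambda>t\<in>\<Omega>. l t)"
    have x: "x t \<in> carr (F t)" "vlim (F t) (\<lambda>n. s n t) (x t)" if "t \<in> \<Omega>" for t
      using l that by (simp_all add: x_def)
    have uniform: "\<exists>N. \<forall>n\<ge>N. \<forall>t\<in>\<Omega>. vdist (F t) (x t) (s n t) \<le> e" if e: "0 < e" for e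
    proof -
      obtain N where N: "\<And>m n. \<lbrakk>N \<le> m; N \<le> n\<rbrakk> \<Longrightarrow> vdist \<A> (s m) (s n) < e"
        using A.cauchy_seqsD[OF s e] by blast
      have "vdist (F t) (x t) (s n t) \<le> e" if n: "N \<le> n" and t: "t \<in> \<Omega>" for n t
      proof -
        interpret Ft: complex_banach_algebra "F t"
          by (rule fibre_algebra[OF t])
        have "(\<lambda>m. vdist (F t) (s m t) (x t) + e) \<longlonglongrightarrow> 0 + e"
          using x(2)[OF t] unfolding vlim_def by (intro tendsto_intros)
        moreover have "vdist (F t) (x t) (s n t) \<le> vdist (F t) (s m t) (x t) + e" if "N \<le> m" for m
          using Ft.vdist_triangle[of "x t" "s m t" "s n t"] x(1)[OF t] field_carr[OF sA t]
            vdist_fibre_le[OF sA sA t, of m n] N[OF that n] by (simp add: Ft.vdist_commute)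
        ultimately show ?thesis
          using LIMSEQ_le_const by fastforce
      qed
      then show ?thesis
        by blast
    qed
    have "x \<in> sections U"
    proof (rule sectionI)
      fix t e
      assume t: "t \<in> \<Omega>" and e: "(0::real) < e"
      then obtain N where "\<forall>s'\<in>\<Omega>. vdist (F s') (x s') (s N s') \<le> e"
        using uniform by blast
      then show "\<exists>x'\<in>sections U. \<exists>N. openin X N \<and> t \<in> N \<and> (\<forall>s\<in>N. vdist (F s) (x s) (x' s) \<le> e)"
        using sA[of N] t by (intro bexI[of _ "s N"] exI[of _ \<Omega>]) (auto simp: carr_field_algebra)
    qed (simp_all add: x, simp add: x_def)
    moreover have "vanishing_at_infinity X (\<lambda>t. vnorm (F t) (x t))"
      unfolding vanishing_at_infinity_def
    proof (intro allI impI)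
      fix e :: real
      assume "0 < e"
      then have e: "0 < e / 2" by simp
      then obtain N where N: "\<forall>t\<in>\<Omega>. vdist (F t) (x t) (s N t) \<le> e / 2"
        using uniform by blast
      obtain K where K: "compactin X K" "\<forall>t\<in>\<Omega> - K. \<bar>vnorm (F t) (s N t)\<bar> < e / 2"
        using sA[of N] e unfolding carr_field_algebra vanishing_at_infinity_def by blast
      have "\<bar>vnorm (F t) (x t)\<bar> < e" if t: "t \<in> \<Omega> - K" for t
      proof -
        interpret Ft: complex_banach_algebra "F t"
          by (rule fibre_algebra) (use t in simp)
        have t': "t \<in> \<Omega>"
          using t by simp
        show ?thesis
          using Ft.norm_diff_le_vdist[OF x(1)[OF t'] field_carr[OF sA t'], of N] bspec[OF N t']
            bspec[OF K(2) t] Ft.vnorm_nonneg[OF x(1)[OF t']] by linarith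
      qed
      with K(1) show "\<exists>K. compactin X K \<and> (\<forall>t\<in>\<Omega> - K. \<bar>vnorm (F t) (x t)\<bar> < e)"
        by blast
    qed
    ultimately have xA: "x \<in> carr \<A>"
      by (simp add: carr_field_algebra)
    have "vlim \<A> s x"
      unfolding vlim_def LIMSEQ_iff
    proof (intro allI impI)
      fix e :: real
      assume "0 < e"
      then have e: "0 < e / 2" by simp
      then obtain N where N: "\<forall>n\<ge>N. \<forall>t\<in>\<Omega>. vdist (F t) (x t) (s n t) \<le> e / 2"
        using uniform by blast
      have "norm (vdist \<A> (s n) x - 0) < e" if "N \<le> n" for n
        using vdist_field_le[OF xA sA, of "e / 2" n] N that e A.vdist_nonneg[of x "s n"]
        by (simp add: A.vdist_commute[of "s n"])
      then show "\<exists>N. \<forall>n\<ge>N. norm (vdist \<A> (s n) x - 0) < e"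
        by blast
    qed
    with xA show "\<exists>x\<in>carr \<A>. vlim \<A> s x"
      by blast
  qed
qed

lemma complex_banach_algebra_field: "complex_banach_algebra \<A>"
proof -
  interpret A: complex_banach_space \<A>
    by (rule complex_banach_space_field)
  show ?thesis
  proof unfold_locales
    fix x y z c
    assume x: "x \<in> carr \<A>" and y: "y \<in> carr \<A>"
    note D = fibre_closed field_ops(1-4) field_extensional x y field_carr[OF x] field_carr[OF y]
    show "amul \<A> x y \<in> carr \<A>"
      using x y by (rule field_closed)
    show "amul \<A> (vscale \<A> c x) y = vscale \<A> c (amul \<A> x y)"
      "amul \<A> x (vscale \<A> c y) = vscale \<A> c (amul \<A> x y)"
      by (rule field_eqI; simp add: D complex_banach_algebra.amul_vscale_left[OF fibre_algebra]
          complex_banach_algebra.amul_vscale_right[OF fibre_algebra])+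
    show "vnorm \<A> (amul \<A> x y) \<le> vnorm \<A> x * vnorm \<A> y"
    proof (rule field_norm_le)
      fix t
      assume t: "t \<in> \<Omega>"
      have "vnorm (F t) (amul \<A> x y t) \<le> vnorm (F t) (x t) * vnorm (F t) (y t)"
        using complex_banach_algebra.vnorm_amul[OF fibre_algebra] t by (simp add: D)
      also have "\<dots> \<le> vnorm \<A> x * vnorm \<A> y"
        using t x y by (intro mult_mono norm_le_field_norm norm_nonneg field_norm_nonneg)
      finally show "vnorm (F t) (amul \<A> x y t) \<le> vnorm \<A> x * vnorm \<A> y" .
    qed (simp add: field_norm_nonneg x y)
    assume z: "z \<in> carr \<A>"
    show "amul \<A> (amul \<A> x y) z = amul \<A> x (amul \<A> y z)"
      "amul \<A> (vadd \<A> x y) z = vadd \<A> (amul \<A> x z) (amul \<A> y z)"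
      "amul \<A> x (vadd \<A> y z) = vadd \<A> (amul \<A> x y) (amul \<A> x z)"
      by (rule field_eqI; simp add: D field_carr[OF z] complex_banach_algebra.amul_assoc[OF fibre_algebra]
          complex_banach_algebra.amul_vadd_left[OF fibre_algebra]
          complex_banach_algebra.amul_vadd_right[OF fibre_algebra])+
  qed
qed

end

sublocale banach_field \<subseteq> A: complex_banach_algebra "field_algebra U"
  by (rule complex_banach_algebra_field)

context banach_field
begin

definition fun_scale :: "('t \<Rightarrow> real) \<Rightarrow> ('t \<Rightarrow> 'a) \<Rightarrow> 't \<Rightarrow> 'a" where
  "fun_scale g x = (\<lambda>t\<in>\<Omega>. vscale (F t) (complex_of_real (g t)) (x t))"

lemma fun_scale_section:
  assumes x: "x \<in> sections U" and g: "continuous_map X euclideanreal g"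
  shows "fun_scale g x \<in> sections U"
proof (rule sectionI)
  show "fun_scale g x t \<in> carr (F t)" if "t \<in> \<Omega>" for t
    using that by (simp add: fun_scale_def fibre_closed section_carr x)
  show "fun_scale g x \<in> extensional \<Omega>"
    by (simp add: fun_scale_def)
  fix t e
  assume t: "t \<in> \<Omega>" and e: "(0::real) < e"
  let ?M = "vnorm (F t) (x t) + 1"
  have M: "0 < ?M"
    using complex_normed_space.vnorm_nonneg[OF fibre_normed[OF t] section_carr[OF x t]] by simp
  obtain N where N: "openin X N" "t \<in> N" "\<And>s. s \<in> N \<Longrightarrow> \<bar>vnorm (F s) (x s) - vnorm (F t) (x t)\<bar> < 1"
    using continuous_map_real_near[OF continuous_norm[OF x] t zero_less_one] by blast
  obtain L where L: "openin X L" "t \<in> L" "\<And>s. s \<in> L \<Longrightarrow> \<bar>g s - g t\<bar> < e / ?M"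
    using continuous_map_real_near[OF g t, of "e / ?M"] e M by auto
  let ?x = "\<lambda>s\<in>\<Omega>. vscale (F s) (complex_of_real (g t)) (x s)"
  have "vdist (F s) (fun_scale g x s) (?x s) \<le> e" if s: "s \<in> N \<inter> L" for s
  proof -
    have s': "s \<in> \<Omega>"
      using s N(1) openin_subset by blast
    interpret Fs: complex_banach_algebra "F s"
      by (rule fibre_algebra[OF s'])
    have xs: "x s \<in> carr (F s)"
      by (rule section_carr[OF x s'])
    have "vsub (F s) (vscale (F s) (complex_of_real (g s)) (x s)) (vscale (F s) (complex_of_real (g t)) (x s)) =
        vscale (F s) (complex_of_real (g s - g t)) (x s)"
      using Fs.vscale_add[OF xs, of "complex_of_real (g s)" "- complex_of_real (g t)"] xs
      by (simp add: vsub_def Fs.vscale_vscale)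
    then have "vdist (F s) (fun_scale g x s) (?x s) = \<bar>g s - g t\<bar> * vnorm (F s) (x s)"
      using s' by (simp add: fun_scale_def Fs.vdist_eq Fs.closed xs Fs.vnorm_vscale flip: of_real_diff)
    also have "\<dots> \<le> (e / ?M) * ?M"
      using N(3)[of s] L(3)[of s] s e M Fs.vnorm_nonneg[OF xs]
      by (intro mult_mono) (auto simp: less_imp_le)
    finally show ?thesis
      using M by simp
  qed
  then show "\<exists>x'\<in>sections U. \<exists>N. openin X N \<and> t \<in> N \<and> (\<forall>s\<in>N. vdist (F s) (fun_scale g x s) (x' s) \<le> e)"
    using N(1,2) L(1,2) section_ops(4)[OF x, of "complex_of_real (g t)"]
    by (intro bexI[of _ ?x] exI[of _ "N \<inter> L"]) (auto simp: openin_Int)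
qed

lemma norm_fun_scale:
  "\<lbrakk>x \<in> carr \<A>; t \<in> \<Omega>\<rbrakk> \<Longrightarrow> vnorm (F t) (fun_scale g x t) = \<bar>g t\<bar> * vnorm (F t) (x t)"
  by (simp add: fun_scale_def complex_normed_space.vnorm_vscale[OF fibre_normed] field_carr)

text \<open>With this bound, scaling a section by \<open>g\<close> is a contraction of \<open>\<A>\<close>.\<close>

definition multiplier :: "('t \<Rightarrow> real) \<Rightarrow> bool" where
  "multiplier g \<longleftrightarrow> continuous_map X euclideanreal g \<and> (\<forall>t\<in>\<Omega>. \<bar>g t\<bar> \<le> 1)"

lemma fun_scale_closed:
  assumes g: "multiplier g" and x: "x \<in> carr \<A>"
  shows "fun_scale g x \<in> carr \<A>"
proof -
  have "vanishing_at_infinity X (\<lambda>t. vnorm (F t) (fun_scale g x t))"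
  proof (rule vanishing_at_infinity_le[of _ _ _ 1])
    show "vanishing_at_infinity X (\<lambda>t. vnorm (F t) (x t))"
      using x by (simp add: carr_field_algebra)
    fix t
    assume t: "t \<in> \<Omega>"
    then have "\<bar>g t\<bar> \<le> 1"
      using g by (simp add: multiplier_def)
    from mult_right_mono[OF this norm_nonneg[OF x t]]
    show "\<bar>vnorm (F t) (fun_scale g x t)\<bar> \<le> 1 * \<bar>vnorm (F t) (x t)\<bar>"
      using norm_nonneg[OF x t] by (simp add: norm_fun_scale x t)
  qed
  then show ?thesis
    using fun_scale_section[of x g] g x by (simp add: carr_field_algebra multiplier_def)
qed

lemma fun_scale_extensional [simp]: "fun_scale g x \<in> extensional \<Omega>"
  by (simp add: fun_scale_def)

lemma fun_scale_vadd:
  "\<lbrakk>x \<in> carr \<A>; y \<in> carr \<A>\<rbrakk> \<Longrightarrow> fun_scale g (vadd \<A> x y) = vadd \<A> (fun_scale g x) (fun_scale g y)"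
  by (rule field_eqI) (simp_all add: field_extensional fun_scale_def field_ops(2) field_carr
      complex_vector_space.vscale_vadd[OF fibre_space])

lemma fun_scale_amul:
  assumes "x \<in> carr \<A>" "y \<in> carr \<A>"
  shows "fun_scale g (amul \<A> x y) = amul \<A> (fun_scale g x) y"
    and "fun_scale g (amul \<A> x y) = amul \<A> x (fun_scale g y)"
  by (rule field_eqI; simp add: assms field_extensional fun_scale_def field_ops(4) field_carr
      complex_banach_algebra.amul_vscale_left[OF fibre_algebra]
      complex_banach_algebra.amul_vscale_right[OF fibre_algebra])+

lemma fun_scale_complement:
  assumes "x \<in> carr \<A>"
  shows "vadd \<A> (fun_scale g x) (fun_scale (\<lambda>t. 1 - g t) x) = x"
proof (rule field_eqI)
  fix t
  assume t: "t \<in> \<Omega>"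
  show "vadd \<A> (fun_scale g x) (fun_scale (\<lambda>t. 1 - g t) x) t = x t"
    using complex_vector_space.vscale_add[OF fibre_space[OF t] field_carr[OF assms t], of "complex_of_real (g t)"
        "complex_of_real (1 - g t)"] t assms
    by (simp add: field_ops fun_scale_def complex_vector_space.vscale_one[OF fibre_space] field_carr)
qed (simp_all add: field_extensional assms)

lemma vdist_fun_scale_le:
  assumes g: "multiplier g" and x: "x \<in> carr \<A>" and y: "y \<in> carr \<A>"
  shows "vdist \<A> (fun_scale g x) (fun_scale g y) \<le> vdist \<A> x y"
proof (rule vdist_field_le)
  fix t
  assume t: "t \<in> \<Omega>"
  interpret Ft: complex_banach_algebra "F t"
    by (rule fibre_algebra[OF t])
  have "vdist (F t) (fun_scale g x t) (fun_scale g y t) = \<bar>g t\<bar> * vdist (F t) (x t) (y t)"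
    using t by (simp add: fun_scale_def Ft.vdist_vscale field_carr x y)
  also have "\<dots> \<le> 1 * vdist \<A> x y"
    using g t vdist_fibre_le[OF x y t] by (intro mult_mono) (auto simp: multiplier_def Ft.vdist_nonneg)
  finally show "vdist (F t) (fun_scale g x t) (fun_scale g y t) \<le> vdist \<A> x y"
    by simp
qed (simp_all add: fun_scale_closed assms A.vdist_nonneg)

text \<open>
  A section vanishing at \<open>t\<close> is a limit of multiples of itself by functions vanishing at \<open>t\<close>: the
  function \<open>h = max 0 (1 - n \<parallel>x\<parallel>)\<close> is \<open>1\<close> at \<open>t\<close> and \<open>\<parallel>h x\<parallel> \<le> 1/n\<close>.
\<close>

lemma vanishing_section_limit:
  assumes x: "x \<in> carr \<A>" and t: "t \<in> \<Omega>" and zero: "x t = vzero (F t)"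
  obtains g where "\<And>n. multiplier (g n)" "\<And>n. g n t = 0" "vlim \<A> (\<lambda>n. fun_scale (g n) x) x"
proof
  let ?h = "\<lambda>n s. max 0 (1 - real (Suc n) * vnorm (F s) (x s))"
  let ?g = "\<lambda>n s. 1 - ?h n s"
  have cont: "continuous_map X euclideanreal (\<lambda>s. vnorm (F s) (x s))"
    using x by (simp add: carr_field_algebra continuous_norm)
  have h: "0 \<le> ?h n s" "?h n s \<le> 1" if "s \<in> \<Omega>" for n s
    using norm_nonneg[OF x that] by auto
  have m: "multiplier (?h n)" for n
    unfolding multiplier_def using h
    by (auto intro!: continuous_map_real_max continuous_map_diff continuous_map_real_mult cont)
  show mg: "multiplier (?g n)" for n
    using m[of n] h unfolding multiplier_def by (auto intro!: continuous_map_diff)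
  show "?g n t = 0" for n
    by (simp add: zero complex_seminormed_space.seminorm_vzero[OF fibre_seminormed[OF t]])
  show "vlim \<A> (\<lambda>n. fun_scale (?g n) x) x"
  proof (rule A.vlim_squeeze[OF _ LIMSEQ_inverse_real_of_nat])
    fix n
    have eq: "vsub \<A> x (fun_scale (?g n) x) = fun_scale (?h n) x"
    proof (rule field_eqI)
      fix s
      assume s: "s \<in> \<Omega>"
      interpret Fs: complex_banach_algebra "F s"
        by (rule fibre_algebra[OF s])
      have xs: "x s \<in> carr (F s)"
        by (rule field_carr[OF x s])
      have "vsub (F s) (x s) (vscale (F s) (complex_of_real (?g n s)) (x s)) =
          vadd (F s) (vscale (F s) 1 (x s)) (vscale (F s) (- complex_of_real (?g n s)) (x s))"
        by (simp add: vsub_def Fs.vscale_one Fs.vscale_vscale xs)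
      also have "\<dots> = vscale (F s) (complex_of_real (?h n s)) (x s)"
        by (subst Fs.vscale_add[symmetric, OF xs]) simp
      finally show "vsub \<A> x (fun_scale (?g n) x) s = fun_scale (?h n) x s"
        using s by (simp add: vsub_field fun_scale_def)
    qed (simp_all add: field_extensional)
    have "vnorm \<A> (fun_scale (?h n) x) \<le> inverse (real (Suc n))"
    proof (rule field_norm_le)
      fix s
      assume s: "s \<in> \<Omega>"
      let ?r = "vnorm (F s) (x s)"
      have r: "0 \<le> ?r"
        by (rule norm_nonneg[OF x s])
      have "?h n s * ?r \<le> inverse (real (Suc n))"
      proof (cases "?r \<le> inverse (real (Suc n))")
        case True
        then show ?thesis
          using mult_mono[OF h(2)[OF s] True] h(1)[OF s] r by simp
      next
        case False
        then have "1 \<le> real (Suc n) * ?r"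
          by (simp add: inverse_eq_divide pos_le_divide_eq mult.commute del: of_nat_Suc)
        then show ?thesis
          by simp
      qed
      then show "vnorm (F s) (fun_scale (?h n) x s) \<le> inverse (real (Suc n))"
        using h(1)[OF s] by (simp add: norm_fun_scale x s)
    qed simp
    then show "vdist \<A> (fun_scale (?g n) x) x \<le> inverse (real (Suc n))"
      unfolding A.vdist_commute[of _ x] A.vdist_eq[OF x fun_scale_closed[OF mg x]] eq .
  qed
qed

end

section \<open>Local trivializations and sections through a point\<close>

lemma isometric_isomorphismD:
  assumes "isometric_isomorphism A B f"
  shows "linear_op A B f" "bij_betw f (carr A) (carr B)"
    "\<lbrakk>x \<in> carr A; y \<in> carr A\<rbrakk> \<Longrightarrow> f (amul A x y) = amul B (f x) (f y)"
    "x \<in> carr A \<Longrightarrow> vnorm B (f x) = vnorm A x"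
    "x \<in> carr A \<Longrightarrow> f x \<in> carr B"
  using assms by (auto simp: isometric_isomorphism_def dest: linear_opD(1))

lemma isometric_isomorphism_vdist:
  assumes f: "isometric_isomorphism A B f" and A: "complex_vector_space A"
    and xy: "x \<in> carr A" "y \<in> carr A"
  shows "vdist B (f x) (f y) = vdist A x y"
proof -
  interpret A: complex_vector_space A by fact
  note D = isometric_isomorphismD[OF f]
  have "vsub B (f x) (f y) = f (vsub A x y)"
    by (simp add: linear_op_vsub[OF D(1) A xy])
  then show ?thesis
    using xy by (simp add: vdist_def D(4,5) A.vsub_closed)
qed

context banach_field
begin

text \<open>
  The last clause is what remains of an isomorphism with a constant field: read in the common
  algebra \<open>C\<close>, every section over \<open>W\<close> is a continuous function.
\<close>

definition trivialization :: "'t set \<Rightarrow> 'a calgebra \<Rightarrow> ('t \<Rightarrow> 'a \<Rightarrow> 'a) \<Rightarrow> bool" where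
  "trivialization W C \<phi> \<longleftrightarrow> openin X W \<and> complex_banach_algebra C \<and>
     (\<forall>s\<in>W. isometric_isomorphism (F s) C (\<phi> s)) \<and>
     (\<forall>x\<in>sections U. \<forall>s\<in>W. \<forall>e>0. \<exists>N. openin X N \<and> s \<in> N \<and> N \<subseteq> W \<and>
        (\<forall>r\<in>N. vdist C (\<phi> r (x r)) (\<phi> s (x s)) \<le> e))"

lemma trivialization_exists:
  assumes "locally_trivial U" "t \<in> \<Omega>"
  obtains W C \<phi> where "t \<in> W" "trivialization W C \<phi>"
proof -
  obtain W V where W: "openin X W" "t \<in> W" "W \<subseteq> V" "V \<subseteq> \<Omega>" "trivial_field (induced_field U V)"
    using assms unfolding locally_trivial_def by metis
  have top: "topspace (subtopology X V) = V"
    using W(4) by auto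
  have simps: "base (induced_field U V) = subtopology X V" "fibre (induced_field U V) = F"
    "sections (induced_field U V) = local_closure (subtopology X V) F (sections U)"
    "fibre (constant_field Y C) = (\<lambda>t. C)" for Y C
    by (simp_all add: induced_field_def constant_field_def)
  obtain C :: "'a calgebra" where C: "complex_banach_algebra C"
    and "isomorphic_fields (induced_field U V) (constant_field (subtopology X V) C)"
    using W(5) unfolding trivial_field_def simps by blast
  then obtain \<phi> where iso: "\<And>s. s \<in> V \<Longrightarrow> isometric_isomorphism (F s) C (\<phi> s)"
    and sec: "\<And>x. x \<in> local_closure (subtopology X V) F (sections U) \<Longrightarrow>
      (\<lambda>s\<in>V. \<phi> s (x s)) \<in> sections (constant_field (subtopology X V) C)"
    unfolding isomorphic_fields_def simps top by blast
  have cont: "continuous_map (subtopology X V) (vtop C) (\<lambda>s. \<phi> s (x s))"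
    if "x \<in> local_closure (subtopology X V) F (sections U)" for x
    using sec[OF that] by (simp add: constant_field_def)
  interpret C: complex_banach_algebra C by fact
  interpret M: Metric_space "carr C" "vdist C"
    by (rule C.Metric_space_vdist)
  have "trivialization W C \<phi>"
    unfolding trivialization_def
  proof (intro conjI ballI allI impI)
    show "openin X W" "complex_banach_algebra C"
      by fact+
    show "isometric_isomorphism (F s) C (\<phi> s)" if "s \<in> W" for s
      using iso that W(3) by blast
    fix x s and e :: real
    assume x: "x \<in> sections U" and s: "s \<in> W" and e: "0 < e"
    have "restrict x V \<in> local_closure (subtopology X V) F (sections U)"
      unfolding local_closure_def all_sections_def
    proof (intro CollectI conjI ballI allI impI)
      show "restrict x V \<in> (\<Pi>\<^sub>E t\<in>topspace (subtopology X V). carr (F t))"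
        using W(4) section_carr[OF x] by (auto simp: PiE_iff Int_absorb1)
      fix t and e :: real
      assume t: "t \<in> topspace (subtopology X V)" and "0 < e"
      have "vdist (F s) (restrict x V s) (x s) \<le> e" if "s \<in> V" for s
        using that W(4) \<open>0 < e\<close>
        by (simp add: complex_seminormed_space.vdist_self[OF fibre_seminormed] subset_iff)
      then show "\<exists>x'\<in>sections U. \<exists>N. openin (subtopology X V) N \<and> t \<in> N \<and>
          (\<forall>s\<in>N. vdist (F s) (restrict x V s) (x' s) \<le> e)"
        using t W(4) by (intro bexI[OF _ x] exI[of _ V]) (auto simp: openin_subtopology_refl)
    qed
    from cont[OF this] have "continuous_map (subtopology X V) M.mtopology (\<lambda>s. \<phi> s (restrict x V s))"
      by (simp only: vtop_def)
    moreover have "s \<in> topspace (subtopology X V)"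
      using s W(3,4) by auto
    ultimately obtain N where N: "openin (subtopology X V) N" "s \<in> N"
      "\<forall>r\<in>N. \<phi> r (restrict x V r) \<in> M.mball (\<phi> s (restrict x V s)) e"
      unfolding M.continuous_map_to_metric using e by blast
    obtain T where T: "openin X T" "N = T \<inter> V"
      using N(1) by (auto simp: openin_subtopology)
    have "vdist C (\<phi> r (x r)) (\<phi> s (x s)) \<le> e" if "r \<in> T \<inter> W" for r
    proof -
      have "\<phi> r (restrict x V r) \<in> M.mball (\<phi> s (restrict x V s)) e"
        using N(3) that T(2) W(3) by blast
      moreover have "r \<in> V" "s \<in> V"
        using that s W(3) by auto
      ultimately show ?thesis
        by (simp add: C.vdist_commute[of "\<phi> r (x r)"])
    qed
    then show "\<exists>N. openin X N \<and> s \<in> N \<and> N \<subseteq> W \<and> (\<forall>r\<in>N. vdist C (\<phi> r (x r)) (\<phi> s (x s)) \<le> e)"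
      using T N(2) s W(1) by (intro exI[of _ "T \<inter> W"]) (auto simp: openin_Int)
  qed
  with W(2) show ?thesis
    by (rule that)
qed

lemma completely_regular: "completely_regular_space X"
  using continuous_field completely_regular_eq_regular_space locally_compact_Hausdorff_imp_regular_space
  unfolding continuous_field_def by blast

lemma fibre_dense:
  assumes t: "t \<in> \<Omega>" and a: "a \<in> carr (F t)" and e: "0 < e"
  obtains x where "x \<in> sections U" "vdist (F t) (x t) a < e"
proof -
  interpret Ft: complex_banach_algebra "F t"
    by (rule fibre_algebra[OF t])
  interpret M: Metric_space "carr (F t)" "vdist (F t)"
    by (rule Ft.Metric_space_vdist)
  have "a \<in> M.mtopology closure_of {x t | x. x \<in> sections U}"
    using continuous_field t a by (simp add: continuous_field_def vtop_def)
  then show ?thesis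
    using e that unfolding M.metric_closure_of by (auto simp: Ft.vdist_commute)
qed

text \<open>
  In a trivialization the constant function with value \<open>\<phi>\<^sub>t a\<close> is cut off by a function \<open>h\<close> with values
  in \<open>[0, 1]\<close> that vanishes off a compact set.  The result is a section: at a point \<open>s\<close> where
  \<open>h(s) \<noteq> 0\<close>, some section comes close to the constant function at \<open>s\<close>, hence also near \<open>s\<close>; where
  \<open>h(s) = 0\<close>, the cut-off function is close to \<open>0\<close> near \<open>s\<close>.
\<close>

lemma section_through:
  assumes loc: "locally_trivial U" and t: "t \<in> \<Omega>" and a: "a \<in> carr (F t)"
  obtains x where "x \<in> carr \<A>" "x t = a" "vnorm \<A> x \<le> vnorm (F t) a"
proof -
  obtain W C \<phi> where tW: "t \<in> W" and triv: "trivialization W C \<phi>"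
    using trivialization_exists[OF loc t] .
  interpret C: complex_banach_algebra C
    using triv by (simp add: trivialization_def)
  have iso: "isometric_isomorphism (F s) C (\<phi> s)" if "s \<in> W" for s
    using triv that by (simp add: trivialization_def)
  note isoD = isometric_isomorphismD[OF iso]
  have W: "openin X W" "W \<subseteq> \<Omega>"
    using triv openin_subset by (auto simp: trivialization_def)
  obtain O' K where K: "openin X O'" "compactin X K" "t \<in> O'" "O' \<subseteq> K"
    using continuous_field t unfolding continuous_field_def locally_compact_space_def by metis
  define D where "D = W \<inter> O'"
  have D: "openin X D" "t \<in> D" "D \<subseteq> W" "D \<subseteq> K"
    using W K tW by (auto simp: D_def openin_Int)
  have "closedin X (\<Omega> - D)" "t \<in> \<Omega> - (\<Omega> - D)"
    using D(1,2) t by (auto simp: openin_closedin_eq)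
  then obtain f where f: "continuous_map X (top_of_set {0..1}) f" "f t = 0" "f ` (\<Omega> - D) \<subseteq> {1::real}"
    using completely_regular unfolding completely_regular_space_def by metis
  define h where "h = (\<lambda>s. 1 - f s)"
  have h: "continuous_map X euclideanreal h" "h t = 1" "\<And>s. s \<in> \<Omega> \<Longrightarrow> 0 \<le> h s" "\<And>s. s \<in> \<Omega> \<Longrightarrow> h s \<le> 1"
    and h_out: "\<And>s. s \<in> \<Omega> - D \<Longrightarrow> h s = 0"
    using f unfolding h_def continuous_map_in_subtopology
    by (auto intro!: continuous_map_diff simp: image_subset_iff)
  define d where "d = \<phi> t a"
  define b where "b = (\<lambda>s. inv_into (carr (F s)) (\<phi> s) d)"
  have dC: "d \<in> carr C" and nd: "vnorm C d = vnorm (F t) a"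
    using isoD(4,5)[OF tW] a by (simp_all add: d_def)
  have b: "b s \<in> carr (F s)" "\<phi> s (b s) = d" "vnorm (F s) (b s) = vnorm (F t) a" if "s \<in> W" for s
  proof -
    have d: "d \<in> \<phi> s ` carr (F s)"
      using isoD(2)[OF that] dC by (simp add: bij_betw_def)
    show 1: "b s \<in> carr (F s)" and 2: "\<phi> s (b s) = d"
      using inv_into_into[OF d] f_inv_into_f[OF d] by (simp_all add: b_def)
    show "vnorm (F s) (b s) = vnorm (F t) a"
      using isoD(4)[OF that 1] 2 nd by simp
  qed
  have "b t = a"
    unfolding b_def d_def using isoD(2)[OF tW] a by (intro inv_into_f_f) (auto simp: bij_betw_def)
  define x where "x = (\<lambda>s\<in>\<Omega>. if s \<in> D then vscale (F s) (complex_of_real (h s)) (b s) else vzero (F s))"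
  have xc: "x s \<in> carr (F s)" if "s \<in> \<Omega>" for s
    using that b D(3) by (auto simp: x_def fibre_closed)
  have xn: "vnorm (F s) (x s) = h s * vnorm (F t) a" if s: "s \<in> \<Omega>" for s
  proof (cases "s \<in> D")
    case True
    then have "s \<in> W"
      using D(3) by blast
    then show ?thesis
      using s True b[of s] h(3)[OF s] complex_normed_space.vnorm_vscale[OF fibre_normed[OF s]]
      by (simp add: x_def)
  next
    case False
    then show ?thesis
      using s h_out complex_seminormed_space.seminorm_vzero[OF fibre_seminormed] by (simp add: x_def)
  qed
  have a_nonneg: "0 \<le> vnorm (F t) a"
    by (rule complex_normed_space.vnorm_nonneg[OF fibre_normed[OF t] a])
  have "x \<in> sections U"
  proof (rule sectionI[OF xc])
    show "x \<in> extensional \<Omega>"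
      by (simp add: x_def)
    fix s e
    assume s: "s \<in> \<Omega>" and e: "(0::real) < e"
    show "\<exists>x'\<in>sections U. \<exists>N. openin X N \<and> s \<in> N \<and> (\<forall>r\<in>N. vdist (F r) (x r) (x' r) \<le> e)"
    proof (cases "s \<in> D")
      case False
      then have "h s = 0"
        using s h_out by simp
      moreover have "0 < e / (vnorm (F t) a + 1)"
        using e a_nonneg by simp
      ultimately obtain N where N: "openin X N" "s \<in> N"
        "\<And>r. r \<in> N \<Longrightarrow> \<bar>h r\<bar> < e / (vnorm (F t) a + 1)"
        using continuous_map_real_near[OF h(1) s] by (metis diff_zero)
      have "vdist (F r) (x r) ((\<lambda>t\<in>\<Omega>. vzero (F t)) r) \<le> e" if r: "r \<in> N" for r
      proof -
        have r': "r \<in> \<Omega>"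
          using r N(1) openin_subset by blast
        have "vdist (F r) (x r) ((\<lambda>t\<in>\<Omega>. vzero (F t)) r) = h r * vnorm (F t) a"
          using r' by (simp add: complex_seminormed_space.vdist_vzero[OF fibre_seminormed] xc xn)
        also have "\<dots> \<le> h r * (vnorm (F t) a + 1)"
          using h(3)[OF r'] by (intro mult_left_mono) auto
        also have "\<dots> \<le> e"
          using N(3)[OF r] h(3)[OF r'] a_nonneg by (simp add: pos_less_divide_eq)
        finally show ?thesis .
      qed
      then show ?thesis
        using N(1,2) section_ops(1) by blast
    next
      case True
      then have sW: "s \<in> W"
        using D(3) by blast
      obtain y where y: "y \<in> sections U" "vdist (F s) (y s) (b s) < e / 2"
        using fibre_dense[OF s b(1)[OF sW], of "e / 2"] e by auto
      obtain N where N: "openin X N" "s \<in> N" "N \<subseteq> W"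
        "\<And>r. r \<in> N \<Longrightarrow> vdist C (\<phi> r (y r)) (\<phi> s (y s)) \<le> e / 2"
        using triv y(1) sW e unfolding trivialization_def by (metis half_gt_zero)
      have "vdist (F r) (x r) (fun_scale h y r) \<le> e" if r: "r \<in> N \<inter> D" for r
      proof -
        have rW: "r \<in> W" and r': "r \<in> \<Omega>"
          using r N(3) W(2) by auto
        interpret Fr: complex_banach_algebra "F r"
          by (rule fibre_algebra[OF r'])
        have yr: "y r \<in> carr (F r)" and ys: "y s \<in> carr (F s)"
          using section_carr[OF y(1)] r' s by auto
        have "vdist (F r) (b r) (y r) = vdist C d (\<phi> r (y r))"
          using isometric_isomorphism_vdist[OF iso[OF rW] Fr.complex_vector_space_axioms b(1)[OF rW] yr]
          by (simp add: b(2)[OF rW])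
        also have "\<dots> \<le> vdist C d (\<phi> s (y s)) + vdist C (\<phi> s (y s)) (\<phi> r (y r))"
          using isoD(5)[OF rW yr] isoD(5)[OF sW ys] dC by (intro C.vdist_triangle)
        also have "vdist C d (\<phi> s (y s)) = vdist (F s) (b s) (y s)"
          using isometric_isomorphism_vdist[OF iso[OF sW] fibre_space[OF s] b(1)[OF sW] ys]
          by (simp add: b(2)[OF sW])
        also have "\<dots> \<le> e / 2"
          using y(2) by (simp add: complex_seminormed_space.vdist_commute[OF fibre_seminormed[OF s]] less_imp_le)
        also have "vdist C (\<phi> s (y s)) (\<phi> r (y r)) \<le> e / 2"
          using N(4)[of r] r by (simp add: C.vdist_commute[of "\<phi> s (y s)"])
        finally have "vdist (F r) (b r) (y r) \<le> e"
          by simp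
        then have "h r * vdist (F r) (b r) (y r) \<le> 1 * e"
          using h(3,4)[OF r'] Fr.vdist_nonneg by (intro mult_mono) auto
        then show ?thesis
          using r r' h(3)[OF r'] by (simp add: x_def fun_scale_def Fr.vdist_vscale b(1)[OF rW] yr)
      qed
      then show ?thesis
        using N(1,2) D(1) True fun_scale_section[OF y(1) h(1)]
        by (intro bexI[of _ "fun_scale h y"] exI[of _ "N \<inter> D"]) (auto simp: openin_Int)
    qed
  qed
  moreover have "vanishing_at_infinity X (\<lambda>s. vnorm (F s) (x s))"
    unfolding vanishing_at_infinity_def
  proof (intro allI impI exI[of _ K] conjI ballI K(2))
    fix e :: real and s
    assume "0 < e" and s: "s \<in> \<Omega> - K"
    then have "h s = 0"
      using D(4) by (intro h_out) blast
    with s \<open>0 < e\<close> show "\<bar>vnorm (F s) (x s)\<bar> < e"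
      by (simp add: xn)
  qed
  ultimately have "x \<in> carr \<A>"
    by (simp add: carr_field_algebra)
  moreover have "x t = a"
    using t D(2) \<open>b t = a\<close> h(2) a by (simp add: x_def complex_vector_space.vscale_one[OF fibre_space])
  moreover have "vnorm \<A> x \<le> vnorm (F t) a"
    using h(3,4) a_nonneg by (intro field_norm_le) (simp_all add: xn mult_left_le_one_le)
  ultimately show ?thesis
    by (rule that)
qed

lemma point_separator:
  assumes "s \<in> \<Omega>" "t \<in> \<Omega>" "s \<noteq> t"
  obtains g where "multiplier g" "multiplier (\<lambda>r. 1 - g r)" "g s = 1" "g t = 0"
proof -
  have "closedin X {t}"
    using continuous_field assms(2) unfolding continuous_field_def
    by (meson Hausdorff_imp_t1_space t1_space_closedin_singleton)
  then obtain f where f: "continuous_map X (top_of_set {0..1}) f" "f s = 0" "f t = (1::real)"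
    using completely_regular[unfolded completely_regular_space_def, rule_format, of "{t}" s] assms
    by auto
  then have cont: "continuous_map X euclideanreal f" and "\<And>r. r \<in> \<Omega> \<Longrightarrow> 0 \<le> f r \<and> f r \<le> 1"
    unfolding continuous_map_in_subtopology by (auto simp: image_subset_iff)
  then have "multiplier f" "multiplier (\<lambda>r. 1 - f r)"
    unfolding multiplier_def by (auto intro!: continuous_map_diff cont)
  with f show ?thesis
    by (intro that[of "\<lambda>r. 1 - f r"]) simp_all
qed

end

section \<open>Splittings of the product map of a locally trivial field\<close>

locale split_field = banach_field U
  for U :: "('t, 'a) cfield" +
  fixes \<rho> :: "('t \<Rightarrow> 'a) \<Rightarrow> ('t \<Rightarrow> 'a, 't \<Rightarrow> 'a) ptensor"
  assumes locally_trivial: "locally_trivial U"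
    and splitting: "bimodule_morphism (field_algebra U) (regular_bimodule (field_algebra U))
      (tensor_bimodule (field_algebra U)) \<rho>"
    and product_splitting: "x \<in> carr (field_algebra U) \<Longrightarrow> product_map (field_algebra U) (\<rho> x) = x"
begin

lemma splitting_bounded: "bounded_op \<A> A.AA \<rho>"
  using splitting by (simp add: bimodule_morphism_def)

lemmas splitting_linear = linear_opD[OF bounded_op_linear[OF splitting_bounded]]

lemma splitting_amul:
  assumes "x \<in> carr \<A>" "y \<in> carr \<A>"
  shows "\<rho> (amul \<A> x y) = A.ltensor x (\<rho> y)" "\<rho> (amul \<A> x y) = A.rtensor (\<rho> x) y"
  using splitting assms unfolding bimodule_morphism_def regular_bimodule_simps by blast+

text \<open>Since \<open>x = \<pi> (\<rho> x)\<close>, the products span a dense subspace of \<open>\<A>\<close>.\<close>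

lemma products_induct [consumes 1, case_names product add lim]:
  assumes x: "x \<in> carr \<A>"
    and product: "\<And>a b. \<lbrakk>a \<in> carr \<A>; b \<in> carr \<A>\<rbrakk> \<Longrightarrow> Q (amul \<A> a b)"
    and add: "\<And>x y. \<lbrakk>x \<in> carr \<A>; y \<in> carr \<A>; Q x; Q y\<rbrakk> \<Longrightarrow> Q (vadd \<A> x y)"
    and lim: "\<And>s x. \<lbrakk>\<And>n. s n \<in> carr \<A>; x \<in> carr \<A>; vlim \<A> s x; \<And>n. Q (s n)\<rbrakk> \<Longrightarrow> Q x"
  shows "Q x"
proof -
  have "Q (product_map \<A> u)" if "u \<in> carr A.AA" for u
    using that
  proof (induction rule: A.TT.proj_tensor_induct)
    case (elem x y)
    then show ?case
      by (simp add: A.product_map product)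
  next
    case (add u v)
    then show ?case
      by (simp add: A.product_map_linear assms(3))
  next
    case (lim s u)
    show ?case
      by (rule assms(4)[OF _ _ vlim_bounded_op[OF A.product_map(1)
              A.TT.P.seminormed A.seminormed lim(1-3)] lim(4)])
        (simp_all add: A.product_map_linear lim)
  qed
  from this[of "\<rho> x"] show ?thesis
    using x by (simp add: splitting_linear product_splitting)
qed

definition eval_tensor :: "'t \<Rightarrow> ('t \<Rightarrow> 'a, 't \<Rightarrow> 'a) ptensor \<Rightarrow> ('a, 'a) ptensor" where
  "eval_tensor t = tensor_lift \<A> \<A> (proj_tensor (F t) (F t)) (\<lambda>x y. elem_tensor (F t) (F t) (x t) (y t))"

text \<open>
  Any section through \<open>a\<close> gives the same value; one of norm at most \<open>\<parallel>a\<parallel>\<close> is chosen so that the norm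
  of the splitting can be read off.
\<close>

definition fibre_splitting :: "'t \<Rightarrow> 'a \<Rightarrow> ('a, 'a) ptensor" where
  "fibre_splitting t a =
     eval_tensor t (\<rho> (SOME x. x \<in> carr \<A> \<and> x t = a \<and> vnorm \<A> x \<le> vnorm (F t) a))"

context
  fixes t
  assumes t: "t \<in> \<Omega>"
begin

interpretation Ft: complex_banach_algebra "F t"
  by (rule fibre_algebra[OF t])

lemma amul_at: "amul \<A> x y t = amul (F t) (x t) (y t)"
  using t by (simp add: field_ops(4))

lemma eval_bounded: "bounded_op \<A> (F t) (\<lambda>x. x t)"
  unfolding bounded_op_def linear_op_def using t
  by (auto simp: field_carr field_ops(2,3) norm_le_field_norm intro!: exI[of _ 1])

lemma eval_tensor_bilinear:
  "bounded_bilinear_op \<A> \<A> Ft.AA (\<lambda>x y. Ft.ten (x t) (y t)) 1"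
proof -
  have "vnorm Ft.AA (Ft.ten (x t) (y t)) \<le> vnorm \<A> x * vnorm \<A> y"
    if x: "x \<in> carr \<A>" and y: "y \<in> carr \<A>" for x y
  proof -
    have "vnorm Ft.AA (Ft.ten (x t) (y t)) \<le> vnorm (F t) (x t) * vnorm (F t) (y t)"
      using t x y by (intro Ft.TT.vnorm_elem_tensor_le field_carr)
    also have "\<dots> \<le> vnorm \<A> x * vnorm \<A> y"
      using t x y by (intro mult_mono norm_le_field_norm norm_nonneg field_norm_nonneg)
    finally show ?thesis .
  qed
  then show ?thesis
    using t by (simp add: bounded_bilinear_op_def field_carr Ft.TT.elem_tensor_closed
        Ft.TT.elem_tensor_linear field_ops(2,3))
qed

lemma eval_tensor:
  shows "bounded_op A.AA Ft.AA (eval_tensor t)"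
    and "\<lbrakk>x \<in> carr \<A>; y \<in> carr \<A>\<rbrakk> \<Longrightarrow> eval_tensor t (A.ten x y) = Ft.ten (x t) (y t)"
    and "u \<in> carr A.AA \<Longrightarrow> vnorm Ft.AA (eval_tensor t u) \<le> vnorm A.AA u"
  using A.TT.tensor_lift[OF Ft.TT.P.complex_banach_space_axioms eval_tensor_bilinear]
  by (simp_all add: eval_tensor_def)

lemma eval_tensor_ltensor:
  assumes a: "a \<in> carr \<A>" and u: "u \<in> carr A.AA"
  shows "eval_tensor t (A.ltensor a u) = Ft.ltensor (a t) (eval_tensor t u)"
proof (rule A.TT.proj_tensor_op_eqI[OF _ _ Ft.TT.P.complex_normed_space_axioms _ u])
  have at: "a t \<in> carr (F t)"
    using a t by (rule field_carr)
  note C = bounded_op_compose[OF _ _ A.TT.P.seminormed]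
  show "bounded_op A.AA Ft.AA (\<lambda>u. eval_tensor t (A.ltensor a u))"
    by (rule C[OF A.ltensor(1)[OF a] eval_tensor(1) A.TT.P.seminormed])
  show "bounded_op A.AA Ft.AA (\<lambda>u. Ft.ltensor (a t) (eval_tensor t u))"
    by (rule C[OF eval_tensor(1) Ft.ltensor(1)[OF at] Ft.TT.P.seminormed])
  show "eval_tensor t (A.ltensor a (A.ten x y)) = Ft.ltensor (a t) (eval_tensor t (A.ten x y))"
    if "x \<in> carr \<A>" "y \<in> carr \<A>" for x y
    using that a t at
    by (simp add: A.ltensor(2) eval_tensor(2) Ft.ltensor(2) A.amul_closed field_carr amul_at)
qed

lemma eval_tensor_rtensor:
  assumes a: "a \<in> carr \<A>" and u: "u \<in> carr A.AA"
  shows "eval_tensor t (A.rtensor u a) = Ft.rtensor (eval_tensor t u) (a t)"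
proof (rule A.TT.proj_tensor_op_eqI[OF _ _ Ft.TT.P.complex_normed_space_axioms _ u])
  have at: "a t \<in> carr (F t)"
    using a t by (rule field_carr)
  note C = bounded_op_compose[OF _ _ A.TT.P.seminormed]
  show "bounded_op A.AA Ft.AA (\<lambda>u. eval_tensor t (A.rtensor u a))"
    by (rule C[OF A.rtensor(1)[OF a] eval_tensor(1) A.TT.P.seminormed])
  show "bounded_op A.AA Ft.AA (\<lambda>u. Ft.rtensor (eval_tensor t u) (a t))"
    by (rule C[OF eval_tensor(1) Ft.rtensor(1)[OF at] Ft.TT.P.seminormed])
  show "eval_tensor t (A.rtensor (A.ten x y) a) = Ft.rtensor (eval_tensor t (A.ten x y)) (a t)"
    if "x \<in> carr \<A>" "y \<in> carr \<A>" for x y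
    using that a t at
    by (simp add: A.rtensor(2) eval_tensor(2) Ft.rtensor(2) A.amul_closed field_carr amul_at)
qed

lemma product_map_eval_tensor:
  assumes u: "u \<in> carr A.AA"
  shows "product_map (F t) (eval_tensor t u) = product_map \<A> u t"
proof (rule A.TT.proj_tensor_op_eqI[OF _ _ Ft.complex_normed_space_axioms _ u])
  note C = bounded_op_compose[OF _ _ A.TT.P.seminormed]
  show "bounded_op A.AA (F t) (\<lambda>u. product_map (F t) (eval_tensor t u))"
    by (rule C[OF eval_tensor(1) Ft.product_map(1) Ft.TT.P.seminormed])
  show "bounded_op A.AA (F t) (\<lambda>u. product_map \<A> u t)"
    by (rule C[OF A.product_map(1) eval_bounded A.seminormed])
  show "product_map (F t) (eval_tensor t (A.ten x y)) = product_map \<A> (A.ten x y) t"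
    if "x \<in> carr \<A>" "y \<in> carr \<A>" for x y
    using that t by (simp add: eval_tensor(2) A.product_map(2) Ft.product_map(2) field_carr amul_at)
qed

lemma eval_splitting_bounded: "bounded_op \<A> Ft.AA (\<lambda>x. eval_tensor t (\<rho> x))"
  by (rule bounded_op_compose[OF splitting_bounded eval_tensor(1) A.seminormed
        A.TT.P.seminormed])

text \<open>
  The value of \<open>\<rho> x\<close> at \<open>(t, t)\<close> depends only on \<open>x(t)\<close>: for \<open>g(t) = 0\<close>,
  \<open>\<rho> (g a b) = (g a) \<cdot> \<rho> b\<close> evaluates to \<open>0\<close>, so \<open>\<rho> (g x)\<close> does, and if \<open>x(t) = 0\<close> then \<open>x\<close> is a
  limit of such \<open>g x\<close>.
\<close>

lemma eval_splitting_eq_vzero: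
  assumes x: "x \<in> carr \<A>" and zero: "x t = vzero (F t)"
  shows "eval_tensor t (\<rho> x) = vzero Ft.AA"
proof -
  note lin = linear_opD[OF bounded_op_linear[OF eval_splitting_bounded]]
  have lim: "eval_tensor t (\<rho> y) = vzero Ft.AA"
    if "\<And>n. s n \<in> carr \<A>" "y \<in> carr \<A>" "vlim \<A> s y" "\<And>n. eval_tensor t (\<rho> (s n)) = vzero Ft.AA" for s y
  proof (rule Ft.TT.P.vlim_unique)
    show "vlim Ft.AA (\<lambda>n. eval_tensor t (\<rho> (s n))) (eval_tensor t (\<rho> y))"
      by (rule vlim_bounded_op[OF eval_splitting_bounded A.seminormed
            Ft.TT.P.seminormed that(1-3)])
    show "vlim Ft.AA (\<lambda>n. eval_tensor t (\<rho> (s n))) (vzero Ft.AA)"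
      by (simp add: that(4) Ft.TT.P.vlim_const)
  qed (simp_all add: lin that(1,2) Ft.TT.P.closed)
  have multiple: "eval_tensor t (\<rho> (fun_scale g y)) = vzero Ft.AA"
    if y: "y \<in> carr \<A>" and g: "multiplier g" "g t = 0" for g y
    using y
  proof (induction rule: products_induct)
    case (product a b)
    have ga: "fun_scale g a \<in> carr \<A>"
      by (rule fun_scale_closed[OF g(1) product(1)])
    have gat: "fun_scale g a t = vzero (F t)"
      using t g(2) product by (simp add: fun_scale_def Ft.vscale_zero_left field_carr)
    have "eval_tensor t (\<rho> (fun_scale g (amul \<A> a b))) = Ft.ltensor (vzero (F t)) (eval_tensor t (\<rho> b))"
      using product by (simp add: fun_scale_amul(1) splitting_amul(1) ga eval_tensor_ltensor
          splitting_linear gat)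
    also have "\<dots> = vzero Ft.AA"
      using Ft.TB.vscale_lact[OF Ft.vzero_closed, of "eval_tensor t (\<rho> b)" 0] product
      by (simp add: Ft.vscale_vzero lin Ft.TT.P.vscale_zero_left Ft.ltensor_linear Ft.closed)
    finally show ?case .
  next
    case (add x y)
    then show ?case
      by (simp add: fun_scale_vadd lin fun_scale_closed[OF g(1)] Ft.TT.P.vadd_zero Ft.TT.P.closed)
  next
    case (lim s x)
    show ?case
    proof (rule \<open>\<And>s y. \<lbrakk>\<And>n. s n \<in> carr \<A>; y \<in> carr \<A>; vlim \<A> s y;
        \<And>n. eval_tensor t (\<rho> (s n)) = vzero Ft.AA\<rbrakk> \<Longrightarrow> eval_tensor t (\<rho> y) = vzero Ft.AA\<close>)
      show "vlim \<A> (\<lambda>n. fun_scale g (s n)) (fun_scale g x)"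
        by (rule A.vlim_squeeze[OF vdist_fun_scale_le[OF g(1) lim(1,2)] lim(3)[unfolded vlim_def]])
    qed (simp_all add: fun_scale_closed[OF g(1)] lim)
  qed
  obtain g where g: "\<And>n. multiplier (g n)" "\<And>n. g n t = 0" "vlim \<A> (\<lambda>n. fun_scale (g n) x) x"
    by (rule vanishing_section_limit[OF x t zero]) blast
  show ?thesis
    by (rule lim[OF _ x g(3)]) (simp_all add: fun_scale_closed g x multiple)
qed

lemma fibre_splitting_eq:
  assumes x: "x \<in> carr \<A>"
  shows "fibre_splitting t (x t) = eval_tensor t (\<rho> x)"
    and fibre_splitting_norm: "\<lbrakk>\<And>x. x \<in> carr \<A> \<Longrightarrow> vnorm A.AA (\<rho> x) \<le> K * vnorm \<A> x; 0 \<le> K\<rbrakk> \<Longrightarrow>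
      vnorm Ft.AA (fibre_splitting t (x t)) \<le> K * vnorm (F t) (x t)"
proof -
  note lin = linear_opD[OF bounded_op_linear[OF eval_splitting_bounded]]
  have "\<exists>y. y \<in> carr \<A> \<and> y t = x t \<and> vnorm \<A> y \<le> vnorm (F t) (x t)"
    using section_through[OF locally_trivial t field_carr[OF x t]] by metis
  from someI_ex[OF this] obtain y where y: "y \<in> carr \<A>" "y t = x t" "vnorm \<A> y \<le> vnorm (F t) (x t)"
    and fs: "fibre_splitting t (x t) = eval_tensor t (\<rho> y)"
    unfolding fibre_splitting_def by blast
  have "vsub \<A> x y t = vzero (F t)"
    using y(2) t x by (simp add: vsub_field Ft.vsub_self field_carr)
  then have "eval_tensor t (\<rho> (vsub \<A> x y)) = vzero Ft.AA"
    by (intro eval_splitting_eq_vzero A.vsub_closed x y)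
  moreover have "eval_tensor t (\<rho> (vsub \<A> x y)) = vsub Ft.AA (eval_tensor t (\<rho> x)) (eval_tensor t (\<rho> y))"
    using eval_splitting_bounded
    by (intro linear_op_vsub[OF _ A.complex_vector_space_axioms x y(1)]) (simp add: bounded_op_def)
  ultimately have "eval_tensor t (\<rho> x) = eval_tensor t (\<rho> y)"
    using Ft.TT.P.vsub_eq_vzero[OF lin(1)[OF x] lin(1)[OF y(1)]] by metis
  then show "fibre_splitting t (x t) = eval_tensor t (\<rho> x)"
    using fs by simp
  assume K: "\<And>x. x \<in> carr \<A> \<Longrightarrow> vnorm A.AA (\<rho> x) \<le> K * vnorm \<A> x" "0 \<le> K"
  have "vnorm Ft.AA (eval_tensor t (\<rho> y)) \<le> vnorm A.AA (\<rho> y)"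
    by (rule eval_tensor(3)) (simp add: splitting_linear y)
  also have "\<dots> \<le> K * vnorm (F t) (x t)"
    using K(1)[OF y(1)] mult_left_mono[OF y(3) K(2)] by simp
  finally show "vnorm Ft.AA (fibre_splitting t (x t)) \<le> K * vnorm (F t) (x t)"
    using fs by simp
qed

lemma fibre_splitting_morphism:
  shows "bimodule_morphism (F t) (regular_bimodule (F t)) (tensor_bimodule (F t)) (fibre_splitting t)"
    and "a \<in> carr (F t) \<Longrightarrow> product_map (F t) (fibre_splitting t a) = a"
    and "\<lbrakk>\<And>x. x \<in> carr \<A> \<Longrightarrow> vnorm A.AA (\<rho> x) \<le> K * vnorm \<A> x; 0 \<le> K\<rbrakk> \<Longrightarrow>
      op_norm (F t) Ft.AA (fibre_splitting t) \<le> K"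
proof -
  note lin = linear_opD[OF bounded_op_linear[OF eval_splitting_bounded]]
  have lift: "\<exists>x. x \<in> carr \<A> \<and> x t = a" if "a \<in> carr (F t)" for a
    using section_through[OF locally_trivial t that] by metis
  have bound: "vnorm Ft.AA (fibre_splitting t a) \<le> K * vnorm (F t) a"
    if K: "\<And>x. x \<in> carr \<A> \<Longrightarrow> vnorm A.AA (\<rho> x) \<le> K * vnorm \<A> x" "0 \<le> K"
      and a: "a \<in> carr (F t)" for K a
  proof -
    obtain x where x: "x \<in> carr \<A>" "x t = a"
      using lift[OF a] by blast
    show ?thesis
      using fibre_splitting_norm[OF x(1) K] by (simp add: x(2))
  qed
  obtain L where L: "0 \<le> L" "\<And>x. x \<in> carr \<A> \<Longrightarrow> vnorm A.AA (\<rho> x) \<le> L * vnorm \<A> x"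
    by (rule bounded_op_bound[OF splitting_bounded A.seminormed]) blast
  show "bimodule_morphism (F t) (regular_bimodule (F t)) (tensor_bimodule (F t)) (fibre_splitting t)"
    unfolding bimodule_morphism_def bounded_op_simps regular_bimodule_simps
  proof (intro conjI ballI)
    have "linear_op (F t) Ft.AA (fibre_splitting t)"
      unfolding linear_op_def
    proof (intro conjI ballI allI funcsetI)
      fix a
      assume "a \<in> carr (F t)"
      then obtain x where x: "x \<in> carr \<A>" "a = x t"
        using lift by metis
      show "fibre_splitting t a \<in> carr Ft.AA"
        by (simp add: x fibre_splitting_eq lin)
      have "vscale (F t) c a = vscale \<A> c x t" for c
        using t x by (simp add: field_ops(3))
      then show "fibre_splitting t (vscale (F t) c a) = vscale Ft.AA c (fibre_splitting t a)" for c
        by (simp add: x(1) A.closed fibre_splitting_eq lin) (simp add: x fibre_splitting_eq)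
      fix b
      assume "b \<in> carr (F t)"
      then obtain y where y: "y \<in> carr \<A>" "b = y t"
        using lift by metis
      have "vadd (F t) a b = vadd \<A> x y t"
        using t x y by (simp add: field_ops(2))
      then show "fibre_splitting t (vadd (F t) a b) = vadd Ft.AA (fibre_splitting t a) (fibre_splitting t b)"
        by (simp add: x(1) y(1) A.closed fibre_splitting_eq lin) (simp add: x y fibre_splitting_eq)
    qed
    then show "bounded_op (F t) Ft.AA (fibre_splitting t)"
      unfolding bounded_op_def using bound[OF L(2,1)] by blast
    fix a b
    assume "a \<in> carr (F t)" "b \<in> carr (F t)"
    then obtain x y where x: "x \<in> carr \<A>" "a = x t" and y: "y \<in> carr \<A>" "b = y t"
      using lift by metis
    have xy: "amul (F t) a b = amul \<A> x y t" "amul (F t) b a = amul \<A> y x t"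
      using t x y by (simp_all add: field_ops(4))
    have "fibre_splitting t (amul (F t) a b) = eval_tensor t (A.ltensor x (\<rho> y))"
      by (simp only: xy fibre_splitting_eq[OF A.amul_closed[OF x(1) y(1)]] splitting_amul(1)[OF x(1) y(1)])
    then show "fibre_splitting t (amul (F t) a b) = Ft.ltensor a (fibre_splitting t b)"
      by (simp add: eval_tensor_ltensor x(1) splitting_linear y(1)) (simp add: x y fibre_splitting_eq)
    have "fibre_splitting t (amul (F t) b a) = eval_tensor t (A.rtensor (\<rho> y) x)"
      by (simp only: xy fibre_splitting_eq[OF A.amul_closed[OF y(1) x(1)]] splitting_amul(2)[OF y(1) x(1)])
    then show "fibre_splitting t (amul (F t) b a) = Ft.rtensor (fibre_splitting t b) a"
      by (simp add: eval_tensor_rtensor x(1) splitting_linear y(1)) (simp add: x y fibre_splitting_eq)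
  qed
  show "product_map (F t) (fibre_splitting t a) = a" if "a \<in> carr (F t)"
  proof -
    obtain x where x: "x \<in> carr \<A>" "a = x t"
      using lift[OF \<open>a \<in> carr (F t)\<close>] by metis
    then show ?thesis
      by (simp add: fibre_splitting_eq product_map_eval_tensor splitting_linear product_splitting)
  qed
  assume K: "\<And>x. x \<in> carr \<A> \<Longrightarrow> vnorm A.AA (\<rho> x) \<le> K * vnorm \<A> x" "0 \<le> K"
  show "op_norm (F t) Ft.AA (fibre_splitting t) \<le> K"
    unfolding op_norm_def
  proof (rule cSup_least)
    have "vzero (F t) \<in> carr (F t)" "vnorm (F t) (vzero (F t)) \<le> 1"
      by (simp_all add: Ft.closed Ft.seminorm_vzero)
    then show "{vnorm Ft.AA (fibre_splitting t a) | a. a \<in> carr (F t) \<and> vnorm (F t) a \<le> 1} \<noteq> {}"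
      by blast
    show "r \<le> K" if r: "r \<in> {vnorm Ft.AA (fibre_splitting t a) | a. a \<in> carr (F t) \<and> vnorm (F t) a \<le> 1}" for r
    proof -
      obtain a where a: "a \<in> carr (F t)" "vnorm (F t) a \<le> 1" "r = vnorm Ft.AA (fibre_splitting t a)"
        using r by blast
      then show ?thesis
        using bound[OF K a(1)] mult_left_mono[OF a(2) K(2)] by simp
    qed
  qed
qed

end

theorem fibres_uniformly_biprojective: "uniformly_biprojective \<Omega> F"
proof -
  obtain K where "0 \<le> K" "\<And>x. x \<in> carr \<A> \<Longrightarrow> vnorm A.AA (\<rho> x) \<le> K * vnorm \<A> x"
    by (rule bounded_op_bound[OF splitting_bounded A.seminormed]) blast
  then have "bdd_above ((\<lambda>t. op_norm (F t) (proj_tensor (F t) (F t)) (fibre_splitting t)) ` \<Omega>)"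
    by (intro bdd_aboveI2[of _ _ K] fibre_splitting_morphism(3))
  then show ?thesis
    unfolding uniformly_biprojective_def using fibre_splitting_morphism(1,2)
    by (intro exI[of _ fibre_splitting]) blast
qed

text \<open>
  Over a trivialization, \<open>x \<otimes> y \<mapsto> x(s) y(t)\<close>, with both values read in the common algebra \<open>C\<close>.
\<close>

definition transported_product ::
  "'a calgebra \<Rightarrow> ('t \<Rightarrow> 'a \<Rightarrow> 'a) \<Rightarrow> 't \<Rightarrow> 't \<Rightarrow> ('t \<Rightarrow> 'a, 't \<Rightarrow> 'a) ptensor \<Rightarrow> 'a" where
  "transported_product C \<phi> s t = tensor_lift \<A> \<A> C (\<lambda>x y. amul C (\<phi> s (x s)) (\<phi> t (y t)))"

context
  fixes W C \<phi>
  assumes triv: "trivialization W C \<phi>"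
begin

abbreviation "L \<equiv> transported_product C \<phi>"

interpretation C: complex_banach_algebra C
  using triv by (simp add: trivialization_def)

lemma triv_subset: "W \<subseteq> \<Omega>"
  using triv openin_subset by (auto simp: trivialization_def)

lemma triv_iso: "s \<in> W \<Longrightarrow> isometric_isomorphism (F s) C (\<phi> s)"
  using triv by (simp add: trivialization_def)

lemma triv_eval:
  assumes s: "s \<in> W"
  shows "x \<in> carr \<A> \<Longrightarrow> \<phi> s (x s) \<in> carr C"
    and "x \<in> carr \<A> \<Longrightarrow> vnorm C (\<phi> s (x s)) \<le> vnorm \<A> x"
    and "\<lbrakk>x \<in> carr \<A>; y \<in> carr \<A>\<rbrakk> \<Longrightarrow> \<phi> s (vadd \<A> x y s) = vadd C (\<phi> s (x s)) (\<phi> s (y s))"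
    and "x \<in> carr \<A> \<Longrightarrow> \<phi> s (vscale \<A> c x s) = vscale C c (\<phi> s (x s))"
    and "\<lbrakk>x \<in> carr \<A>; y \<in> carr \<A>\<rbrakk> \<Longrightarrow> \<phi> s (amul \<A> x y s) = amul C (\<phi> s (x s)) (\<phi> s (y s))"
    and "\<phi> s (vzero (F s)) = vzero C"
proof -
  note D = isometric_isomorphismD[OF triv_iso[OF s]]
  have sO: "s \<in> \<Omega>"
    using s triv_subset by blast
  show "x \<in> carr \<A> \<Longrightarrow> \<phi> s (x s) \<in> carr C"
    and "x \<in> carr \<A> \<Longrightarrow> vnorm C (\<phi> s (x s)) \<le> vnorm \<A> x"
    and "\<lbrakk>x \<in> carr \<A>; y \<in> carr \<A>\<rbrakk> \<Longrightarrow> \<phi> s (vadd \<A> x y s) = vadd C (\<phi> s (x s)) (\<phi> s (y s))"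
    and "x \<in> carr \<A> \<Longrightarrow> \<phi> s (vscale \<A> c x s) = vscale C c (\<phi> s (x s))"
    and "\<lbrakk>x \<in> carr \<A>; y \<in> carr \<A>\<rbrakk> \<Longrightarrow> \<phi> s (amul \<A> x y s) = amul C (\<phi> s (x s)) (\<phi> s (y s))"
    using sO by (simp_all add: D field_carr linear_opD[OF D(1)] field_ops(2-4) norm_le_field_norm)
  show "\<phi> s (vzero (F s)) = vzero C"
    by (rule linear_op_vzero[OF D(1) fibre_space[OF sO] C.complex_vector_space_axioms])
qed

lemma transported_bilinear:
  assumes s: "s \<in> W" and t: "t \<in> W"
  shows "bounded_bilinear_op \<A> \<A> C (\<lambda>x y. amul C (\<phi> s (x s)) (\<phi> t (y t))) 1"
proof -
  have "vnorm C (amul C (\<phi> s (x s)) (\<phi> t (y t))) \<le> vnorm \<A> x * vnorm \<A> y"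
    if x: "x \<in> carr \<A>" and y: "y \<in> carr \<A>" for x y
  proof -
    have "vnorm C (amul C (\<phi> s (x s)) (\<phi> t (y t))) \<le> vnorm C (\<phi> s (x s)) * vnorm C (\<phi> t (y t))"
      by (rule C.vnorm_amul[OF triv_eval(1)[OF s x] triv_eval(1)[OF t y]])
    also have "\<dots> \<le> vnorm \<A> x * vnorm \<A> y"
      by (intro mult_mono triv_eval(2) C.vnorm_nonneg triv_eval(1) field_norm_nonneg s t x y)
    finally show ?thesis .
  qed
  then show ?thesis
    by (simp add: bounded_bilinear_op_def triv_eval[OF s] triv_eval[OF t] C.amul_closed
        C.amul_vadd_left C.amul_vadd_right C.amul_vscale_left C.amul_vscale_right)
qed

lemma transported:
  assumes "s \<in> W" "t \<in> W"
  shows "bounded_op A.AA C (L s t)"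
    and "\<lbrakk>x \<in> carr \<A>; y \<in> carr \<A>\<rbrakk> \<Longrightarrow>
      L s t (A.ten x y) = amul C (\<phi> s (x s)) (\<phi> t (y t))"
    and "u \<in> carr A.AA \<Longrightarrow> vnorm C (L s t u) \<le> vnorm A.AA u"
  using A.TT.tensor_lift[OF C.complex_banach_space_axioms transported_bilinear[OF assms]]
  by (simp_all add: transported_product_def)

lemmas transported_linear = linear_opD[OF bounded_op_linear[OF transported(1)]]

lemma zero_bounded: "bounded_op A.AA C (\<lambda>u. vzero C)"
  unfolding bounded_op_def linear_op_def
  by (auto simp: C.closed C.vadd_zero C.vscale_vzero C.seminorm_vzero intro!: exI[of _ 0])

lemma amul_vzero_C: "c \<in> carr C \<Longrightarrow> amul C (vzero C) c = vzero C" "c \<in> carr C \<Longrightarrow> amul C c (vzero C) = vzero C"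
  using C.amul_vscale_left[OF C.vzero_closed, of c 0] C.amul_vscale_right[OF _ C.vzero_closed, of c 0]
  by (simp_all add: C.vscale_vzero C.vscale_zero_left C.closed C.amul_closed)

lemma transported_ltensor_zero:
  assumes st: "s \<in> W" "t \<in> W" and a: "a \<in> carr \<A>" "a s = vzero (F s)" and u: "u \<in> carr A.AA"
  shows "L s t (A.ltensor a u) = vzero C"
proof (rule A.TT.proj_tensor_op_eqI[OF _ zero_bounded C.complex_normed_space_axioms _ u])
  show "bounded_op A.AA C (\<lambda>u. L s t (A.ltensor a u))"
    by (rule bounded_op_compose[OF A.ltensor(1)[OF a(1)] transported(1)[OF st]
          A.TT.P.seminormed A.TT.P.seminormed])
  show "L s t (A.ltensor a (A.ten x y)) = vzero C"
    if "x \<in> carr \<A>" "y \<in> carr \<A>" for x y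
    using that by (simp add: A.ltensor(2) a transported(2)[OF st] A.amul_closed triv_eval[OF st(1)]
        triv_eval(1)[OF st(2)] amul_vzero_C)
qed

lemma transported_rtensor_zero:
  assumes st: "s \<in> W" "t \<in> W" and a: "a \<in> carr \<A>" "a t = vzero (F t)" and u: "u \<in> carr A.AA"
  shows "L s t (A.rtensor u a) = vzero C"
proof (rule A.TT.proj_tensor_op_eqI[OF _ zero_bounded C.complex_normed_space_axioms _ u])
  show "bounded_op A.AA C (\<lambda>u. L s t (A.rtensor u a))"
    by (rule bounded_op_compose[OF A.rtensor(1)[OF a(1)] transported(1)[OF st]
          A.TT.P.seminormed A.TT.P.seminormed])
  show "L s t (A.rtensor (A.ten x y) a) = vzero C"
    if "x \<in> carr \<A>" "y \<in> carr \<A>" for x y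
    using that by (simp add: A.rtensor(2) a transported(2)[OF st] A.amul_closed triv_eval[OF st(2)]
        triv_eval(1)[OF st(1)] amul_vzero_C)
qed

text \<open>
  For \<open>g(s) = 1\<close> and \<open>g(t) = 0\<close>, the tensor \<open>\<rho> (a b)\<close> is the sum of \<open>\<rho> (a (g b)) = \<rho> a \<cdot> (g b)\<close>, whose
  second factors vanish at \<open>t\<close>, and \<open>\<rho> (((1 - g) a) b) = ((1 - g) a) \<cdot> \<rho> b\<close>, whose first factors
  vanish at \<open>s\<close>.
\<close>

lemma splitting_off_diagonal:
  assumes st: "s \<in> W" "t \<in> W" "s \<noteq> t" and x: "x \<in> carr \<A>"
  shows "L s t (\<rho> x) = vzero C"
  using x
proof (induction rule: products_induct)
  case (product a b)
  have O: "s \<in> \<Omega>" "t \<in> \<Omega>"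
    using st triv_subset by auto
  obtain g where g: "multiplier g" "multiplier (\<lambda>r. 1 - g r)" "g s = 1" "g t = 0"
    using point_separator[OF O st(3)] by blast
  let ?gb = "fun_scale g b" and ?ga = "fun_scale (\<lambda>r. 1 - g r) a"
  have c: "?gb \<in> carr \<A>" "?ga \<in> carr \<A>"
    by (simp_all add: fun_scale_closed g product)
  have z: "?gb t = vzero (F t)" "?ga s = vzero (F s)"
    using O g(3,4) product
    by (simp_all add: fun_scale_def complex_vector_space.vscale_zero_left[OF fibre_space] field_carr)
  have "amul \<A> a b = vadd \<A> (amul \<A> a ?gb) (amul \<A> ?ga b)"
    using fun_scale_complement[of "amul \<A> a b" g] product
    by (simp add: A.amul_closed fun_scale_amul(1)[of a b "\<lambda>r. 1 - g r"] fun_scale_amul(2)[of a b g])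
  then have "\<rho> (amul \<A> a b) = vadd A.AA (\<rho> (amul \<A> a ?gb)) (\<rho> (amul \<A> ?ga b))"
    by (simp add: splitting_linear A.amul_closed c product)
  also have "\<dots> = vadd A.AA (A.rtensor (\<rho> a) ?gb) (A.ltensor ?ga (\<rho> b))"
    by (simp only: splitting_amul(1)[OF c(2) product(2)] splitting_amul(2)[OF product(1) c(1)])
  finally show ?case
    by (simp add: transported_linear[OF st(1,2)] A.rtensor_linear A.ltensor_linear c splitting_linear
        product transported_ltensor_zero[OF st(1,2)] transported_rtensor_zero[OF st(1,2)] z
        C.vadd_zero C.closed)
next
  case (add x y)
  then show ?case
    by (simp add: splitting_linear transported_linear[OF st(1,2)] C.vadd_zero C.closed)
next
  case (lim r x)
  note comp = bounded_op_compose[OF splitting_bounded transported(1)[OF st(1,2)]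
      A.seminormed A.TT.P.seminormed]
  show ?case
  proof (rule C.vlim_unique)
    show "vlim C (\<lambda>n. L s t (\<rho> (r n))) (L s t (\<rho> x))"
      by (rule vlim_bounded_op[OF comp A.seminormed C.seminormed
            lim(1-3)])
    show "vlim C (\<lambda>n. L s t (\<rho> (r n))) (vzero C)"
      by (simp add: lim(4) C.vlim_const)
  qed (simp_all add: transported_linear[OF st(1,2)] splitting_linear lim C.closed)
qed

lemma splitting_diagonal:
  assumes t: "t \<in> W" and x: "x \<in> carr \<A>"
  shows "L t t (\<rho> x) = \<phi> t (x t)"
proof -
  have tO: "t \<in> \<Omega>"
    using t triv_subset by blast
  have "L t t u = \<phi> t (product_map \<A> u t)" if u: "u \<in> carr A.AA" for u
  proof (rule A.TT.proj_tensor_op_eqI[OF transported(1)[OF t t] _ C.complex_normed_space_axioms _ u])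
    have "bounded_op (F t) C (\<phi> t)"
      using isometric_isomorphismD(1,4)[OF triv_iso[OF t]]
      by (auto simp: bounded_op_def intro!: exI[of _ 1])
    from bounded_op_compose[OF bounded_op_compose[OF A.product_map(1) eval_bounded[OF tO]
          A.TT.P.seminormed A.seminormed] this
        A.TT.P.seminormed fibre_seminormed[OF tO]]
    show "bounded_op A.AA C (\<lambda>u. \<phi> t (product_map \<A> u t))" .
    show "L t t (A.ten x y) = \<phi> t (product_map \<A> (A.ten x y) t)"
      if "x \<in> carr \<A>" "y \<in> carr \<A>" for x y
      using that by (simp add: transported(2)[OF t t] A.product_map(2) triv_eval(5)[OF t])
  qed
  then show ?thesis
    using x by (simp add: splitting_linear product_splitting)
qed

lemma eventually_triv: "s \<in> W \<Longrightarrow> eventually (\<lambda>t. t \<in> W) (atin X s)"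
  using triv unfolding eventually_atin trivialization_def by blast

text \<open>
  For an elementary tensor this is continuity of a section in the trivialization.  It passes to
  limits because the operators are contractions, so approximation is uniform in \<open>t\<close>.
\<close>

lemma transported_continuous:
  assumes s: "s \<in> W" and u: "u \<in> carr A.AA"
  shows "((\<lambda>t. vdist C (L s t u) (L s s u)) \<longlongrightarrow> 0) (atin X s)"
  using u
proof (induction rule: A.TT.proj_tensor_induct)
  case (elem x y)
  let ?c = "\<phi> s (x s)"
  have c: "?c \<in> carr C"
    by (rule triv_eval(1)[OF s elem(1)])
  have conv: "((\<lambda>t. vdist C (\<phi> t (y t)) (\<phi> s (y s))) \<longlongrightarrow> 0) (atin X s)"
  proof (rule tendstoI)
    fix e :: real
    assume e: "0 < e"
    have "y \<in> sections U"
      using elem(2) by (simp add: carr_field_algebra)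
    then obtain N where N: "openin X N" "s \<in> N" "\<forall>t\<in>N. vdist C (\<phi> t (y t)) (\<phi> s (y s)) \<le> e / 2"
      using triv s e unfolding trivialization_def by (meson half_gt_zero)
    then have "vdist C (\<phi> t (y t)) (\<phi> s (y s)) < e" if "t \<in> N" for t
      using that e by fastforce
    then show "eventually (\<lambda>t. dist (vdist C (\<phi> t (y t)) (\<phi> s (y s))) 0 < e) (atin X s)"
      using N(1,2) by (auto simp: eventually_atin C.vdist_nonneg)
  qed
  have "vdist C (L s t (A.ten x y)) (L s s (A.ten x y)) \<le> vnorm C ?c * vdist C (\<phi> t (y t)) (\<phi> s (y s))"
    if tW: "t \<in> W" for t
    unfolding transported(2)[OF s tW elem] transported(2)[OF s s elem]
    using bounded_op_linear[OF bounded_op_amul(1)[OF C.complex_banach_algebra_axioms c]] C.vnorm_amul[OF c]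
    by (rule vdist_linear_op_le[OF _ _ C.seminormed triv_eval(1)[OF tW elem(2)] triv_eval(1)[OF s elem(2)]])
  then have "eventually (\<lambda>t. vdist C (L s t (A.ten x y)) (L s s (A.ten x y)) \<le>
      vnorm C ?c * vdist C (\<phi> t (y t)) (\<phi> s (y s))) (atin X s)"
    using eventually_triv[OF s] by (rule eventually_mono[rotated])
  then show ?case
    by (rule tendsto_sandwich[OF always_eventually _ tendsto_const
          tendsto_mult_right_zero[OF conv, of "vnorm C ?c"], rotated]) (simp add: C.vdist_nonneg)
next
  case (add u v)
  have "vdist C (L s t (vadd A.AA u v)) (L s s (vadd A.AA u v)) \<le>
      vdist C (L s t u) (L s s u) + vdist C (L s t v) (L s s v)" if "t \<in> W" for t
    using add(1,2) by (simp add: transported_linear[OF s that] transported_linear[OF s s] C.vdist_vadd)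
  then have "eventually (\<lambda>t. vdist C (L s t (vadd A.AA u v)) (L s s (vadd A.AA u v)) \<le>
      vdist C (L s t u) (L s s u) + vdist C (L s t v) (L s s v)) (atin X s)"
    using eventually_triv[OF s] by (rule eventually_mono[rotated])
  then show ?case
    by (rule tendsto_sandwich[OF always_eventually _ tendsto_const
          tendsto_add[OF add(3,4), unfolded add_0], rotated]) (simp add: C.vdist_nonneg)
next
  case (lim r u)
  show ?case
  proof (rule tendstoI)
    fix e :: real
    assume "0 < e"
    then have e: "0 < e / 3"
      by simp
    then have "eventually (\<lambda>n. vdist A.AA (r n) u < e / 3) sequentially"
      using order_tendstoD(2)[OF lim(3)[unfolded vlim_def]] by blast
    then obtain n where n: "vdist A.AA (r n) u < e / 3"
      using eventually_happens'[OF sequentially_bot] by blast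
    have less: "vdist C (L s t u) (L s s u) < e" if tW: "t \<in> W" and t: "vdist C (L s t (r n)) (L s s (r n)) < e / 3" for t
    proof -
      have near: "vdist C (L s t' (r n)) (L s t' u) < e / 3" if "t' \<in> W" for t'
        using vdist_linear_op_le[OF bounded_op_linear[OF transported(1)[OF s that]] _
            A.TT.P.seminormed lim(1)[of n] lim(2), of 1] transported(3)[OF s that] n by simp
      have c: "L s t' v \<in> carr C" if "t' \<in> W" "v \<in> carr A.AA" for t' v
        using transported_linear(1)[OF s] that by blast
      have "vdist C (L s t u) (L s s u) \<le> vdist C (L s t u) (L s t (r n)) + vdist C (L s t (r n)) (L s s u)"
        by (intro C.vdist_triangle c s tW lim)
      moreover have "vdist C (L s t (r n)) (L s s u) \<le>
          vdist C (L s t (r n)) (L s s (r n)) + vdist C (L s s (r n)) (L s s u)"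
        by (intro C.vdist_triangle c s tW lim)
      ultimately show ?thesis
        using near[OF tW] near[OF s] t by (simp add: C.vdist_commute[of "L s t u"])
    qed
    show "eventually (\<lambda>t. dist (vdist C (L s t u) (L s s u)) 0 < e) (atin X s)"
      using order_tendstoD(2)[OF lim(4)[of n] e] eventually_triv[OF s]
      by eventually_elim (simp add: C.vdist_nonneg less)
  qed
qed

text \<open>
  At a limit point \<open>s\<close> the diagonal value \<open>\<phi>\<^sub>s (x(s))\<close> is a limit of off-diagonal values, hence
  zero, for every \<open>x\<close>.
\<close>

lemma zero_fibre_if_not_isolated:
  assumes s: "s \<in> W" and not_open: "\<not> openin X {s}" and x: "x \<in> carr \<A>"
  shows "x s = vzero (F s)"
proof -
  have sO: "s \<in> \<Omega>"
    using s triv_subset by blast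
  let ?d = "\<phi> s (x s)"
  have d: "?d \<in> carr C"
    by (rule triv_eval(1)[OF s x])
  have "N \<noteq> {s}" if "openin X N" for N
    using that not_open by blast
  then have "atin X s \<noteq> bot"
    unfolding nontrivial_limit_atin in_derived_set_of using sO openin_subset by blast
  moreover have "eventually (\<lambda>t. t \<noteq> s) (atin X s)"
    unfolding eventually_atin using sO by blast
  then have "eventually (\<lambda>t. vdist C (L s t (\<rho> x)) (L s s (\<rho> x)) = vnorm C ?d) (atin X s)"
    using eventually_triv[OF s]
    by eventually_elim
      (use d in \<open>simp add: splitting_off_diagonal[OF s] x splitting_diagonal[OF s] C.vdist_commute[of "vzero C"]
        C.vdist_vzero\<close>)
  then have "((\<lambda>t. vnorm C ?d) \<longlongrightarrow> 0) (atin X s)"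
    using transported_continuous[OF s splitting_linear(1)[OF x]] by (simp cong: tendsto_cong)
  ultimately have "vnorm C ?d = 0"
    by (simp add: tendsto_const_iff)
  then have "vnorm (F s) (x s) = 0"
    using isometric_isomorphismD(4)[OF triv_iso[OF s] field_carr[OF x sO]] by simp
  then show ?thesis
    using complex_normed_space.vnorm_eq_0_iff[OF fibre_normed[OF sO] field_carr[OF x sO]] by simp
qed

end

theorem base_discrete:
  assumes nonzero: "\<And>t. t \<in> \<Omega> \<Longrightarrow> carr (F t) \<noteq> {vzero (F t)}"
  shows "X = discrete_topology \<Omega>"
proof -
  have "openin X {t}" if t: "t \<in> \<Omega>" for t
  proof (rule ccontr)
    assume not_open: "\<not> openin X {t}"
    obtain W C \<phi> where W: "t \<in> W" "trivialization W C \<phi>"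
      using trivialization_exists[OF locally_trivial t] .
    have "a = vzero (F t)" if a: "a \<in> carr (F t)" for a
    proof -
      obtain x where "x \<in> carr \<A>" "x t = a"
        using section_through[OF locally_trivial t a] by blast
      then show ?thesis
        using zero_fibre_if_not_isolated[OF W(2,1) not_open] by blast
    qed
    then have "carr (F t) = {vzero (F t)}"
      using fibre_closed(1)[OF t] by blast
    with nonzero[OF t] show False
      by contradiction
  qed
  then have "discrete_topology \<Omega> = X"
    by (simp add: discrete_topology_unique)
  then show ?thesis
    by simp
qed

end

theorem theorem5p1:
  fixes U :: "('t, 'a) cfield"
  assumes "continuous_field U"
    and "locally_trivial U"
    and "biprojective (field_algebra U)"
  shows "uniformly_biprojective (topspace (base U)) (fibre U) \<and>
    ((\<forall>t\<in>topspace (base U). carr (fibre U t) \<noteq> {vzero (fibre U t)}) \<longrightarrow>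
      base U = discrete_topology (topspace (base U)))"
proof -
  interpret banach_field U
    using assms(1) by unfold_locales
  obtain \<rho> where "bimodule_morphism \<A> (regular_bimodule \<A>) (tensor_bimodule \<A>) \<rho>"
    "\<And>x. x \<in> carr \<A> \<Longrightarrow> product_map \<A> (\<rho> x) = x"
    using A.biprojective_splitting[OF assms(3)] by blast
  then interpret split_field U \<rho>
    using assms(2) by unfold_locales
  show ?thesis
    using fibres_uniformly_biprojective base_discrete by blast
qed

end
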